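(* Let $\mathcal T$ be a locally finite tree and let $G$ be a group acting by automorphisms on $\mathcal T$ such that the subgroup $G^+$ of type-preserving automorphisms in $G$ is strongly transitive. Let $e$ be a distinguished edge, $\mathcal B$ the subgroup of $G$ fixing $e$ pointwise, $\mathcal A$ a doubly-infinite geodesic containing $e$, and let $W$, $\widetilde W$, $s$, $t$, $i$, $\Delta_w$ be as defined in the context. The complete multiplication tables for the canonical generators are given by: (1) For the algebra $\mathbb C[G^+,\mathcal B]$, let $w,w'\in W$, written as reduced words in $\{s,t\}$. Denote by $w_{(j)}$ (respectively $w_{[j]}$) the word consisting of (respectively missing) the last $j$ letters of $w$, so that $w=w_{[j]}w_{(j)}$, and by ${}_{(j)}w'$ (respectively ${}_{[j]}w'$) the word consisting of (respectively missing) the first $j$ letters of $w'$, so that $w'={}_{(j)}w'\,{}_{[j]}w'$. For a word $v$ with reduced decomposition $s_1\cdots s_n$ put $q_v:=\prod_{k=1}^nq_{s_k}$, where $q_r=R(\Delta_r)$ for $r\in\{s,t\}$. (a) If the last letter of the reduced decomposition of $w$ differs from the first letter of the reduced decomposition of $w'$, then $\Delta_w\Delta_{w'}=\Delta_{ww'}$. (b) Suppose the last letter of the reduced decomposition of $w$ coincides with the first letter of the reduced decomposition of $w'$; call this common letter $r$ and let $u$ be the other element of $\{s,t\}$. For $j$ even let $q_j:=q_r$ and for $j$ odd let $q_j:=q_u$. Let $m$ be the length of the shorter word among $w$ and $w'$, and let $s_j$ be the $j$-th letter of $w'$. Then $$\Delta_w\Delta_{w'}=q_{w_{(m)}}\,\Delta_{w_{[m]}\,{}_{[m]}w'}+\sum_{j=0}^{m-1}q_{w_{(j)}}\,(q_j-1)\,\Delta_{w_{[j+1]}\,s_{j+1}\,{}_{[j+1]}w'}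 .$$ (2) When $G\ne G^+$, the products of elements of the standard basis of the algebra $\mathbb C[G,\mathcal B]$ are determined using the information given in (1) and the following relations for $w,w'\in W$: $$\Delta_{iw}\Delta_{w'}=\Delta_i(\Delta_w\Delta_{w'}),\qquad \Delta_w\Delta_{iw'}=\Delta_i(\Delta_{\overline w}\Delta_{w'}),\qquad \Delta_{iw}\Delta_{iw'}=\Delta_{\overline w}\Delta_{w'},$$ where $w\mapsto\overline w$ is the automorphism of $W$ exchanging $s$ and $t$.
   Context: Hecke algebras. A pair $(G,H)$ of a group and a subgroup is a Hecke pair if every double coset $HgH$ is a finite union of right cosets $Hx$ (equivalently, every double coset is a finite union of left cosets $xH$). For a Hecke pair, $\mathbb Z[G,H]$ is the free $\mathbb Z$-module on the set $H\backslash G/H$ of double cosets (the canonical or standard basis) with the associative multiplication $$HgH\cdot Hg'H=\sum_{HxH\in H\backslash G/H}\alpha(g,g';x)\,HxH,\qquad \alpha(g,g';x)=\#\{(i,j): g_ig'_j\in Hx\},$$ where $HgH=\bigsqcup_i Hg_i$ and $Hg'H=\bigsqcup_j Hg'_j$. Its unit is $H$. Put $\mathbb C[G,H]=\mathbb Z[G,H]\otimes_{\mathbb Z}\mathbb C$. $R(HxH)$ denotes the number of right $H$-cosets contained in $HxH$. Trees. The vertex set of a tree has a unique bipartition into two types such that adjacent vertices have different types; an automorphism is type-preserving if it preserves each type. A doubly-infinite geodesic is a subgraph isomorphic to the real line triangulated by $\mathbb Z$. A group of type-preserving automorphisms of a tree is strongly transitive if it acts transitively on the set of doubly-infinite geodesics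 and the stabilizer of some doubly-infinite geodesic acts transitively on the set of its edges; the group is also understood to act transitively on the set of all (unoriented) edges of the tree. Setting. $(G,\mathcal B)$ and $(G^+,\mathcal B)$ are Hecke pairs. $N^+$ (respectively $N$) is the setwise stabilizer of $\mathcal A$ in $G^+$ (respectively $G$), $T$ is the pointwise stabilizer of $\mathcal A$ (in $G$, equivalently in $G^+$), which is contained in $\mathcal B$, and $W=N^+/T$, $\widetilde W=N/T$. $W$ is the infinite dihedral group of type-preserving automorphisms of $\mathcal A$, generated by the two involutions $s,t$ which map $e$ to its two neighbouring edges in $\mathcal A$; every element of $W$ has a unique reduced (alternating) word in $s,t$. If $G\ne G^+$, $i\in G$ is an element that exchanges the vertices of $e$ and stabilizes $\mathcal A$; its image in $\widetilde W$ is also denoted $i$, and $\widetilde W=W\sqcup iW$. For $w$ in $W$ or $\widetilde W$, $\Delta_w$ is the element of the Hecke algebra given by the double coset $\mathcal Bw\mathcal B$ (that is, $\mathcal Bn\mathcal B$ for any representative $n$ of $w$). The $\Delta_w$, $w\in W$, form the canonical basis of $\mathbb C[G^+,\mathcal B]$, and if $G\neq G^+$ the $\Delta_w$, $w\in\widetilde W$, form that of $\mathbb C[G,\mathcal B]$. *)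

theory Defs
  imports
    Complex_Main
    "HOL-Algebra.Group_Action"
    "HOL-Library.Poly_Mapping"
begin

section \<open>Hecke algebras\<close>

definition double_coset :: "('g, 'm) monoid_scheme \<Rightarrow> 'g set \<Rightarrow> 'g \<Rightarrow> 'g set" where
  "double_coset G H g = H <#>\<^bsub>G\<^esub> (g <#\<^bsub>G\<^esub> H)"

definition double_cosets :: "('g, 'm) monoid_scheme \<Rightarrow> 'g set \<Rightarrow> 'g set set" where
  "double_cosets G H = double_coset G H ` carrier G"

definition rcosets_in :: "('g, 'm) monoid_scheme \<Rightarrow> 'g set \<Rightarrow> 'g set \<Rightarrow> 'g set set" where
  "rcosets_in G H D = {C \<in> rcosets\<^bsub>G\<^esub> H. C \<subseteq> D}"

text \<open>The number \<open>R(D)\<close> of right cosets in a double coset.\<close>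

definition rcoset_number :: "('g, 'm) monoid_scheme \<Rightarrow> 'g set \<Rightarrow> 'g set \<Rightarrow> nat" where
  "rcoset_number G H D = card (rcosets_in G H D)"

locale hecke_pair = group G + subgroup H G for G (structure) and H +
  assumes finite_rcosets_in: "g \<in> carrier G \<Longrightarrow> finite (rcosets_in G H (double_coset G H g))"

definition coset_rep :: "'g set \<Rightarrow> 'g" where
  "coset_rep C = (SOME g. g \<in> C)"

text \<open>
  The number of pairs \<open>(i, j)\<close> with \<open>g\<^sub>i g'\<^sub>j \<in> H x\<close>, where \<open>D\<close> and \<open>D'\<close> are the disjoint
  unions of the right cosets \<open>H g\<^sub>i\<close> and \<open>H g'\<^sub>j\<close>. The index \<open>i\<close> is the right coset itself and
  \<open>g\<^sub>i\<close> is a chosen representative; the number does not depend on the choices.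
\<close>

definition hecke_coeff ::
    "('g, 'm) monoid_scheme \<Rightarrow> 'g set \<Rightarrow> 'g set \<Rightarrow> 'g set \<Rightarrow> 'g \<Rightarrow> nat" where
  "hecke_coeff G H D D' x =
     card {(C, C'). C \<in> rcosets_in G H D \<and> C' \<in> rcosets_in G H D' \<and>
                    coset_rep C \<otimes>\<^bsub>G\<^esub> coset_rep C' \<in> H #>\<^bsub>G\<^esub> x}"

text \<open>
  Elements of the complex Hecke algebra of \<open>(G, H)\<close> are finitely supported complex functions on
  the set of double cosets; \<open>Poly_Mapping.single D 1\<close> is the basis element given by \<open>D\<close>.
\<close>

type_synonym 'g hecke = "'g set \<Rightarrow>\<^sub>0 complex"

definition hecke_scale :: "complex \<Rightarrow> 'g hecke \<Rightarrow> 'g hecke" (infixr \<open>*\<^sub>H\<close> 75) where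
  "c *\<^sub>H f = Poly_Mapping.map (\<lambda>z. c * z) f"

definition hecke_basis :: "('g, 'm) monoid_scheme \<Rightarrow> 'g set \<Rightarrow> 'g hecke set" where
  "hecke_basis G H = (\<lambda>D. Poly_Mapping.single D 1) ` double_cosets G H"

text \<open>
  For a Hecke pair, only finitely many double cosets have a nonzero coefficient, so the sum below
  is a genuine finite sum.
\<close>

definition double_coset_mult :: "('g, 'm) monoid_scheme \<Rightarrow> 'g set \<Rightarrow> 'g set \<Rightarrow> 'g set \<Rightarrow> 'g hecke" where
  "double_coset_mult G H D D' =
     (\<Sum>X | X \<in> double_cosets G H \<and> hecke_coeff G H D D' (coset_rep X) \<noteq> 0.
        of_nat (hecke_coeff G H D D' (coset_rep X)) *\<^sub>H Poly_Mapping.single X 1)"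

definition hecke_mult ::
    "('g, 'm) monoid_scheme \<Rightarrow> 'g set \<Rightarrow> 'g hecke \<Rightarrow> 'g hecke \<Rightarrow> 'g hecke" where
  "hecke_mult G H f f' =
     (\<Sum>D\<in>Poly_Mapping.keys f. \<Sum>D'\<in>Poly_Mapping.keys f'.
        (Poly_Mapping.lookup f D * Poly_Mapping.lookup f' D') *\<^sub>H double_coset_mult G H D D')"


section \<open>Trees and their automorphisms\<close>

text \<open>A simple graph is a pair of a vertex set and a set of two-element sets of vertices.\<close>

type_synonym 'v graph = "'v set \<times> 'v set set"

definition adjacent :: "'v graph \<Rightarrow> 'v \<Rightarrow> 'v \<Rightarrow> bool" where
  "adjacent X u v \<longleftrightarrow> {u, v} \<in> snd X"

definition simple_graph :: "'v graph \<Rightarrow> bool" where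
  "simple_graph X \<longleftrightarrow> (\<forall>e\<in>snd X. e \<subseteq> fst X \<and> card e = 2)"

definition connected_graph :: "'v graph \<Rightarrow> bool" where
  "connected_graph X \<longleftrightarrow> fst X \<noteq> {} \<and>
     (\<forall>u\<in>fst X. \<forall>v\<in>fst X. \<exists>p. p \<noteq> [] \<and> hd p = u \<and> last p = v \<and> successively (adjacent X) p)"

definition graph_cycle :: "'v graph \<Rightarrow> 'v list \<Rightarrow> bool" where
  "graph_cycle X p \<longleftrightarrow>
     3 \<le> length p \<and> distinct p \<and> successively (adjacent X) p \<and> adjacent X (last p) (hd p)"

definition tree :: "'v graph \<Rightarrow> bool" where
  "tree X \<longleftrightarrow> simple_graph X \<and> connected_graph X \<and> (\<nexists>p. graph_cycle X p)"

definition locally_finite :: "'v graph \<Rightarrow> bool" where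
  "locally_finite X \<longleftrightarrow> (\<forall>v\<in>fst X. finite {u. adjacent X v u})"

text \<open>
  The action is not assumed to be faithful, and an element may invert an edge.
\<close>

definition acts_by_automorphisms ::
    "('g, 'm) monoid_scheme \<Rightarrow> 'v graph \<Rightarrow> ('g \<Rightarrow> 'v \<Rightarrow> 'v) \<Rightarrow> bool" where
  "acts_by_automorphisms G X \<phi> \<longleftrightarrow>
     group_action G (fst X) \<phi> \<and> (\<forall>g\<in>carrier G. (\<lambda>e. \<phi> g ` e) ` snd X = snd X)"

definition bipartition :: "'v graph \<Rightarrow> 'v set \<Rightarrow> 'v set \<Rightarrow> bool" where
  "bipartition X P Q \<longleftrightarrow>
     P \<union> Q = fst X \<and> P \<inter> Q = {} \<and> (\<forall>e\<in>snd X. e \<inter> P \<noteq> {} \<and> e \<inter> Q \<noteq> {})"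

definition type_preserving :: "'v graph \<Rightarrow> ('v \<Rightarrow> 'v) \<Rightarrow> bool" where
  "type_preserving X f \<longleftrightarrow> (\<forall>P Q. bipartition X P Q \<longrightarrow> f ` P = P \<and> f ` Q = Q)"

definition type_preserving_part ::
    "('g, 'm) monoid_scheme \<Rightarrow> 'v graph \<Rightarrow> ('g \<Rightarrow> 'v \<Rightarrow> 'v) \<Rightarrow> 'g set" where
  "type_preserving_part G X \<phi> = {g \<in> carrier G. type_preserving X (\<phi> g)}"

text \<open>Subgraphs isomorphic to the line with vertex set the integers.\<close>

definition biinfinite_geodesics :: "'v graph \<Rightarrow> 'v graph set" where
  "biinfinite_geodesics X =
     {A. \<exists>l :: int \<Rightarrow> 'v. inj l \<and> fst A = range l \<and> snd A = range (\<lambda>k. {l k, l (k + 1)}) \<and>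
         fst A \<subseteq> fst X \<and> snd A \<subseteq> snd X}"

definition graph_image :: "('v \<Rightarrow> 'v) \<Rightarrow> 'v graph \<Rightarrow> 'v graph" where
  "graph_image f A = (f ` fst A, (\<lambda>e. f ` e) ` snd A)"

definition setwise_stabilizer :: "'g set \<Rightarrow> ('g \<Rightarrow> 'v \<Rightarrow> 'v) \<Rightarrow> 'v graph \<Rightarrow> 'g set" where
  "setwise_stabilizer K \<phi> A = {g \<in> K. graph_image (\<phi> g) A = A}"

definition pointwise_stabilizer :: "'g set \<Rightarrow> ('g \<Rightarrow> 'v \<Rightarrow> 'v) \<Rightarrow> 'v set \<Rightarrow> 'g set" where
  "pointwise_stabilizer K \<phi> S = {g \<in> K. \<forall>v\<in>S. \<phi> g v = v}"

definition strongly_transitive :: "'g set \<Rightarrow> 'v graph \<Rightarrow> ('g \<Rightarrow> 'v \<Rightarrow> 'v) \<Rightarrow> bool" where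
  "strongly_transitive K X \<phi> \<longleftrightarrow>
     (\<forall>A\<in>biinfinite_geodesics X. \<forall>A'\<in>biinfinite_geodesics X. \<exists>g\<in>K. graph_image (\<phi> g) A = A') \<and>
     (\<exists>A\<in>biinfinite_geodesics X. \<forall>f\<in>snd A. \<forall>f'\<in>snd A.
        \<exists>g\<in>setwise_stabilizer K \<phi> A. \<phi> g ` f = f') \<and>
     (\<forall>f\<in>snd X. \<forall>f'\<in>snd X. \<exists>g\<in>K. \<phi> g ` f = f')"

definition neighbour_edges :: "'v graph \<Rightarrow> 'v set \<Rightarrow> 'v set set" where
  "neighbour_edges A e = {f \<in> snd A. f \<noteq> e \<and> f \<inter> e \<noteq> {}}"


section \<open>Words\<close>

definition word_prod :: "('w, 'm) monoid_scheme \<Rightarrow> 'w list \<Rightarrow> 'w" where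
  "word_prod W xs = foldr (\<lambda>x y. x \<otimes>\<^bsub>W\<^esub> y) xs \<one>\<^bsub>W\<^esub>"

definition is_reduced_word :: "('w, 'm) monoid_scheme \<Rightarrow> 'w set \<Rightarrow> 'w \<Rightarrow> 'w list \<Rightarrow> bool" where
  "is_reduced_word W S w xs \<longleftrightarrow> set xs \<subseteq> S \<and> word_prod W xs = w \<and>
     (\<forall>ys. set ys \<subseteq> S \<and> word_prod W ys = w \<longrightarrow> length xs \<le> length ys)"

definition reduced_word :: "('w, 'm) monoid_scheme \<Rightarrow> 'w set \<Rightarrow> 'w \<Rightarrow> 'w list" where
  "reduced_word W S w = (THE xs. is_reduced_word W S w xs)"

definition last_letters :: "nat \<Rightarrow> 'w list \<Rightarrow> 'w list" where
  "last_letters j xs = drop (length xs - j) xs"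

definition drop_last_letters :: "nat \<Rightarrow> 'w list \<Rightarrow> 'w list" where
  "drop_last_letters j xs = take (length xs - j) xs"


section \<open>The basis elements indexed by the Weyl group\<close>

text \<open>
  An element \<open>w\<close> of \<open>N/T\<close> is a coset of \<open>T\<close>, and \<open>T \<subseteq> B\<close>, so the product \<open>B w B\<close> of subsets of \<open>G\<close>
  is the double coset of any representative of \<open>w\<close>.
\<close>

definition weyl_double_coset :: "('g, 'm) monoid_scheme \<Rightarrow> 'g set \<Rightarrow> 'g set \<Rightarrow> 'g set" where
  "weyl_double_coset G B w = B <#>\<^bsub>G\<^esub> w <#>\<^bsub>G\<^esub> B"

definition Delta :: "('g, 'm) monoid_scheme \<Rightarrow> 'g set \<Rightarrow> 'g set \<Rightarrow> 'g hecke" where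
  "Delta G B w = Poly_Mapping.single (weyl_double_coset G B w) 1"

end

theory Submission
  imports Defs
begin

text \<open>
  The product of double cosets counts right cosets: the coefficient of \<open>H x H\<close> in \<open>D D'\<close> is the
  number of cosets \<open>H g' \<subseteq> D'\<close> with \<open>x g'\<^sup>-\<^sup>1 \<in> D\<close>, and in this form associativity is a bijection
  between pairs of cosets.

  Let \<open>l\<close> parametrize the geodesic, with \<open>{l 0, l 1}\<close> the distinguished edge. The retraction of the
  tree onto the line centred at this edge sends a vertex to the vertex of the line at the same
  distances from \<open>l 0\<close> and \<open>l 1\<close>. Strong transitivity implies that \<open>B\<close> realizes this retraction on
  every edge, since each edge lies on a doubly-infinite geodesic that contains half of the line. Hence
  \<open>B g B\<close> is determined by one integer, the position \<open>j\<close> of the edge \<open>{l j, l (j + 1)}\<close> to which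
  \<open>g {l 0, l 1}\<close> retracts. Elements at position \<open>-1\<close> fix \<open>l 0\<close> and turn the positive side of the tree
  to the negative side, and those at position \<open>1\<close> do the converse around \<open>l 1\<close>. This yields
  \<open>\<Delta>\<^sub>r \<Delta>\<^sub>w = \<Delta>\<^bsub>r w\<^esub>\<close> when \<open>r w\<close> is longer than \<open>w\<close>; and \<open>B \<union> B r B\<close>, being the stabilizer of a vertex, is a
  group, which yields the quadratic relation \<open>\<Delta>\<^sub>r\<^sup>2 = q\<^sub>r + (q\<^sub>r - 1) \<Delta>\<^sub>r\<close>. The multiplication table
  follows from associativity by cancelling one letter of the reduced words at a time. An element
  \<open>i\<close> that inverts the edge normalizes \<open>B\<close>, so that \<open>\<Delta>\<^sub>i \<Delta>\<^sub>w = \<Delta>\<^bsub>i w\<^esub>\<close> and \<open>\<Delta>\<^sub>w \<Delta>\<^sub>i = \<Delta>\<^bsub>w i\<^esub>\<close>, and it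
  reverses positions, as does the automorphism that exchanges the two generators.
\<close>

section \<open>Hecke algebras\<close>

text \<open>A position records only an unoriented edge. It still determines a double coset because
  types are preserved: the image of \<open>l 0\<close> retracts to an even coordinate, so the parity
  of the position restores the orientation.

  In \<open>W\<close> the generators act on positions by p -> -p - 1 and p -> 1 - p, the effect on
  edges of the reflections of the line in \<open>l 0\<close> and \<open>l 1\<close>. Hence the
  absolute value of the position is the reduced length, and its sign gives the first letter:
  negative for \<open>s\<close>, positive for \<open>t\<close>. The length condition of the product
  rule thus becomes an inequality between integers, which can be checked on distances in the tree.

  The retraction is defined by distances alone, so its invariance under \<open>B\<close> is
  immediate; the work lies in finding one element of \<open>B\<close> that carries both ends of an
  edge onto the line at once. The algebras of \<open>Gp\<close> and \<open>G\<close> are formed over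
  different carriers, and parity of displacement shows that their products agree on type-preserving
  double cosets.\<close>

lemma lookup_hecke_scale [simp]: "Poly_Mapping.lookup (c *\<^sub>H f) X = c * Poly_Mapping.lookup f X"
  unfolding hecke_scale_def by (simp add: Poly_Mapping.map.rep_eq when_def)

lemma hecke_scale_one [simp]: "1 *\<^sub>H f = f"
  by (rule poly_mapping_eqI) simp

lemma hecke_scale_scale [simp]: "a *\<^sub>H b *\<^sub>H f = (a * b) *\<^sub>H f"
  by (rule poly_mapping_eqI) simp

lemma hecke_scale_add: "a *\<^sub>H (f + g) = a *\<^sub>H f + a *\<^sub>H g"
  by (rule poly_mapping_eqI) (simp add: lookup_add distrib_left)

lemma hecke_scale_sum: "a *\<^sub>H (\<Sum>i\<in>I. f i) = (\<Sum>i\<in>I. a *\<^sub>H f i)"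
  by (rule poly_mapping_eqI) (simp add: lookup_sum sum_distrib_left)

text \<open>Cancellation can make the keys of \<open>f + g\<close> smaller than the union of the
  keys. Allowing any finite supersets of the supports lets both sides of a bilinearity law be summed
  over the same index sets.\<close>

lemma lookup_hecke_mult:
  assumes "finite S" "Poly_Mapping.keys f \<subseteq> S" "finite S'" "Poly_Mapping.keys f' \<subseteq> S'"
  shows "Poly_Mapping.lookup (hecke_mult G H f f') X =
    (\<Sum>D\<in>S. \<Sum>D'\<in>S'. Poly_Mapping.lookup f D * Poly_Mapping.lookup f' D'
       * Poly_Mapping.lookup (double_coset_mult G H D D') X)"
proof -
  have "Poly_Mapping.lookup (hecke_mult G H f f') X =
    (\<Sum>D\<in>Poly_Mapping.keys f. \<Sum>D'\<in>Poly_Mapping.keys f'. Poly_Mapping.lookup f D *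
       Poly_Mapping.lookup f' D' * Poly_Mapping.lookup (double_coset_mult G H D D') X)"
    by (simp add: hecke_mult_def lookup_sum)
  also have "\<dots> = (\<Sum>D\<in>Poly_Mapping.keys f. \<Sum>D'\<in>S'. Poly_Mapping.lookup f D *
       Poly_Mapping.lookup f' D' * Poly_Mapping.lookup (double_coset_mult G H D D') X)"
    using assms by (intro sum.cong refl sum.mono_neutral_left) (auto simp: in_keys_iff)
  also have "\<dots> = (\<Sum>D\<in>S. \<Sum>D'\<in>S'. Poly_Mapping.lookup f D *
       Poly_Mapping.lookup f' D' * Poly_Mapping.lookup (double_coset_mult G H D D') X)"
    using assms by (intro sum.mono_neutral_left) (auto simp: in_keys_iff)
  finally show ?thesis .
qed

lemma hecke_mult_add_left: "hecke_mult G H (f + g) h = hecke_mult G H f h + hecke_mult G H g h"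
proof (rule poly_mapping_eqI)
  fix X
  let ?S = "Poly_Mapping.keys f \<union> Poly_Mapping.keys g"
  have "Poly_Mapping.keys (f + g) \<subseteq> ?S"
    by (rule Poly_Mapping.keys_add)
  then show "Poly_Mapping.lookup (hecke_mult G H (f + g) h) X =
      Poly_Mapping.lookup (hecke_mult G H f h + hecke_mult G H g h) X"
    by (simp add: lookup_add lookup_hecke_mult[where S = ?S and S' = "Poly_Mapping.keys h"]
        sum.distrib distrib_right)
qed

lemma hecke_mult_add_right: "hecke_mult G H h (f + g) = hecke_mult G H h f + hecke_mult G H h g"
proof (rule poly_mapping_eqI)
  fix X
  let ?S = "Poly_Mapping.keys f \<union> Poly_Mapping.keys g"
  have "Poly_Mapping.keys (f + g) \<subseteq> ?S"
    by (rule Poly_Mapping.keys_add)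
  then show "Poly_Mapping.lookup (hecke_mult G H h (f + g)) X =
      Poly_Mapping.lookup (hecke_mult G H h f + hecke_mult G H h g) X"
    by (simp add: lookup_add lookup_hecke_mult[where S' = ?S and S = "Poly_Mapping.keys h"]
        sum.distrib distrib_left distrib_right)
qed

lemma keys_hecke_scale: "Poly_Mapping.keys (c *\<^sub>H f) \<subseteq> Poly_Mapping.keys f"
  by (auto simp: in_keys_iff)

lemma hecke_mult_scale_left: "hecke_mult G H (c *\<^sub>H f) h = c *\<^sub>H hecke_mult G H f h"
  by (rule poly_mapping_eqI)
    (simp add: lookup_hecke_mult[where S = "Poly_Mapping.keys f" and S' = "Poly_Mapping.keys h"]
      keys_hecke_scale sum_distrib_left mult.assoc)

lemma hecke_mult_scale_right: "hecke_mult G H h (c *\<^sub>H f) = c *\<^sub>H hecke_mult G H h f"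
  by (rule poly_mapping_eqI)
    (simp add: lookup_hecke_mult[where S' = "Poly_Mapping.keys f" and S = "Poly_Mapping.keys h"]
      keys_hecke_scale sum_distrib_left mult.assoc mult.left_commute)

lemma hecke_mult_single:
  "hecke_mult G H (Poly_Mapping.single D 1) (Poly_Mapping.single D' 1) = double_coset_mult G H D D'"
  by (rule poly_mapping_eqI) (simp add: lookup_hecke_mult[where S = "{D}" and S' = "{D'}"])

section \<open>Double cosets, right cosets and structure constants\<close>

context hecke_pair
begin

lemma in_double_coset_iff:
  "x \<in> double_coset G H g \<longleftrightarrow> (\<exists>h\<in>H. \<exists>k\<in>H. x = h \<otimes> (g \<otimes> k))"
  by (auto simp: double_coset_def set_mult_def l_coset_def)

lemma double_coset_memI: "h \<in> H \<Longrightarrow> k \<in> H \<Longrightarrow> h \<otimes> (g \<otimes> k) \<in> double_coset G H g"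
  by (auto simp: in_double_coset_iff)

lemma double_coset_subset: "g \<in> carrier G \<Longrightarrow> double_coset G H g \<subseteq> carrier G"
  by (auto simp: in_double_coset_iff)

lemma self_in_double_coset: "g \<in> carrier G \<Longrightarrow> g \<in> double_coset G H g"
  using double_coset_memI[of \<one> \<one> g] by simp

lemma double_coset_eqI:
  assumes g: "g \<in> carrier G" and x: "x \<in> double_coset G H g"
  shows "double_coset G H x = double_coset G H g"
proof -
  obtain h k where hk: "h \<in> H" "k \<in> H" and xe: "x = h \<otimes> (g \<otimes> k)"
    using x by (auto simp: in_double_coset_iff)
  have 1: "h' \<otimes> (x \<otimes> k') = (h' \<otimes> h) \<otimes> (g \<otimes> (k \<otimes> k'))" if "h' \<in> H" "k' \<in> H" for h' k'
    using that hk g by (simp add: xe m_assoc)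
  have 2: "h' \<otimes> (g \<otimes> k') = (h' \<otimes> inv h) \<otimes> (x \<otimes> (inv k \<otimes> k'))" if "h' \<in> H" "k' \<in> H" for h' k'
  proof -
    have "h' \<otimes> inv h \<otimes> (h \<otimes> (g \<otimes> k) \<otimes> (inv k \<otimes> k')) =
        h' \<otimes> (inv h \<otimes> (h \<otimes> (g \<otimes> (k \<otimes> (inv k \<otimes> k')))))"
      using that hk g by (simp add: m_assoc)
    also have "\<dots> = h' \<otimes> (g \<otimes> k')"
      using that hk g by (simp add: inv_solve_left' flip: m_assoc)
    finally show ?thesis by (simp add: xe)
  qed
  show ?thesis
  proof (intro Set.set_eqI iffI)
    fix y assume "y \<in> double_coset G H x"
    then show "y \<in> double_coset G H g"
      unfolding in_double_coset_iff using 1 hk by (metis m_closed)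
  next
    fix y assume "y \<in> double_coset G H g"
    then show "y \<in> double_coset G H x"
      unfolding in_double_coset_iff using 2 hk by (metis m_closed m_inv_closed)
  qed
qed

lemma double_coset_in: "g \<in> carrier G \<Longrightarrow> double_coset G H g \<in> double_cosets G H"
  by (auto simp: double_cosets_def)

lemma double_cosets_subset: "D \<in> double_cosets G H \<Longrightarrow> D \<subseteq> carrier G"
  using double_coset_subset by (auto simp: double_cosets_def)

lemma double_cosets_memD: "D \<in> double_cosets G H \<Longrightarrow> x \<in> D \<Longrightarrow> D = double_coset G H x"
  using double_coset_eqI by (auto simp: double_cosets_def)

lemma double_cosets_closed_left: "D \<in> double_cosets G H \<Longrightarrow> x \<in> D \<Longrightarrow> h \<in> H \<Longrightarrow> h \<otimes> x \<in> D"
  using double_coset_memI[of h \<one> x] double_cosets_memD[of D x] double_cosets_subset[of D] by auto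

lemma double_cosets_closed_right: "D \<in> double_cosets G H \<Longrightarrow> x \<in> D \<Longrightarrow> h \<in> H \<Longrightarrow> x \<otimes> h \<in> D"
  using double_coset_memI[of \<one> h x] double_cosets_memD[of D x] double_cosets_subset[of D] by auto

lemma double_coset_one: "double_coset G H \<one> = H"
proof (intro Set.set_eqI iffI)
  fix h assume "h \<in> H"
  then show "h \<in> double_coset G H \<one>" using double_coset_memI[of h \<one> \<one>] by simp
qed (auto simp: in_double_coset_iff)

lemma subgroup_double_coset: "H \<in> double_cosets G H"
  using double_coset_in[of \<one>] by (simp add: double_coset_one)

lemma coset_rep_double_coset: "D \<in> double_cosets G H \<Longrightarrow> coset_rep D \<in> D"
proof -
  assume "D \<in> double_cosets G H"
  then obtain g where "g \<in> D"
    using self_in_double_coset by (auto simp: double_cosets_def)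
  then show ?thesis unfolding coset_rep_def by (rule someI)
qed

lemma double_coset_coset_rep: "D \<in> double_cosets G H \<Longrightarrow> double_coset G H (coset_rep D) = D"
  using double_cosets_memD coset_rep_double_coset by metis

lemma finite_rcosets_in_double_cosets: "D \<in> double_cosets G H \<Longrightarrow> finite (rcosets_in G H D)"
  using finite_rcosets_in by (auto simp: double_cosets_def)

lemma rcos_eqI: "x \<in> carrier G \<Longrightarrow> y \<in> carrier G \<Longrightarrow> x \<otimes> inv y \<in> H \<Longrightarrow> H #> x = H #> y"
proof -
  assume a: "x \<in> carrier G" "y \<in> carrier G" "x \<otimes> inv y \<in> H"
  have "(x \<otimes> inv y) \<otimes> y = x" using a by (simp add: m_assoc)
  then have "x \<in> H #> y" using a(3) unfolding r_coset_def by force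
  then show ?thesis using repr_independence[of x H y] a subgroup_axioms by simp
qed

lemma rcos_mult_left: "h \<in> H \<Longrightarrow> y \<in> carrier G \<Longrightarrow> H #> (h \<otimes> y) = H #> y"
  by (rule rcos_eqI) (simp_all add: m_assoc)

lemma rcos_eqD: "x \<in> carrier G \<Longrightarrow> y \<in> carrier G \<Longrightarrow> H #> x = H #> y \<Longrightarrow> x \<otimes> inv y \<in> H"
  using rcos_self[of x H] subgroup_axioms rcos_module_imp[of y x] by (metis is_group)

lemma rcosets_in_eq:
  assumes "D \<in> double_cosets G H"
  shows "rcosets_in G H D = (\<lambda>g. H #> g) ` D"
proof (intro Set.set_eqI iffI)
  fix C assume "C \<in> rcosets_in G H D"
  then obtain g where g: "g \<in> carrier G" "C = H #> g" "C \<subseteq> D"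
    by (auto simp: rcosets_in_def RCOSETS_def)
  then have "g \<in> D" using rcos_self[of g H] subgroup_axioms by auto
  then show "C \<in> (\<lambda>g. H #> g) ` D" using g by auto
next
  fix C assume "C \<in> (\<lambda>g. H #> g) ` D"
  then obtain g where g: "g \<in> D" "C = H #> g" by auto
  then have "C \<subseteq> D"
    using double_cosets_closed_left[OF assms] by (auto simp: r_coset_def)
  then show "C \<in> rcosets_in G H D"
    using g double_cosets_subset[OF assms] subset rcosetsI[of H g] by (auto simp: rcosets_in_def)
qed

lemma coset_rep_rcos: "C \<in> rcosets H \<Longrightarrow> coset_rep C \<in> C"
  unfolding coset_rep_def using rcosets_non_empty by (metis all_not_in_conv someI)

lemma rcosets_in_rcosets: "C \<in> rcosets_in G H D \<Longrightarrow> C \<in> rcosets H"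
  by (simp add: rcosets_in_def)

lemma coset_rep_carrier: "C \<in> rcosets H \<Longrightarrow> coset_rep C \<in> carrier G"
  using coset_rep_rcos rcosets_carrier is_group by blast

lemma coset_rep_rcosets_in: "C \<in> rcosets_in G H D \<Longrightarrow> coset_rep C \<in> D"
  using coset_rep_rcos by (auto simp: rcosets_in_def)

lemma rcos_coset_rep: "C \<in> rcosets H \<Longrightarrow> H #> coset_rep C = C"
proof -
  assume C: "C \<in> rcosets H"
  then obtain g where g: "g \<in> carrier G" "C = H #> g"
    by (auto simp: RCOSETS_def)
  have "coset_rep C \<in> H #> g" using coset_rep_rcos[OF C] g by simp
  then show ?thesis using repr_independence[OF _ g(1) subgroup_axioms] g by simp
qed

lemma coset_rep_rcos_eq:
  assumes "g \<in> carrier G"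
  obtains h where "h \<in> H" "coset_rep (H #> g) = h \<otimes> g"
proof -
  have "coset_rep (H #> g) \<in> H #> g"
    using assms subset by (intro coset_rep_rcos rcosetsI)
  then show ?thesis using that by (auto simp: r_coset_def)
qed

text \<open>Another representative of \<open>H #> g\<close> changes the quotient by a right factor
  in \<open>H\<close>, which \<open>D\<close> absorbs. So the arbitrary choice made by
  \<open>coset_rep\<close> can be replaced by a convenient representative in every count.\<close>

lemma rep_quotient_mem_iff:
  assumes D: "D \<in> double_cosets G H" and "x \<in> carrier G" "g \<in> carrier G"
  shows "x \<otimes> inv (coset_rep (H #> g)) \<in> D \<longleftrightarrow> x \<otimes> inv g \<in> D"
proof -
  obtain h where h: "h \<in> H" "coset_rep (H #> g) = h \<otimes> g"
    using coset_rep_rcos_eq assms by blast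
  have e: "x \<otimes> inv (coset_rep (H #> g)) = (x \<otimes> inv g) \<otimes> inv h"
    using assms h by (simp add: inv_mult_group m_assoc)
  have "(x \<otimes> inv g \<otimes> inv h) \<otimes> h = x \<otimes> inv g"
    using assms h by (simp add: m_assoc)
  then show ?thesis
    using double_cosets_closed_right[OF D] h e by (metis m_inv_closed)
qed

text \<open>
  For a given \<open>j\<close>, the condition \<open>g\<^sub>i g'\<^sub>j \<in> H x\<close> determines the coset \<open>H g\<^sub>i\<close>, which lies in \<open>D\<close>
  if and only if \<open>x g'\<^sub>j\<^sup>-\<^sup>1\<close> does.
\<close>

lemma hecke_coeff_eq:
  assumes D: "D \<in> double_cosets G H" and D': "D' \<in> double_cosets G H" and x: "x \<in> carrier G"
  shows "hecke_coeff G H D D' x =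
    card {C' \<in> rcosets_in G H D'. x \<otimes> inv (coset_rep C') \<in> D}"
proof -
  let ?P = "{(C, C'). C \<in> rcosets_in G H D \<and> C' \<in> rcosets_in G H D' \<and>
                    coset_rep C \<otimes> coset_rep C' \<in> H #> x}"
  have key: "\<exists>h\<in>H. coset_rep C = h \<otimes> (x \<otimes> inv (coset_rep C'))"
    if P: "(C, C') \<in> ?P" for C C'
  proof -
    have c: "coset_rep C \<in> carrier G" "coset_rep C' \<in> carrier G"
      using P coset_rep_carrier rcosets_in_rcosets by auto
    obtain h where h: "h \<in> H" "coset_rep C \<otimes> coset_rep C' = h \<otimes> x"
      using P by (auto simp: r_coset_def)
    then have "coset_rep C = h \<otimes> x \<otimes> inv (coset_rep C')"
      using c x by (subst inv_solve_right) auto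
    then have "coset_rep C = h \<otimes> (x \<otimes> inv (coset_rep C'))"
      using h c x by (simp add: m_assoc)
    then show ?thesis using h by blast
  qed
  have "bij_betw snd ?P {C' \<in> rcosets_in G H D'. x \<otimes> inv (coset_rep C') \<in> D}"
    unfolding bij_betw_def
  proof (intro conjI inj_onI Set.set_eqI iffI)
    fix p q assume p: "p \<in> ?P" and q: "q \<in> ?P" and e: "snd p = snd q"
    obtain C C' K where pq: "p = (C, C')" "q = (K, C')" using e by (metis prod.collapse)
    have c: "C \<in> rcosets H" "K \<in> rcosets H" "x \<otimes> inv (coset_rep C') \<in> carrier G"
      using p q pq x coset_rep_carrier rcosets_in_rcosets by auto
    obtain h k where hk: "h \<in> H" "coset_rep C = h \<otimes> (x \<otimes> inv (coset_rep C'))"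
        "k \<in> H" "coset_rep K = k \<otimes> (x \<otimes> inv (coset_rep C'))"
      using key p q pq by meson
    have "H #> coset_rep C = H #> (x \<otimes> inv (coset_rep C'))"
        "H #> coset_rep K = H #> (x \<otimes> inv (coset_rep C'))"
      using hk c(3) by (simp_all add: rcos_mult_left)
    then show "p = q" using pq c rcos_coset_rep by metis
  next
    fix C' assume "C' \<in> snd ` ?P"
    then obtain C where P: "(C, C') \<in> ?P" by force
    then obtain h where h: "h \<in> H" "coset_rep C = h \<otimes> (x \<otimes> inv (coset_rep C'))"
      using key by blast
    have c: "coset_rep C' \<in> carrier G" using P coset_rep_carrier rcosets_in_rcosets by auto
    have "inv h \<otimes> coset_rep C = x \<otimes> inv (coset_rep C')"
      using h x c by (simp flip: m_assoc)
    moreover have "coset_rep C \<in> D" using P coset_rep_rcosets_in by auto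
    ultimately have "x \<otimes> inv (coset_rep C') \<in> D"
      using double_cosets_closed_left[OF D, of "coset_rep C" "inv h"] h by auto
    then show "C' \<in> {C' \<in> rcosets_in G H D'. x \<otimes> inv (coset_rep C') \<in> D}"
      using P by auto
  next
    fix C' assume C': "C' \<in> {C' \<in> rcosets_in G H D'. x \<otimes> inv (coset_rep C') \<in> D}"
    define y where "y = x \<otimes> inv (coset_rep C')"
    have c: "coset_rep C' \<in> carrier G" "y \<in> carrier G"
      using C' x coset_rep_carrier rcosets_in_rcosets by (auto simp: y_def)
    obtain h where h: "h \<in> H" "coset_rep (H #> y) = h \<otimes> y"
      using coset_rep_rcos_eq c by blast
    have "coset_rep (H #> y) \<otimes> coset_rep C' = h \<otimes> x"
      using h c x by (simp add: y_def m_assoc)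
    then have "(H #> y, C') \<in> ?P"
      using C' h D by (auto simp: rcosets_in_eq y_def r_coset_def)
    then show "C' \<in> snd ` ?P" by force
  qed
  then show ?thesis unfolding hecke_coeff_def by (rule bij_betw_same_card)
qed

text \<open>Write y = h x k. Right translation by \<open>k\<close> permutes the right cosets in
  \<open>D'\<close>, and the remaining left factor \<open>h\<close> is absorbed by \<open>D\<close>,
  so the two counted sets correspond.\<close>

lemma hecke_coeff_double_coset:
  assumes D: "D \<in> double_cosets G H" and D': "D' \<in> double_cosets G H"
    and x: "x \<in> carrier G" and y: "y \<in> double_coset G H x"
  shows "hecke_coeff G H D D' y = hecke_coeff G H D D' x"
proof -
  obtain h k where hk: "h \<in> H" "k \<in> H" and ye: "y = h \<otimes> (x \<otimes> k)"
    using y by (auto simp: in_double_coset_iff)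
  have yc: "y \<in> carrier G" using hk x ye by simp
  have 1: "x \<otimes> inv g \<in> D \<longleftrightarrow> y \<otimes> inv (g \<otimes> k) \<in> D" if g: "g \<in> carrier G" for g
  proof -
    have e: "y \<otimes> inv (g \<otimes> k) = h \<otimes> (x \<otimes> inv g)"
    proof -
      have "y \<otimes> inv (g \<otimes> k) = h \<otimes> (x \<otimes> (k \<otimes> (inv k \<otimes> inv g)))"
        using g hk x by (simp add: ye inv_mult_group m_assoc)
      also have "k \<otimes> (inv k \<otimes> inv g) = inv g"
        using g hk by (simp flip: m_assoc)
      finally show ?thesis .
    qed
    have "inv h \<otimes> (h \<otimes> (x \<otimes> inv g)) = x \<otimes> inv g"
      using g hk x by (simp flip: m_assoc)
    then show ?thesis using e double_cosets_closed_left[OF D] hk by (metis m_inv_closed)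
  qed
  let ?A = "\<lambda>x. {C' \<in> rcosets_in G H D'. x \<otimes> inv (coset_rep C') \<in> D}"
  have "bij_betw (\<lambda>C. C #> k) (?A x) (?A y)"
  proof (rule bij_betw_byWitness[where f' = "\<lambda>C. C #> inv k"])
    have sub: "C \<subseteq> carrier G" if "C \<in> rcosets_in G H D'" for C
      using that rcosets_carrier is_group by (auto simp: rcosets_in_def)
    show "\<forall>C\<in>?A x. C #> k #> inv k = C" "\<forall>C\<in>?A y. C #> inv k #> k = C"
      using hk sub by (auto simp: coset_mult_assoc)
    have ex: "\<exists>g\<in>D'. C = H #> g" if "C \<in> rcosets_in G H D'" for C
      using that rcosets_in_eq[OF D'] by auto
    show "(\<lambda>C. C #> k) ` ?A x \<subseteq> ?A y"
    proof clarsimp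
      fix C assume C: "C \<in> rcosets_in G H D'" "x \<otimes> inv (coset_rep C) \<in> D"
      obtain g where g: "g \<in> D'" "C = H #> g" using ex C by blast
      have gc: "g \<in> carrier G" using g D' double_cosets_subset by auto
      have Ck: "C #> k = H #> (g \<otimes> k)" using g gc hk subset by (simp add: coset_mult_assoc)
      have "x \<otimes> inv g \<in> D" using C g gc x rep_quotient_mem_iff[OF D] by auto
      then have "y \<otimes> inv (g \<otimes> k) \<in> D" using 1 gc by blast
      then show "C #> k \<in> rcosets_in G H D' \<and> y \<otimes> inv (coset_rep (C #> k)) \<in> D"
        using Ck gc hk yc g rep_quotient_mem_iff[OF D] double_cosets_closed_right[OF D']
        by (auto simp: rcosets_in_eq[OF D'])
    qed
    show "(\<lambda>C. C #> inv k) ` ?A y \<subseteq> ?A x"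
    proof clarsimp
      fix C assume C: "C \<in> rcosets_in G H D'" "y \<otimes> inv (coset_rep C) \<in> D"
      obtain g where g: "g \<in> D'" "C = H #> g" using ex C by blast
      have gc: "g \<in> carrier G" using g D' double_cosets_subset by auto
      have Ck: "C #> inv k = H #> (g \<otimes> inv k)" using g gc hk subset by (simp add: coset_mult_assoc)
      have gk: "g \<otimes> inv k \<otimes> k = g" using gc hk by (simp add: m_assoc)
      have "y \<otimes> inv g \<in> D" using C g gc yc rep_quotient_mem_iff[OF D] by auto
      then have "x \<otimes> inv (g \<otimes> inv k) \<in> D" using 1[of "g \<otimes> inv k"] gc hk gk by simp
      then show "C #> inv k \<in> rcosets_in G H D' \<and> x \<otimes> inv (coset_rep (C #> inv k)) \<in> D"
        using Ck gc hk x g rep_quotient_mem_iff[OF D] double_cosets_closed_right[OF D']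
        by (auto simp: rcosets_in_eq[OF D'])
    qed
  qed
  then show ?thesis
    using assms yc by (simp add: hecke_coeff_eq bij_betw_same_card)
qed

text \<open>A double coset with nonzero coefficient contains a product of two chosen
  representatives, and there are only finitely many such products.\<close>

lemma finite_hecke_support:
  assumes D: "D \<in> double_cosets G H" and D': "D' \<in> double_cosets G H"
  shows "finite {X \<in> double_cosets G H. hecke_coeff G H D D' (coset_rep X) \<noteq> 0}"
proof (rule finite_subset)
  let ?I = "(\<lambda>(C, C'). double_coset G H (coset_rep C \<otimes> coset_rep C')) `
      (rcosets_in G H D \<times> rcosets_in G H D')"
  show "finite ?I"
    using finite_rcosets_in_double_cosets D D' by blast
  show "{X \<in> double_cosets G H. hecke_coeff G H D D' (coset_rep X) \<noteq> 0} \<subseteq> ?I"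
  proof
    fix X assume "X \<in> {X \<in> double_cosets G H. hecke_coeff G H D D' (coset_rep X) \<noteq> 0}"
    then have X: "X \<in> double_cosets G H" and "hecke_coeff G H D D' (coset_rep X) \<noteq> 0" by auto
    then have "{(C, C'). C \<in> rcosets_in G H D \<and> C' \<in> rcosets_in G H D' \<and>
        coset_rep C \<otimes> coset_rep C' \<in> H #> coset_rep X} \<noteq> {}"
      unfolding hecke_coeff_def by (metis card.empty)
    then obtain C C' where C: "C \<in> rcosets_in G H D" "C' \<in> rcosets_in G H D'"
        "coset_rep C \<otimes> coset_rep C' \<in> H #> coset_rep X" by auto
    have "coset_rep C \<otimes> coset_rep C' \<in> X"
      using C(3) double_cosets_closed_left[OF X coset_rep_double_coset[OF X]]
      by (auto simp: r_coset_def)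
    then have "X = double_coset G H (coset_rep C \<otimes> coset_rep C')"
      using X double_cosets_memD by blast
    then show "X \<in> ?I" using C by auto
  qed
qed

text \<open>Finiteness of the support is essential here, because a sum over an infinite index set
  would be 0 by convention.\<close>

lemma lookup_double_coset_mult:
  assumes D: "D \<in> double_cosets G H" and D': "D' \<in> double_cosets G H"
  shows "Poly_Mapping.lookup (double_coset_mult G H D D') X =
    (if X \<in> double_cosets G H then of_nat (hecke_coeff G H D D' (coset_rep X)) else 0)"
proof -
  let ?S = "{X \<in> double_cosets G H. hecke_coeff G H D D' (coset_rep X) \<noteq> 0}"
  have "Poly_Mapping.lookup (double_coset_mult G H D D') X =
      (\<Sum>Y\<in>?S. if X = Y then of_nat (hecke_coeff G H D D' (coset_rep Y)) else 0)"
    unfolding double_coset_mult_def lookup_sum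
    by (intro sum.cong refl) (auto simp: lookup_single when_def)
  then show ?thesis
    using finite_hecke_support[OF D D'] by (auto simp: sum.delta')
qed

lemma keys_double_coset_mult:
  assumes "D \<in> double_cosets G H" "D' \<in> double_cosets G H"
  shows "Poly_Mapping.keys (double_coset_mult G H D D') \<subseteq> double_cosets G H"
  by (auto simp: in_keys_iff lookup_double_coset_mult[OF assms] split: if_splits)

text \<open>Written as sums of indicators, the counts allow sums over double cosets and over cosets
  to be interchanged in the proof of associativity.\<close>

lemma hecke_coeff_sum:
  assumes "D \<in> double_cosets G H" "D' \<in> double_cosets G H" "x \<in> carrier G"
  shows "(of_nat (hecke_coeff G H D D' x) :: complex) =
    (\<Sum>C\<in>rcosets_in G H D'. of_bool (x \<otimes> inv (coset_rep C) \<in> D))"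
  using finite_rcosets_in_double_cosets assms
  by (simp add: hecke_coeff_eq sum_of_bool_eq Int_def)

text \<open>Both coefficients at \<open>x\<close> count pairs of cosets: \<open>C\<close> in
  \<open>D3\<close>, and \<open>K\<close> with K C^-1 in \<open>D2\<close> and x K^-1 in
  \<open>D1\<close>. On the left, \<open>K\<close> arises as the translate \<open>C' #> g\<close> of
  a coset \<open>C'\<close> in \<open>D2\<close>; on the right, grouping the \<open>K\<close> by
  their double cosets gives the product of \<open>D2\<close> and \<open>D3\<close>.\<close>

lemma hecke_mult_assoc_basis:
  assumes D1: "D1 \<in> double_cosets G H" and D2: "D2 \<in> double_cosets G H"
    and D3: "D3 \<in> double_cosets G H"
  defines "\<delta> \<equiv> \<lambda>D. Poly_Mapping.single D (1 :: complex)"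
  shows "hecke_mult G H (hecke_mult G H (\<delta> D1) (\<delta> D2)) (\<delta> D3) =
    hecke_mult G H (\<delta> D1) (hecke_mult G H (\<delta> D2) (\<delta> D3))"
proof (rule poly_mapping_eqI)
  fix X
  let ?c = "\<lambda>D D' x. of_nat (hecke_coeff G H D D' x) :: complex"
  let ?f = "double_coset_mult G H D1 D2" and ?g = "double_coset_mult G H D2 D3"
  let ?R = "rcosets_in G H"
  have lhs: "Poly_Mapping.lookup (hecke_mult G H (hecke_mult G H (\<delta> D1) (\<delta> D2)) (\<delta> D3)) X =
    (\<Sum>Y\<in>Poly_Mapping.keys ?f. Poly_Mapping.lookup ?f Y *
        Poly_Mapping.lookup (double_coset_mult G H Y D3) X)"
    unfolding \<delta>_def hecke_mult_single
    by (subst lookup_hecke_mult[where S = "Poly_Mapping.keys ?f" and S' = "{D3}"]) auto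
  have rhs: "Poly_Mapping.lookup (hecke_mult G H (\<delta> D1) (hecke_mult G H (\<delta> D2) (\<delta> D3))) X =
    (\<Sum>Z\<in>Poly_Mapping.keys ?g. Poly_Mapping.lookup ?g Z *
        Poly_Mapping.lookup (double_coset_mult G H D1 Z) X)"
    unfolding \<delta>_def hecke_mult_single
    by (subst lookup_hecke_mult[where S' = "Poly_Mapping.keys ?g" and S = "{D1}"]) auto
  have kf: "Y \<in> double_cosets G H" if "Y \<in> Poly_Mapping.keys ?f" for Y
    using that keys_double_coset_mult D1 D2 by blast
  have kg: "Y \<in> double_cosets G H" if "Y \<in> Poly_Mapping.keys ?g" for Y
    using that keys_double_coset_mult D2 D3 by blast
  show "Poly_Mapping.lookup (hecke_mult G H (hecke_mult G H (\<delta> D1) (\<delta> D2)) (\<delta> D3)) X =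
    Poly_Mapping.lookup (hecke_mult G H (\<delta> D1) (hecke_mult G H (\<delta> D2) (\<delta> D3))) X"
  proof (cases "X \<in> double_cosets G H")
    case False
    then have "Poly_Mapping.lookup (double_coset_mult G H Y D3) X = 0"
      if "Y \<in> Poly_Mapping.keys ?f" for Y
      using lookup_double_coset_mult[OF kf[OF that] D3] by simp
    moreover have "Poly_Mapping.lookup (double_coset_mult G H D1 Z) X = 0"
      if "Z \<in> Poly_Mapping.keys ?g" for Z
      using False lookup_double_coset_mult[OF D1 kg[OF that]] by simp
    ultimately show ?thesis unfolding lhs rhs by simp
  next
    case X: True
    define x where "x = coset_rep X"
    have x: "x \<in> carrier G"
      using X coset_rep_double_coset double_cosets_subset x_def by blast
    have repc: "coset_rep C \<in> carrier G" if "C \<in> ?R D" for C D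
      using that coset_rep_carrier rcosets_in_rcosets by blast
    have "(\<Sum>Y\<in>Poly_Mapping.keys ?f. Poly_Mapping.lookup ?f Y *
        Poly_Mapping.lookup (double_coset_mult G H Y D3) X) =
      (\<Sum>Y\<in>Poly_Mapping.keys ?f. \<Sum>C\<in>?R D3. Poly_Mapping.lookup ?f Y *
         of_bool (x \<otimes> inv (coset_rep C) \<in> Y))"
      using X x kf D3 by (intro sum.cong refl)
        (simp add: lookup_double_coset_mult hecke_coeff_sum sum_distrib_left flip: x_def)
    also have "\<dots> = (\<Sum>C\<in>?R D3. \<Sum>Y\<in>Poly_Mapping.keys ?f. Poly_Mapping.lookup ?f Y *
         of_bool (x \<otimes> inv (coset_rep C) \<in> Y))"
      by (rule sum.swap)
    also have "\<dots> = (\<Sum>C\<in>?R D3. ?c D1 D2 (x \<otimes> inv (coset_rep C)))"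
    proof (rule sum.cong[OF refl])
      fix C assume C: "C \<in> ?R D3"
      define y where "y = x \<otimes> inv (coset_rep C)"
      define Z where "Z = double_coset G H y"
      have y: "y \<in> carrier G" using C x repc y_def by auto
      have Z: "Z \<in> double_cosets G H" unfolding Z_def by (rule double_coset_in[OF y])
      \<comment> \<open>Double cosets are disjoint, so only \<open>Y = Z\<close> can contribute; if
        \<open>Z\<close> is not a key, both sides vanish.\<close>
      have "(\<Sum>Y\<in>Poly_Mapping.keys ?f. Poly_Mapping.lookup ?f Y * of_bool (y \<in> Y)) =
          (\<Sum>Y\<in>Poly_Mapping.keys ?f. if Z = Y then Poly_Mapping.lookup ?f Y else 0)"
        using kf double_cosets_memD self_in_double_coset[OF y]
        by (intro sum.cong refl) (auto simp: Z_def)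
      also have "\<dots> = Poly_Mapping.lookup ?f Z"
        by (simp add: sum.delta' in_keys_iff)
      also have "\<dots> = ?c D1 D2 (coset_rep Z)"
        using Z by (simp add: lookup_double_coset_mult D1 D2)
      also have "\<dots> = ?c D1 D2 y"
        using hecke_coeff_double_coset[OF D1 D2 y, of "coset_rep Z"] coset_rep_double_coset[OF Z]
        by (simp add: Z_def)
      finally show "(\<Sum>Y\<in>Poly_Mapping.keys ?f. Poly_Mapping.lookup ?f Y *
          of_bool (x \<otimes> inv (coset_rep C) \<in> Y)) = ?c D1 D2 (x \<otimes> inv (coset_rep C))"
        by (simp add: y_def)
    qed
    also have "\<dots> = (\<Sum>C\<in>?R D3. \<Sum>K\<in>(\<Union>Z\<in>Poly_Mapping.keys ?g. ?R Z).
        of_bool (coset_rep K \<otimes> inv (coset_rep C) \<in> D2) * of_bool (x \<otimes> inv (coset_rep K) \<in> D1))"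
    proof (rule sum.cong[OF refl])
      fix C assume C: "C \<in> ?R D3"
      let ?U = "\<Union>Z\<in>Poly_Mapping.keys ?g. ?R Z"
      define g where "g = coset_rep C"
      have g: "g \<in> carrier G" using C repc g_def by auto
      have finU: "finite ?U" using kg finite_rcosets_in_double_cosets by auto
      have "?c D1 D2 (x \<otimes> inv g) = (\<Sum>C'\<in>?R D2. of_bool (x \<otimes> inv g \<otimes> inv (coset_rep C') \<in> D1))"
        using x g D1 D2 by (simp add: hecke_coeff_sum)
      also have "\<dots> = (\<Sum>K\<in>{K \<in> ?U. coset_rep K \<otimes> inv g \<in> D2}. of_bool (x \<otimes> inv (coset_rep K) \<in> D1))"
      proof (rule sum.reindex_bij_witness[where i = "\<lambda>K. K #> inv g" and j = "\<lambda>C'. C' #> g"])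
        fix C' assume C': "C' \<in> ?R D2"
        obtain k where k: "k \<in> D2" "C' = H #> k" using C' rcosets_in_eq[OF D2] by auto
        have kc: "k \<in> carrier G" using k D2 double_cosets_subset by auto
        have Cg: "C' #> g = H #> (k \<otimes> g)" using k kc g subset by (simp add: coset_mult_assoc)
        show "C' #> g #> inv g = C'"
          using k kc g subset by (simp add: coset_mult_assoc m_assoc)
        define Z where "Z = double_coset G H (k \<otimes> g)"
        have Z: "Z \<in> double_cosets G H" "k \<otimes> g \<in> Z"
          using kc g by (auto simp: Z_def double_coset_in self_in_double_coset)
        have rep: "coset_rep (C' #> g) \<otimes> inv g \<in> D2"
        proof -
          obtain h where h: "h \<in> H" "coset_rep (H #> (k \<otimes> g)) = h \<otimes> (k \<otimes> g)"
            using coset_rep_rcos_eq[of "k \<otimes> g"] kc g by blast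
          then have "coset_rep (C' #> g) \<otimes> inv g = h \<otimes> k"
            using kc g Cg by (simp add: m_assoc)
          then show ?thesis using h k double_cosets_closed_left[OF D2] by simp
        qed
        \<comment> \<open>The coset \<open>C\<close> itself is counted by the coefficient at
          \<open>k \<otimes> g\<close>, since (k g) g^-1 = k lies in \<open>D2\<close>.\<close>
        have "Z \<in> Poly_Mapping.keys ?g"
        proof -
          have "{C'' \<in> ?R D3. k \<otimes> g \<otimes> inv (coset_rep C'') \<in> D2} \<noteq> {}"
            using C k kc g by (auto simp: m_assoc g_def)
          moreover have "finite {C'' \<in> ?R D3. k \<otimes> g \<otimes> inv (coset_rep C'') \<in> D2}"
            using finite_rcosets_in_double_cosets[OF D3] by auto
          ultimately have "hecke_coeff G H D2 D3 (k \<otimes> g) \<noteq> 0"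
            using kc g D2 D3 by (simp add: hecke_coeff_eq card_eq_0_iff)
          then have "hecke_coeff G H D2 D3 (coset_rep Z) \<noteq> 0"
            using hecke_coeff_double_coset[OF D2 D3, of "k \<otimes> g" "coset_rep Z"] kc g
              coset_rep_double_coset[OF Z(1)] by (simp add: Z_def)
          then show ?thesis using Z by (simp add: in_keys_iff lookup_double_coset_mult D2 D3)
        qed
        moreover have "C' #> g \<in> ?R Z" using Z Cg by (auto simp: rcosets_in_eq)
        ultimately show "C' #> g \<in> {K \<in> ?U. coset_rep K \<otimes> inv g \<in> D2}" using rep by auto
        have "x \<otimes> inv (coset_rep (C' #> g)) \<in> D1 \<longleftrightarrow> x \<otimes> inv (k \<otimes> g) \<in> D1"
          using rep_quotient_mem_iff[OF D1 x, of "k \<otimes> g"] kc g Cg by simp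
        also have "x \<otimes> inv (k \<otimes> g) = x \<otimes> inv g \<otimes> inv k"
          using x kc g by (simp add: inv_mult_group m_assoc)
        also have "\<dots> \<in> D1 \<longleftrightarrow> x \<otimes> inv g \<otimes> inv (coset_rep C') \<in> D1"
          using rep_quotient_mem_iff[OF D1, of "x \<otimes> inv g" k] x kc g k by simp
        finally show "of_bool (x \<otimes> inv (coset_rep (C' #> g)) \<in> D1) =
            of_bool (x \<otimes> inv g \<otimes> inv (coset_rep C') \<in> D1)" by simp
      next
        fix K assume K: "K \<in> {K \<in> ?U. coset_rep K \<otimes> inv g \<in> D2}"
        then have Kr: "K \<in> rcosets H" using rcosets_in_rcosets by auto
        have Kc: "coset_rep K \<in> carrier G" "K = H #> coset_rep K"
          using Kr coset_rep_carrier rcos_coset_rep by auto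
        have Kg: "K #> inv g = H #> (coset_rep K \<otimes> inv g)"
          using Kc g subset by (metis coset_mult_assoc inv_closed)
        have "K \<subseteq> carrier G" using Kr rcosets_carrier is_group by auto
        then show "K #> inv g #> g = K"
          using g by (simp add: coset_mult_assoc)
        show "K #> inv g \<in> ?R D2" using Kg K by (auto simp: rcosets_in_eq[OF D2])
      qed
      also have "\<dots> = (\<Sum>K\<in>?U. of_bool (coset_rep K \<otimes> inv g \<in> D2) * of_bool (x \<otimes> inv (coset_rep K) \<in> D1))"
        using finU by (intro sum.mono_neutral_cong_left) auto
      finally show "?c D1 D2 (x \<otimes> inv (coset_rep C)) = (\<Sum>K\<in>?U.
          of_bool (coset_rep K \<otimes> inv (coset_rep C) \<in> D2) * of_bool (x \<otimes> inv (coset_rep K) \<in> D1))"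
        by (simp add: g_def)
    qed
    also have "\<dots> = (\<Sum>K\<in>(\<Union>Z\<in>Poly_Mapping.keys ?g. ?R Z).
        ?c D2 D3 (coset_rep K) * of_bool (x \<otimes> inv (coset_rep K) \<in> D1))"
      using D2 D3 repc by (subst sum.swap, intro sum.cong refl)
        (auto simp: hecke_coeff_sum sum_distrib_right)
    also have "\<dots> = (\<Sum>Z\<in>Poly_Mapping.keys ?g. \<Sum>K\<in>?R Z.
        ?c D2 D3 (coset_rep K) * of_bool (x \<otimes> inv (coset_rep K) \<in> D1))"
    proof (rule sum.UNION_disjoint)
      show "\<forall>Z\<in>Poly_Mapping.keys ?g. finite (?R Z)"
        using kg finite_rcosets_in_double_cosets by auto
      show "\<forall>Z\<in>Poly_Mapping.keys ?g. \<forall>Z'\<in>Poly_Mapping.keys ?g. Z \<noteq> Z' \<longrightarrow> ?R Z \<inter> ?R Z' = {}"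
        using kg coset_rep_rcosets_in double_cosets_memD by (metis disjoint_iff)
    qed simp
    also have "\<dots> = (\<Sum>Z\<in>Poly_Mapping.keys ?g. Poly_Mapping.lookup ?g Z *
        Poly_Mapping.lookup (double_coset_mult G H D1 Z) X)"
    proof (rule sum.cong[OF refl])
      fix Z assume Zk: "Z \<in> Poly_Mapping.keys ?g"
      have Z: "Z \<in> double_cosets G H" using Zk kg by blast
      have "?c D2 D3 (coset_rep K) = Poly_Mapping.lookup ?g Z" if K: "K \<in> ?R Z" for K
      proof -
        have "coset_rep Z \<in> double_coset G H (coset_rep K)"
          using Z K coset_rep_rcosets_in coset_rep_double_coset double_cosets_memD by metis
        then show ?thesis
          using hecke_coeff_double_coset[OF D2 D3, of "coset_rep K" "coset_rep Z"] repc K Z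
          by (auto simp: lookup_double_coset_mult D2 D3)
      qed
      then show "(\<Sum>K\<in>?R Z. ?c D2 D3 (coset_rep K) * of_bool (x \<otimes> inv (coset_rep K) \<in> D1)) =
          Poly_Mapping.lookup ?g Z * Poly_Mapping.lookup (double_coset_mult G H D1 Z) X"
        using Z X x by (simp add: lookup_double_coset_mult D1 hecke_coeff_sum sum_distrib_left
            flip: x_def)
    qed
    finally show ?thesis unfolding lhs rhs .
  qed
qed

section \<open>Products that can be read off by counting cosets\<close>

lemma double_coset_mult_eqI:
  assumes D: "D \<in> double_cosets G H" and D': "D' \<in> double_cosets G H"
    and "\<And>x. x \<in> carrier G \<Longrightarrow>
      of_nat (hecke_coeff G H D D' x) = Poly_Mapping.lookup f (double_coset G H x)"
    and "Poly_Mapping.keys f \<subseteq> double_cosets G H"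
  shows "double_coset_mult G H D D' = f"
proof (rule poly_mapping_eqI)
  fix X
  show "Poly_Mapping.lookup (double_coset_mult G H D D') X = Poly_Mapping.lookup f X"
  proof (cases "X \<in> double_cosets G H")
    case True
    then have "coset_rep X \<in> carrier G"
      using coset_rep_double_coset double_cosets_subset by blast
    then show ?thesis
      using assms True by (simp add: lookup_double_coset_mult double_coset_coset_rep)
  next
    case False
    then have "Poly_Mapping.lookup f X = 0" using assms(4) by (auto simp: in_keys_iff)
    then show ?thesis using False D D' by (simp add: lookup_double_coset_mult)
  qed
qed

text \<open>\<open>closed\<close> confines the product to the single double coset \<open>E\<close>,
  and \<open>inj\<close> says that the product determines the coset of its second factor, so the
  coefficient at each element of \<open>E\<close> is exactly 1.\<close>

lemma double_coset_mult_single: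
  assumes D: "D \<in> double_cosets G H" and D': "D' \<in> double_cosets G H"
    and E: "E \<in> double_cosets G H"
    and closed: "\<And>g g'. g \<in> D \<Longrightarrow> g' \<in> D' \<Longrightarrow> g \<otimes> g' \<in> E"
    and inj: "\<And>g k g' k'. g \<in> D \<Longrightarrow> k \<in> D \<Longrightarrow> g' \<in> D' \<Longrightarrow> k' \<in> D' \<Longrightarrow>
        g \<otimes> g' = k \<otimes> k' \<Longrightarrow> g' \<otimes> inv k' \<in> H"
  shows "double_coset_mult G H D D' = Poly_Mapping.single E 1"
proof (rule double_coset_mult_eqI[OF D D'])
  show "Poly_Mapping.keys (Poly_Mapping.single E (1::complex)) \<subseteq> double_cosets G H"
    using E by simp
  fix x assume x: "x \<in> carrier G"
  let ?A = "{C' \<in> rcosets_in G H D'. x \<otimes> inv (coset_rep C') \<in> D}"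
  have mem: "C' \<in> rcosets H \<and> coset_rep C' \<in> D' \<and> coset_rep C' \<in> carrier G \<and>
      x \<otimes> inv (coset_rep C') \<in> D \<and> x \<otimes> inv (coset_rep C') \<otimes> coset_rep C' = x" if "C' \<in> ?A" for C'
    using that coset_rep_rcosets_in rcosets_in_rcosets coset_rep_carrier x by (auto simp: m_assoc)
  have "card ?A = of_bool (x \<in> E)"
  proof (cases "x \<in> E")
    case False
    have "C' \<notin> ?A" for C'
      using False closed[of "x \<otimes> inv (coset_rep C')" "coset_rep C'"] mem[of C'] by auto
    then have "?A = {}" by blast
    then have "card ?A = 0" by (simp only: card.empty)
    then show ?thesis using False by simp
  next
    case True
    obtain g where g: "g \<in> D" using coset_rep_double_coset[OF D] by blast
    obtain g' where g': "g' \<in> D'" using coset_rep_double_coset[OF D'] by blast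
    have gc: "g \<in> carrier G" "g' \<in> carrier G" using g g' D D' double_cosets_subset by auto
    have "x \<in> double_coset G H (g \<otimes> g')"
      using double_cosets_memD[OF E closed[OF g g']] True by simp
    then obtain h k where hk: "h \<in> H" "k \<in> H" "x = h \<otimes> (g \<otimes> g' \<otimes> k)"
      by (auto simp: in_double_coset_iff)
    have e: "x \<otimes> inv (g' \<otimes> k) = h \<otimes> g"
    proof -
      define y where "y = g' \<otimes> k"
      have y: "y \<in> carrier G" using hk gc by (simp add: y_def)
      have xy: "x = (h \<otimes> g) \<otimes> y" using hk gc by (simp add: y_def m_assoc)
      have "(h \<otimes> g) \<otimes> y \<otimes> inv y = h \<otimes> g" using y hk gc by (simp add: m_assoc)
      then show ?thesis unfolding xy y_def .
    qed
    \<comment> \<open>The factorization x = (h g) (g' k) exhibits the one coset that is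
      counted.\<close>
    have "H #> (g' \<otimes> k) \<in> ?A"
      using e x hk gc g g' double_cosets_closed_left[OF D] double_cosets_closed_right[OF D']
      by (auto simp: rcosets_in_eq[OF D'] rep_quotient_mem_iff[OF D])
    moreover have "C = C'" if C: "C \<in> ?A" "C' \<in> ?A" for C C'
    proof -
      have "coset_rep C \<otimes> inv (coset_rep C') \<in> H"
        using mem[OF C(1)] mem[OF C(2)]
        by (intro inj[of "x \<otimes> inv (coset_rep C)" "x \<otimes> inv (coset_rep C')"]) auto
      then have "H #> coset_rep C = H #> coset_rep C'"
        using mem[OF C(1)] mem[OF C(2)] rcos_eqI by blast
      then show ?thesis using mem[OF C(1)] mem[OF C(2)] rcos_coset_rep by metis
    qed
    ultimately have "?A = {H #> (g' \<otimes> k)}" by blast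
    then have "card ?A = card {H #> (g' \<otimes> k)}" by (rule arg_cong)
    then show ?thesis using True by simp
  qed
  moreover have "double_coset G H x = E \<longleftrightarrow> x \<in> E"
    using E x double_cosets_memD self_in_double_coset by blast
  ultimately show "of_nat (hecke_coeff G H D D' x) =
      Poly_Mapping.lookup (Poly_Mapping.single E (1::complex)) (double_coset G H x)"
    using D D' x by (auto simp: hecke_coeff_eq lookup_single when_def)
qed

text \<open>For a coset of \<open>H\<close> in \<open>D\<close> with representative g, the group
  \<open>H \<union> D\<close> contains x g^-1 exactly when it contains \<open>x\<close>, and the
  quotient lies in \<open>H\<close> only for the coset \<open>H #> x\<close>. For \<open>x\<close>
  in \<open>H\<close> that coset is not in \<open>D\<close>, so all cosets are counted; for
  \<open>x\<close> in \<open>D\<close> all but one are.\<close>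

lemma double_coset_mult_square:
  assumes D: "D \<in> double_cosets G H" and sub: "subgroup (H \<union> D) G" and ne: "D \<noteq> H"
  shows "double_coset_mult G H D D = of_nat (rcoset_number G H D) *\<^sub>H Poly_Mapping.single H 1
    + (of_nat (rcoset_number G H D) - 1) *\<^sub>H Poly_Mapping.single D 1"
proof (rule double_coset_mult_eqI[OF D D])
  let ?q = "rcoset_number G H D"
  show "Poly_Mapping.keys (of_nat ?q *\<^sub>H Poly_Mapping.single H 1
      + (of_nat ?q - 1) *\<^sub>H Poly_Mapping.single D 1) \<subseteq> double_cosets G H"
    using D subgroup_double_coset
    by (auto simp: in_keys_iff lookup_add lookup_single when_def split: if_splits)
  fix x assume x: "x \<in> carrier G"
  let ?A = "{C' \<in> rcosets_in G H D. x \<otimes> inv (coset_rep C') \<in> D}"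
  have disj: "H \<inter> D = {}"
    using D ne subgroup_double_coset double_cosets_memD by blast
  have mem: "C' \<in> rcosets H \<and> coset_rep C' \<in> D \<and> coset_rep C' \<in> carrier G"
    if "C' \<in> rcosets_in G H D" for C'
    using that coset_rep_rcosets_in rcosets_in_rcosets coset_rep_carrier x by auto
  have quot: "x \<otimes> inv (coset_rep C') \<in> H \<union> D \<longleftrightarrow> x \<in> H \<union> D" if C': "C' \<in> rcosets_in G H D" for C'
  proof
    have rep: "coset_rep C' \<in> H \<union> D" using mem[OF C'] by blast
    assume "x \<otimes> inv (coset_rep C') \<in> H \<union> D"
    then have "x \<otimes> inv (coset_rep C') \<otimes> coset_rep C' \<in> H \<union> D"
      by (rule subgroup.m_closed[OF sub _ rep])
    then show "x \<in> H \<union> D" using x mem[OF C'] by (simp add: m_assoc)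
  next
    have rep: "coset_rep C' \<in> H \<union> D" using mem[OF C'] by blast
    assume "x \<in> H \<union> D"
    then show "x \<otimes> inv (coset_rep C') \<in> H \<union> D"
      by (rule subgroup.m_closed[OF sub _ subgroup.m_inv_closed[OF sub rep]])
  qed
  have inH: "x \<otimes> inv (coset_rep C') \<in> H \<longleftrightarrow> C' = H #> x" if C': "C' \<in> rcosets_in G H D" for C'
    using rcos_eqI[OF x, of "coset_rep C'"] rcos_eqD[OF x, of "coset_rep C'"] mem[OF C']
      rcos_coset_rep[of C'] by auto
  have inD: "x \<otimes> inv (coset_rep C') \<in> D \<longleftrightarrow> x \<in> H \<union> D \<and> C' \<noteq> H #> x"
    if C': "C' \<in> rcosets_in G H D" for C'
    using quot[OF C'] inH[OF C'] disj by blast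
  have coeff: "hecke_coeff G H D D x = card {C' \<in> rcosets_in G H D. x \<in> H \<union> D \<and> C' \<noteq> H #> x}"
    using D x inD by (simp add: hecke_coeff_eq cong: conj_cong)
  have dc: "double_coset G H x = E \<longleftrightarrow> x \<in> E" if "E \<in> double_cosets G H" for E
    using that x double_cosets_memD self_in_double_coset by blast
  have fin: "finite (rcosets_in G H D)" by (rule finite_rcosets_in_double_cosets[OF D])
  consider "x \<in> H" | "x \<in> D" | "x \<notin> H \<union> D" by blast
  then have "of_nat (hecke_coeff G H D D x) = (of_nat ?q * of_bool (x \<in> H) + (of_nat ?q - 1) * of_bool (x \<in> D) :: complex)"
  proof cases
    case 1
    have "C' \<noteq> H #> x" if "C' \<in> rcosets_in G H D" for C'
      using 1 mem[OF that] coset_rep_rcos[of C'] coset_join2[of x H] x subgroup_axioms disj by auto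
    then have "{C' \<in> rcosets_in G H D. x \<in> H \<union> D \<and> C' \<noteq> H #> x} = rcosets_in G H D"
      using 1 by auto
    then show ?thesis using 1 disj by (auto simp: coeff rcoset_number_def)
  next
    case 2
    then have C: "H #> x \<in> rcosets_in G H D" by (simp add: rcosets_in_eq[OF D])
    have "{C' \<in> rcosets_in G H D. x \<in> H \<union> D \<and> C' \<noteq> H #> x} = rcosets_in G H D - {H #> x}"
      using 2 by auto
    \<comment> \<open>Positivity makes the truncated subtraction of natural numbers agree with the
      complex number \<open>?q - 1\<close>.\<close>
    moreover have "card (rcosets_in G H D) > 0" using C fin card_gt_0_iff by blast
    ultimately show ?thesis
      using 2 disj C fin by (auto simp: coeff rcoset_number_def card_Diff_singleton of_nat_diff)
  qed (simp add: coeff)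
  then show "of_nat (hecke_coeff G H D D x) = Poly_Mapping.lookup (of_nat ?q *\<^sub>H Poly_Mapping.single H 1
      + (of_nat ?q - 1) *\<^sub>H Poly_Mapping.single D 1) (double_coset G H x)"
    using dc[OF D] dc[OF subgroup_double_coset]
    by (auto simp: lookup_add lookup_single when_def)
qed

end

lemma (in hecke_pair) hecke_mult_one_left:
  assumes D: "D \<in> double_cosets G H"
  shows "hecke_mult G H (Poly_Mapping.single H 1) (Poly_Mapping.single D 1) = Poly_Mapping.single D 1"
  unfolding hecke_mult_single
proof (rule double_coset_mult_single[OF subgroup_double_coset D D])
  show "g \<otimes> g' \<in> D" if "g \<in> H" "g' \<in> D" for g g'
    using that D double_cosets_closed_left by blast
  fix g k g' k' assume a: "g \<in> H" "k \<in> H" "g' \<in> D" "k' \<in> D" "g \<otimes> g' = k \<otimes> k'"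
  then have c: "g' \<in> carrier G" "k' \<in> carrier G" using D double_cosets_subset by auto
  have "g' = inv g \<otimes> (g \<otimes> g')" using a(1-4) c by (simp flip: m_assoc)
  also have "\<dots> = inv g \<otimes> k \<otimes> k'"
    unfolding a(5) using a(1,2) c by (simp add: m_assoc)
  finally have "g' \<otimes> inv k' = inv g \<otimes> k" using a c by (simp add: m_assoc)
  then show "g' \<otimes> inv k' \<in> H" using a by simp
qed

section \<open>Products with an element that normalizes the subgroup\<close>

context hecke_pair
begin

lemma normalizing_double_coset:
  assumes a: "a \<in> carrier G" and n: "a <# H = H #> a"
  shows "double_coset G H a = a <# H"
proof -
  have "H <#> (H #> a) = H #> a"
    using a subset subgroup_mult_id[OF subgroup_axioms] by (simp add: setmult_rcos_assoc)
  then show ?thesis by (simp add: double_coset_def n)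
qed

lemma normalizing_commute:
  assumes n: "a <# H = H #> a" and h: "h \<in> H"
  obtains k where "k \<in> H" "a \<otimes> h = k \<otimes> a"
proof -
  have "a \<otimes> h \<in> H #> a" using h n by (auto simp: l_coset_def)
  then show ?thesis using that by (auto simp: r_coset_def)
qed

lemma normalizing_commute':
  assumes n: "a <# H = H #> a" and h: "h \<in> H"
  obtains k where "k \<in> H" "h \<otimes> a = a \<otimes> k"
proof -
  have "h \<otimes> a \<in> a <# H" using h n by (auto simp: r_coset_def)
  then show ?thesis using that by (auto simp: l_coset_def)
qed

text \<open>The double coset of a normalizing element is a single coset, and elements of
  \<open>H\<close> can be carried across \<open>a\<close>; this gives both conditions of the rule
  for products with one term.\<close>

lemma double_coset_mult_normalizing_left:
  assumes a: "a \<in> carrier G" and n: "a <# H = H #> a" and x: "x \<in> carrier G"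
  shows "double_coset_mult G H (double_coset G H a) (double_coset G H x) =
    Poly_Mapping.single (double_coset G H (a \<otimes> x)) 1"
proof (rule double_coset_mult_single)
  show "g \<otimes> g' \<in> double_coset G H (a \<otimes> x)"
    if g: "g \<in> double_coset G H a" "g' \<in> double_coset G H x" for g g'
  proof -
    have "g \<in> H #> a" using g normalizing_double_coset[OF a n] n by simp
    then obtain h where h: "h \<in> H" "g = h \<otimes> a" by (auto simp: r_coset_def)
    obtain h1 k1 where k: "h1 \<in> H" "k1 \<in> H" "g' = h1 \<otimes> (x \<otimes> k1)"
      using g by (auto simp: in_double_coset_iff)
    obtain c where c: "c \<in> H" "a \<otimes> h1 = c \<otimes> a" using normalizing_commute[OF n k(1)] .
    have "g \<otimes> g' = h \<otimes> ((a \<otimes> h1) \<otimes> (x \<otimes> k1))" using h k a x by (simp add: m_assoc)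
    also have "\<dots> = (h \<otimes> c) \<otimes> ((a \<otimes> x) \<otimes> k1)" using c h k a x by (simp add: m_assoc)
    finally show ?thesis using h c k by (simp add: double_coset_memI)
  qed
  show "g' \<otimes> inv k' \<in> H"
    if g: "g \<in> double_coset G H a" "k \<in> double_coset G H a" "g' \<in> double_coset G H x"
      "k' \<in> double_coset G H x" "g \<otimes> g' = k \<otimes> k'" for g k g' k'
  proof -
    obtain h h' where h: "h \<in> H" "h' \<in> H" "g = a \<otimes> h" "k = a \<otimes> h'"
      using g(1,2) normalizing_double_coset[OF a n] by (auto simp: l_coset_def)
    have c: "g' \<in> carrier G" "k' \<in> carrier G" using g x double_coset_subset by auto
    have "a \<otimes> (h \<otimes> g') = a \<otimes> (h' \<otimes> k')" using g(5) h a c by (simp add: m_assoc)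
    then have e: "h \<otimes> g' = h' \<otimes> k'" using a c h by simp
    have "g' = inv h \<otimes> (h \<otimes> g')" using h(1) c by (simp flip: m_assoc)
    then have "g' = inv h \<otimes> h' \<otimes> k'" unfolding e using h c by (simp add: m_assoc)
    then have "g' \<otimes> inv k' = inv h \<otimes> h'" using h c by (simp add: m_assoc)
    then show ?thesis using h by simp
  qed
qed (use a x in \<open>auto intro: double_coset_in\<close>)

lemma double_coset_mult_normalizing_right:
  assumes a: "a \<in> carrier G" and n: "a <# H = H #> a" and x: "x \<in> carrier G"
  shows "double_coset_mult G H (double_coset G H x) (double_coset G H a) =
    Poly_Mapping.single (double_coset G H (x \<otimes> a)) 1"
proof (rule double_coset_mult_single)
  show "g \<otimes> g' \<in> double_coset G H (x \<otimes> a)"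
    if g: "g \<in> double_coset G H x" "g' \<in> double_coset G H a" for g g'
  proof -
    obtain h where h: "h \<in> H" "g' = a \<otimes> h"
      using g normalizing_double_coset[OF a n] by (auto simp: l_coset_def)
    obtain h1 k1 where k: "h1 \<in> H" "k1 \<in> H" "g = h1 \<otimes> (x \<otimes> k1)"
      using g by (auto simp: in_double_coset_iff)
    obtain c where c: "c \<in> H" "k1 \<otimes> a = a \<otimes> c" using normalizing_commute'[OF n k(2)] .
    have "g \<otimes> g' = h1 \<otimes> (x \<otimes> ((k1 \<otimes> a) \<otimes> h))" using h k a x by (simp add: m_assoc)
    also have "\<dots> = h1 \<otimes> ((x \<otimes> a) \<otimes> (c \<otimes> h))" using c h k a x by (simp add: m_assoc)
    finally show ?thesis using h c k by (simp add: double_coset_memI)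
  qed
  show "g' \<otimes> inv k' \<in> H"
    if g: "g' \<in> double_coset G H a" "k' \<in> double_coset G H a" for g' k'
  proof -
    have "g' \<in> H #> a" "k' \<in> H #> a" using g normalizing_double_coset[OF a n] n by auto
    then obtain h h' where h: "h \<in> H" "h' \<in> H" "g' = h \<otimes> a" "k' = h' \<otimes> a"
      by (auto simp: r_coset_def)
    have "g' \<otimes> inv k' = h \<otimes> (a \<otimes> (inv a \<otimes> inv h'))"
      using h a by (simp add: inv_mult_group m_assoc)
    moreover have "a \<otimes> (inv a \<otimes> inv h') = inv h'"
      using h a by (simp flip: m_assoc)
    ultimately show ?thesis using h a by simp
  qed
qed (use a x in \<open>auto intro: double_coset_in\<close>)

end

section \<open>Reduced words in the infinite dihedral group\<close>

text \<open>\<open>pos w\<close> models the index of the edge to which \<open>w\<close> moves the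
  edge {0, 1} of the integer line; \<open>pos_s\<close> and \<open>pos_t\<close> are the effects on
  edge indices of the reflections k -> -k and k -> 2 - k. Generation of \<open>W\<close> by
  \<open>s\<close> and \<open>t\<close> is a consequence of injectivity, since every integer is the
  position of an alternating word.\<close>

locale infinite_dihedral = group W for W :: "('w, 'n) monoid_scheme" (structure) +
  fixes s t and pos :: "'w \<Rightarrow> int"
  assumes s_closed: "s \<in> carrier W" and t_closed: "t \<in> carrier W"
    and pos_one: "pos \<one> = 0"
    and pos_inj: "inj_on pos (carrier W)"
    and pos_s: "w \<in> carrier W \<Longrightarrow> pos (s \<otimes> w) = - pos w - 1"
    and pos_t: "w \<in> carrier W \<Longrightarrow> pos (t \<otimes> w) = 1 - pos w"
begin

definition alternating :: "'w list \<Rightarrow> bool" where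
  "alternating xs \<longleftrightarrow> set xs \<subseteq> {s, t} \<and> successively (\<noteq>) xs"

lemma pos_generators: "pos s = -1" "pos t = 1"
  using pos_s[of \<one>] pos_t[of \<one>] pos_one s_closed t_closed by auto

lemma s_neq_t: "s \<noteq> t"
  using pos_generators by auto

lemma word_prod_Nil [simp]: "word_prod W [] = \<one>"
  by (simp add: word_prod_def)

lemma word_prod_Cons [simp]: "word_prod W (x # xs) = x \<otimes> word_prod W xs"
  by (simp add: word_prod_def)

lemma word_prod_closed [simp]: "set xs \<subseteq> {s, t} \<Longrightarrow> word_prod W xs \<in> carrier W"
  by (induction xs) (auto simp: s_closed t_closed)

lemma word_prod_append:
  "set xs \<subseteq> {s, t} \<Longrightarrow> set ys \<subseteq> {s, t} \<Longrightarrow> word_prod W (xs @ ys) = word_prod W xs \<otimes> word_prod W ys"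
  by (induction xs) (auto simp: s_closed t_closed m_assoc)

lemma alternating_Cons:
  "alternating (x # xs) \<longleftrightarrow> x \<in> {s, t} \<and> alternating xs \<and> (xs = [] \<or> x \<noteq> hd xs)"
  by (cases xs) (auto simp: alternating_def)

lemma alternating_set: "alternating xs \<Longrightarrow> set xs \<subseteq> {s, t}"
  by (simp add: alternating_def)

lemma alternating_append:
  "alternating (xs @ ys) \<longleftrightarrow> alternating xs \<and> alternating ys \<and> (xs = [] \<or> ys = [] \<or> last xs \<noteq> hd ys)"
  by (auto simp: alternating_def successively_append_iff)

text \<open>One letter changes the absolute position by at most 1. This is the lower bound for the
  length of any word representing a given element.\<close>

lemma pos_word_le: "set xs \<subseteq> {s, t} \<Longrightarrow> \<bar>pos (word_prod W xs)\<bar> \<le> int (length xs)"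
  by (induction xs) (auto simp: pos_one pos_s pos_t)

text \<open>A letter different from the head always acts away from 0: \<open>s\<close> sends p \<ge>
  0 to -p - 1, and \<open>t\<close> sends p \<le> 0 to 1 - p.\<close>

lemma pos_alternating:
  "alternating xs \<Longrightarrow> pos (word_prod W xs) =
    (if xs \<noteq> [] \<and> hd xs = s then - int (length xs) else int (length xs))"
proof (induction xs)
  case (Cons x xs)
  then have a: "alternating xs" "x = s \<or> x = t" "xs = [] \<or> x \<noteq> hd xs"
    by (auto simp: alternating_Cons)
  have hd: "xs = [] \<or> hd xs = s \<or> hd xs = t" using a(1) alternating_set hd_in_set by blast
  have c: "word_prod W xs \<in> carrier W" using a(1) alternating_set by simp
  show ?case
    using a(2)
  proof
    assume x: "x = s"
    then have "pos (word_prod W xs) = int (length xs)" using Cons.IH[OF a(1)] a(3) by auto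
    then show ?thesis using pos_s[OF c] x by simp
  next
    assume x: "x = t"
    then have "pos (word_prod W xs) = - int (length xs)" using Cons.IH[OF a(1)] a(3) hd by auto
    then show ?thesis using pos_t[OF c] x s_neq_t by simp
  qed
qed (simp add: pos_one)

text \<open>The position dictates the word: its length is the absolute value, and its first letter
  is \<open>s\<close> exactly when the position is negative. Injectivity of \<open>pos\<close>
  identifies the resulting product with \<open>w\<close>.\<close>

lemma alternating_exists:
  assumes w: "w \<in> carrier W"
  obtains xs where "alternating xs" "word_prod W xs = w"
proof -
  have ex: "\<exists>xs. alternating xs \<and> length xs = n \<and> (xs = [] \<or> hd xs = r)" if "r \<in> {s, t}" for n r
    using that
  proof (induction n arbitrary: r)
    case 0
    show ?case by (intro exI[of _ "[]"]) (simp add: alternating_def)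
  next
    case (Suc n)
    define r' where "r' = (if r = s then t else s)"
    have "r' \<in> {s, t}" by (simp add: r'_def)
    then obtain xs where "alternating xs" "length xs = n" "xs = [] \<or> hd xs = r'"
      using Suc.IH by blast
    then show ?case
      using Suc.prems s_neq_t
      by (intro exI[of _ "r # xs"]) (auto simp: alternating_Cons r'_def split: if_splits)
  qed
  define r where "r = (if pos w < 0 then s else t)"
  have "r \<in> {s, t}" by (simp add: r_def)
  then obtain xs where xs: "alternating xs" "length xs = nat \<bar>pos w\<bar>" "xs = [] \<or> hd xs = r"
    using ex by blast
  have "pos (word_prod W xs) = pos w"
  proof (cases "pos w < 0")
    case True
    then have "xs \<noteq> []" "hd xs = s" using xs(2,3) by (auto simp: r_def)
    then show ?thesis using pos_alternating[OF xs(1)] xs(2) True by simp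
  next
    case False
    then have "\<not> (xs \<noteq> [] \<and> hd xs = s)" using xs(3) s_neq_t by (auto simp: r_def)
    then have "pos (word_prod W xs) = int (length xs)" using pos_alternating[OF xs(1)] by metis
    then show ?thesis using xs(2) False by simp
  qed
  then have "word_prod W xs = w"
    using pos_inj w xs(1) alternating_set by (auto dest!: inj_onD)
  then show ?thesis using that xs by blast
qed

text \<open>This is the case of equality in the length bound: a repeated letter would step back
  towards 0, and the bound could no longer be attained.\<close>

lemma alternating_if_long:
  "set xs \<subseteq> {s, t} \<Longrightarrow> \<bar>pos (word_prod W xs)\<bar> = int (length xs) \<Longrightarrow> alternating xs"
proof (induction xs)
  case (Cons x xs)
  have "\<bar>pos (word_prod W xs)\<bar> \<le> int (length xs)" using Cons.prems by (intro pos_word_le) auto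
  moreover have "pos (word_prod W (x # xs)) \<in> {- pos (word_prod W xs) - 1, 1 - pos (word_prod W xs)}"
    using Cons.prems by (auto simp: pos_s pos_t)
  ultimately have "\<bar>pos (word_prod W xs)\<bar> = int (length xs)"
    using Cons.prems(2) by auto
  then have alt: "alternating xs" using Cons by simp
  have c: "word_prod W xs \<in> carrier W" using alt alternating_set by simp
  have "x \<noteq> hd xs" if ne: "xs \<noteq> []"
  proof
    assume x: "x = hd xs"
    have len: "0 < int (length xs)" using ne by simp
    consider "x = s" | "x = t" using Cons.prems by auto
    then show False
    proof cases
      case 1
      then show ?thesis
        using Cons.prems(2) pos_alternating[OF alt] ne x pos_s[OF c] len by auto
    next
      case 2
      then show ?thesis
        using Cons.prems(2) pos_alternating[OF alt] ne x pos_t[OF c] s_neq_t len by auto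
    qed
  qed
  then show ?case using alt Cons.prems by (auto simp: alternating_Cons)
qed (simp add: alternating_def)

text \<open>Alternating words attain the length bound given by the position. A word of minimal
  length is no longer than such a word, so it attains the bound too and must alternate.\<close>

lemma is_reduced_word_iff:
  assumes "w \<in> carrier W"
  shows "is_reduced_word W {s, t} w xs \<longleftrightarrow> alternating xs \<and> word_prod W xs = w"
proof
  assume r: "is_reduced_word W {s, t} w xs"
  obtain ys where ys: "alternating ys" "word_prod W ys = w" using alternating_exists[OF assms] .
  then have "length xs \<le> length ys" using r alternating_set by (auto simp: is_reduced_word_def)
  moreover have "\<bar>pos w\<bar> = int (length ys)" using pos_alternating[OF ys(1)] ys(2) by auto
  moreover have xs: "set xs \<subseteq> {s, t}" "word_prod W xs = w" using r by (auto simp: is_reduced_word_def)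
  ultimately show "alternating xs \<and> word_prod W xs = w"
    using alternating_if_long[OF xs(1)] pos_word_le[OF xs(1)] by auto
next
  assume a: "alternating xs \<and> word_prod W xs = w"
  then have "\<bar>pos w\<bar> = int (length xs)" using pos_alternating[of xs] by auto
  then show "is_reduced_word W {s, t} w xs"
    using a alternating_set pos_word_le by (fastforce simp: is_reduced_word_def)
qed

text \<open>The sign of the position reveals the first letter, which can be cancelled. This
  uniqueness makes the definite description in \<open>reduced_word\<close> meaningful.\<close>

lemma alternating_unique:
  "alternating xs \<Longrightarrow> alternating ys \<Longrightarrow> word_prod W xs = word_prod W ys \<Longrightarrow> xs = ys"
proof (induction xs arbitrary: ys)
  case Nil
  then show ?case using pos_alternating[OF Nil(2)] pos_one by (auto split: if_splits)
next
  case (Cons x xs)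
  have "ys \<noteq> []"
    using pos_alternating[OF Cons.prems(1)] Cons.prems(3) pos_one by (auto split: if_splits)
  then obtain y zs where ys: "ys = y # zs" by (cases ys) auto
  have xy: "x \<in> {s, t}" "y \<in> {s, t}" "alternating xs" "alternating zs"
    using Cons.prems ys by (auto simp: alternating_Cons)
  have "x = y"
    using pos_alternating[OF Cons.prems(1)] pos_alternating[OF Cons.prems(2)] Cons.prems(3) ys xy
    by (auto split: if_splits)
  moreover have "word_prod W xs = word_prod W zs"
    using Cons.prems(3) ys xy \<open>x = y\<close> s_closed t_closed alternating_set by auto
  ultimately show ?case using Cons.IH xy ys by auto
qed

lemma reduced_word_eq: "alternating xs \<Longrightarrow> reduced_word W {s, t} (word_prod W xs) = xs"
  unfolding reduced_word_def
  by (rule the_equality) (auto simp: is_reduced_word_iff alternating_set intro: alternating_unique)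

lemma reduced_word:
  assumes "w \<in> carrier W"
  shows "alternating (reduced_word W {s, t} w)" "word_prod W (reduced_word W {s, t} w) = w"
  using alternating_exists[OF assms] reduced_word_eq by metis+

text \<open>Negation turns -p - 1 into 1 - (-p), so conjugating the action of \<open>s\<close> on
  positions by negation gives that of \<open>t\<close>. Induction on words extends this to all of
  \<open>W\<close>.\<close>

lemma pos_swap:
  assumes bar: "bar \<in> hom W W" "bar s = t" "bar t = s" and w: "w \<in> carrier W"
  shows "pos (bar w) = - pos w"
proof -
  have "pos (bar (word_prod W xs)) = - pos (word_prod W xs)" if "set xs \<subseteq> {s, t}" for xs
    using that
  proof (induction xs)
    case Nil
    have "bar \<one> = \<one>" using bar(1) is_group hom_one by blast
    then show ?case by (simp add: pos_one)
  next
    case (Cons x xs)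
    then have c: "word_prod W xs \<in> carrier W" "x \<in> {s, t}" by auto
    then have "bar (x \<otimes> word_prod W xs) = bar x \<otimes> bar (word_prod W xs)"
      using bar(1) s_closed t_closed by (auto simp: hom_def)
    moreover have c': "bar (word_prod W xs) \<in> carrier W" using bar(1) c by (auto simp: hom_def)
    moreover have "pos (bar (word_prod W xs)) = - pos (word_prod W xs)" using Cons by simp
    ultimately show ?case
      using c(2) bar(2,3) pos_s[OF c(1)] pos_t[OF c(1)] pos_s[OF c'] pos_t[OF c']
      by (elim insertE) simp_all
  qed
  then show ?thesis using reduced_word[OF w] alternating_set by metis
qed

end

text \<open>The assumptions isolate the facts about the tree from which the multiplication table is
  derived. The sign conditions in \<open>ascend_s\<close> and \<open>ascend_t\<close> say that the
  reduced word of \<open>w\<close> does not begin with the letter multiplied from the left.\<close>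

locale dihedral_hecke = infinite_dihedral W s t pos + H: hecke_pair G B
  for W :: "('w, 'n) monoid_scheme" (structure) and s t pos and G :: "('g, 'm) monoid_scheme" and B +
  fixes D :: "'w \<Rightarrow> 'g set" and q :: "'w \<Rightarrow> complex"
  assumes D_closed: "w \<in> carrier W \<Longrightarrow> D w \<in> double_cosets G B"
    and D_one: "D \<one> = B"
    and square: "r \<in> {s, t} \<Longrightarrow> double_coset_mult G B (D r) (D r) =
      q r *\<^sub>H Poly_Mapping.single B 1 + (q r - 1) *\<^sub>H Poly_Mapping.single (D r) 1"
    and ascend_s: "w \<in> carrier W \<Longrightarrow> 0 \<le> pos w \<Longrightarrow>
      double_coset_mult G B (D s) (D w) = Poly_Mapping.single (D (s \<otimes> w)) 1"
    and ascend_t: "w \<in> carrier W \<Longrightarrow> pos w \<le> 0 \<Longrightarrow>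
      double_coset_mult G B (D t) (D w) = Poly_Mapping.single (D (t \<otimes> w)) 1"
begin

abbreviation \<Delta> :: "'w list \<Rightarrow> 'g hecke" where
  "\<Delta> xs \<equiv> Poly_Mapping.single (D (word_prod W xs)) 1"

abbreviation hmult (infixl \<open>\<star>\<close> 70) where
  "f \<star> g \<equiv> hecke_mult G B f g"

lemma \<Delta>_assoc:
  assumes "set xs \<subseteq> {s, t}" "set ys \<subseteq> {s, t}" "set zs \<subseteq> {s, t}"
  shows "\<Delta> xs \<star> \<Delta> ys \<star> \<Delta> zs = \<Delta> xs \<star> (\<Delta> ys \<star> \<Delta> zs)"
  using assms by (intro H.hecke_mult_assoc_basis D_closed) simp_all

lemma \<Delta>_Cons:
  assumes "alternating (x # xs)"
  shows "\<Delta> [x] \<star> \<Delta> xs = \<Delta> (x # xs)"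
proof -
  have a: "alternating xs" "x \<in> {s, t}" "xs = [] \<or> x \<noteq> hd xs"
    using assms by (auto simp: alternating_Cons)
  then have c: "word_prod W xs \<in> carrier W" using alternating_set by simp
  have "xs \<noteq> [] \<Longrightarrow> hd xs \<in> {s, t}" using a alternating_set hd_in_set by blast
  then have "x = s \<and> 0 \<le> pos (word_prod W xs) \<or> x = t \<and> pos (word_prod W xs) \<le> 0"
    using a s_neq_t by (auto simp: pos_alternating)
  then show ?thesis
    using c s_closed t_closed by (auto simp: hecke_mult_single ascend_s ascend_t)
qed

lemma \<Delta>_append:
  "alternating (xs @ ys) \<Longrightarrow> \<Delta> xs \<star> \<Delta> ys = \<Delta> (xs @ ys)"
proof (induction xs)
  case Nil
  then show ?case
    using H.hecke_mult_one_left[OF D_closed] alternating_set by (simp add: D_one)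
next
  case (Cons x xs)
  have a: "alternating (x # xs)" "alternating ys" "alternating (xs @ ys)" "alternating (x # (xs @ ys))"
    using Cons.prems alternating_append[of "x # xs" ys] alternating_Cons[of x "xs @ ys"] by auto
  have sub: "set [x] \<subseteq> {s, t}" "set xs \<subseteq> {s, t}" "set ys \<subseteq> {s, t}"
    using a[THEN alternating_set] by auto
  have "\<Delta> (x # xs) \<star> \<Delta> ys = \<Delta> [x] \<star> \<Delta> xs \<star> \<Delta> ys" using \<Delta>_Cons[OF a(1)] by simp
  also have "\<dots> = \<Delta> [x] \<star> (\<Delta> xs \<star> \<Delta> ys)" by (rule \<Delta>_assoc[OF sub])
  also have "\<dots> = \<Delta> [x] \<star> \<Delta> (xs @ ys)" using Cons.IH a by simp
  also have "\<dots> = \<Delta> (x # (xs @ ys))" by (rule \<Delta>_Cons[OF a(4)])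
  finally show ?case by simp
qed

text \<open>Associativity isolates the square of \<open>\<Delta> [r]\<close>. In the linear term of
  the quadratic relation one \<open>r\<close> survives between \<open>xs\<close> and
  \<open>ys\<close>, so the word still alternates and gives a single basis element; the constant
  term leaves a product of shorter words.\<close>

lemma \<Delta>_cancel:
  assumes xs: "alternating (xs @ [r])" and ys: "alternating (r # ys)"
  shows "\<Delta> (xs @ [r]) \<star> \<Delta> (r # ys) = q r *\<^sub>H (\<Delta> xs \<star> \<Delta> ys) + (q r - 1) *\<^sub>H \<Delta> (xs @ r # ys)"
proof -
  have r: "r \<in> {s, t}" and sub: "set [r] \<subseteq> {s, t}" "set xs \<subseteq> {s, t}" "set ys \<subseteq> {s, t}"
    using alternating_set[OF xs] alternating_set[OF ys] by auto
  have a: "alternating xs" "alternating ys" "alternating (xs @ r # ys)"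
    using xs ys by (auto simp: alternating_append alternating_Cons)
  have rc: "r \<in> carrier W" using r s_closed t_closed by auto
  have "\<Delta> [r] \<star> \<Delta> [r] = q r *\<^sub>H \<Delta> [] + (q r - 1) *\<^sub>H \<Delta> [r]"
    using square[OF r] rc by (simp add: hecke_mult_single D_one)
  then have "\<Delta> [r] \<star> \<Delta> (r # ys) = q r *\<^sub>H (\<Delta> [] \<star> \<Delta> ys) + (q r - 1) *\<^sub>H (\<Delta> [r] \<star> \<Delta> ys)"
    using \<Delta>_Cons[OF ys] \<Delta>_assoc[OF sub(1,1,3)]
    by (metis hecke_mult_add_left hecke_mult_scale_left)
  then have *: "\<Delta> [r] \<star> \<Delta> (r # ys) = q r *\<^sub>H \<Delta> ys + (q r - 1) *\<^sub>H \<Delta> (r # ys)"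
    using \<Delta>_Cons[OF ys] \<Delta>_append[of "[]" ys] a by simp
  have "\<Delta> (xs @ [r]) \<star> \<Delta> (r # ys) = \<Delta> xs \<star> (\<Delta> [r] \<star> \<Delta> (r # ys))"
    using \<Delta>_append[OF xs] \<Delta>_assoc[OF sub(2,1) alternating_set[OF ys]] by simp
  also have "\<dots> = q r *\<^sub>H (\<Delta> xs \<star> \<Delta> ys) + (q r - 1) *\<^sub>H (\<Delta> xs \<star> \<Delta> (r # ys))"
    unfolding * by (simp add: hecke_mult_add_right hecke_mult_scale_right)
  finally show ?thesis using \<Delta>_append[OF a(3)] by simp
qed

text \<open>The induction on the second word generalizes \<open>r\<close> and \<open>u\<close>,
  because cancelling one letter exchanges their roles; this is the origin of the parity rule for the
  factors. The recursion stops when one word is exhausted, since the product is then a mere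
  concatenation.\<close>

lemma \<Delta>_mult_cancelling:
  fixes qw :: "'w list \<Rightarrow> complex"
  defines "qw \<equiv> \<lambda>v. \<Prod>r\<leftarrow>v. q r"
  assumes "alternating xs" "alternating ys" "xs \<noteq> []" "ys \<noteq> []" "last xs = r" "hd ys = r"
    and "{r, u} = {s, t}" "m = min (length xs) (length ys)"
  shows "\<Delta> xs \<star> \<Delta> ys =
      qw (last_letters m xs) *\<^sub>H \<Delta> (drop_last_letters m xs @ drop m ys)
    + (\<Sum>j<m. (qw (last_letters j xs) * (q (if even j then r else u) - 1))
        *\<^sub>H \<Delta> (drop_last_letters (j + 1) xs @ [ys ! j] @ drop (j + 1) ys))"
  using assms(2-)
proof (induction ys arbitrary: xs r u m)
  case (Cons y ys')
  define xs' where "xs' = butlast xs"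
  have xs: "xs = xs' @ [r]" and y: "y = r"
    using Cons.prems by (auto simp: xs'_def simp flip: append_butlast_last_id)
  have alt: "alternating (xs' @ [r])" "alternating (r # ys')" "alternating xs'" "alternating ys'"
    using Cons.prems xs y by (auto simp: alternating_append alternating_Cons)
  have step: "\<Delta> xs \<star> \<Delta> (y # ys') =
      q r *\<^sub>H (\<Delta> xs' \<star> \<Delta> ys') + (q r - 1) *\<^sub>H \<Delta> (xs' @ r # ys')"
    unfolding xs y by (rule \<Delta>_cancel[OF alt(1,2)])
  have ll: "last_letters (Suc j) xs = last_letters j xs' @ [r]"
      "drop_last_letters (Suc j) xs = drop_last_letters j xs'" if "j \<le> length xs'" for j
    using that by (auto simp: xs last_letters_def drop_last_letters_def)
  have qw_snoc: "qw (v @ [r]) = qw v * q r" for v by (simp add: qw_def)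
  have [simp]: "last_letters 0 v = []" "drop_last_letters 0 v = v" "qw [] = 1" for v
    by (simp_all add: last_letters_def drop_last_letters_def qw_def)
  show ?case
  proof (cases "xs' = [] \<or> ys' = []")
    case True
    then have m: "m = Suc 0" using Cons.prems(8) xs by auto
    have "alternating (xs' @ ys')" using True alt by auto
    then have "\<Delta> xs' \<star> \<Delta> ys' = \<Delta> (xs' @ ys')" by (rule \<Delta>_append)
    then show ?thesis
      using step ll[of 0] qw_snoc[of "[]"] by (simp add: m y)
  next
    case False
    define m' where "m' = min (length xs') (length ys')"
    have m: "m = Suc m'" using Cons.prems(8) xs by (auto simp: m'_def)
    have "last xs' \<in> {s, t}" "hd ys' \<in> {s, t}"
      using False alternating_set[OF alt(3)] alternating_set[OF alt(4)] last_in_set hd_in_set by blast+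
    moreover have "last xs' \<noteq> r" "hd ys' \<noteq> r"
      using alt False by (auto simp: alternating_append alternating_Cons)
    moreover have "{u, r} = {s, t}" using Cons.prems(7) by auto
    ultimately have lh: "last xs' = u" "hd ys' = u" by auto
    have IH: "\<Delta> xs' \<star> \<Delta> ys' =
        qw (last_letters m' xs') *\<^sub>H \<Delta> (drop_last_letters m' xs' @ drop m' ys')
      + (\<Sum>j<m'. (qw (last_letters j xs') * (q (if even j then u else r) - 1))
          *\<^sub>H \<Delta> (drop_last_letters (j + 1) xs' @ [ys' ! j] @ drop (j + 1) ys'))"
      using False lh \<open>{u, r} = {s, t}\<close> by (intro Cons.IH[OF alt(3,4)]) (auto simp: m'_def)
    have m'_le: "m' \<le> length xs'" by (simp add: m'_def)
    \<comment> \<open>The term for j = 0 is the linear term of the new cancellation; the others form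
      the sum for the shorter words, shifted by one index and multiplied by
      \<open>q r\<close>.\<close>
    have sum: "(\<Sum>j<m. (qw (last_letters j xs) * (q (if even j then r else u) - 1))
          *\<^sub>H \<Delta> (drop_last_letters (j + 1) xs @ [(y # ys') ! j] @ drop (j + 1) (y # ys'))) =
        (q r - 1) *\<^sub>H \<Delta> (xs' @ r # ys') +
        q r *\<^sub>H (\<Sum>j<m'. (qw (last_letters j xs') * (q (if even j then u else r) - 1))
          *\<^sub>H \<Delta> (drop_last_letters (j + 1) xs' @ [ys' ! j] @ drop (j + 1) ys'))"
      unfolding m sum.lessThan_Suc_shift hecke_scale_sum
    proof (intro arg_cong2[where f = "(+)"] sum.cong refl)
      show "(qw (last_letters 0 xs) * (q (if even 0 then r else u) - 1)) *\<^sub>H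
          \<Delta> (drop_last_letters (0 + 1) xs @ [(y # ys') ! 0] @ drop (0 + 1) (y # ys')) =
        (q r - 1) *\<^sub>H \<Delta> (xs' @ r # ys')"
        using ll[of 0] by (simp add: y)
      fix j assume "j \<in> {..<m'}"
      then have "Suc j \<le> length xs'" "j \<le> length xs'" using m'_le by auto
      then show "(qw (last_letters (Suc j) xs) * (q (if even (Suc j) then r else u) - 1)) *\<^sub>H
          \<Delta> (drop_last_letters (Suc j + 1) xs @ [(y # ys') ! Suc j] @ drop (Suc j + 1) (y # ys')) =
        q r *\<^sub>H (qw (last_letters j xs') * (q (if even j then u else r) - 1)) *\<^sub>H
          \<Delta> (drop_last_letters (j + 1) xs' @ [ys' ! j] @ drop (j + 1) ys')"
        using ll[of j] ll[of "Suc j"] by (simp add: qw_snoc mult_ac)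
    qed
    show ?thesis
      unfolding step IH sum hecke_scale_add
      using ll[OF m'_le] by (simp add: m qw_snoc mult_ac add_ac)
  qed
qed simp

end

section \<open>Trees\<close>

definition graph_dist :: "'v graph \<Rightarrow> 'v \<Rightarrow> 'v \<Rightarrow> nat" where
  "graph_dist X u v = (LEAST n. (adjacent X ^^ n) u v)"

text \<open>A local condition is enough: in a tree, a walk without backtracking is automatically
  geodesic and injective. Locality also makes the gluing of two lines easy to verify.\<close>

definition line :: "'v graph \<Rightarrow> (int \<Rightarrow> 'v) \<Rightarrow> bool" where
  "line X l \<longleftrightarrow> (\<forall>k. adjacent X (l k) (l (k + 1)) \<and> l k \<noteq> l (k + 2))"

lemma adjacent_commute: "adjacent X u v \<longleftrightarrow> adjacent X v u"
  by (simp add: adjacent_def insert_commute)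

lemma adjacent_sym: "adjacent X u v \<Longrightarrow> adjacent X v u"
  by (simp add: adjacent_commute[of X u])

lemma relpowp_adjacent_commute: "(adjacent X ^^ n) u v \<longleftrightarrow> (adjacent X ^^ n) v u"
proof -
  have "(adjacent X ^^ n) v u" if "(adjacent X ^^ n) u v" for u v
    using that
  proof (induction n arbitrary: v)
    case (Suc n)
    then obtain w where "(adjacent X ^^ n) u w" "adjacent X w v"
      by auto
    then show ?case
      using Suc.IH adjacent_commute by (metis relpowp_Suc_I2)
  qed auto
  then show ?thesis by blast
qed

lemma graph_dist_commute: "graph_dist X u v = graph_dist X v u"
  by (simp add: graph_dist_def relpowp_adjacent_commute)

lemma graph_dist_le: "(adjacent X ^^ n) u v \<Longrightarrow> graph_dist X u v \<le> n"
  unfolding graph_dist_def by (rule Least_le)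

lemma graph_dist_self [simp]: "graph_dist X u u = 0"
  using graph_dist_le[of 0 X u u] by simp

text \<open>Loops are cut out of a walk. The last clause records that the path stays among the
  points reachable from \<open>a\<close>, which later keeps it away from a forbidden vertex.\<close>

lemma rtranclp_distinct_path:
  assumes "R\<^sup>*\<^sup>* a b"
  obtains p where "p \<noteq> []" "hd p = a" "last p = b" "distinct p" "successively R p"
    "\<And>x. x \<in> set p \<Longrightarrow> R\<^sup>*\<^sup>* a x"
proof -
  have "\<exists>p. p \<noteq> [] \<and> hd p = a \<and> last p = b \<and> distinct p \<and> successively R p \<and> (\<forall>x\<in>set p. R\<^sup>*\<^sup>* a x)"
    using assms
  proof (induction rule: converse_rtranclp_induct)
    case base
    show ?case by (rule exI[of _ "[b]"]) auto
  next
    case (step a a')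
    then obtain p where p: "p \<noteq> []" "hd p = a'" "last p = b" "distinct p" "successively R p"
        "\<forall>x\<in>set p. R\<^sup>*\<^sup>* a' x"
      by auto
    show ?case
    proof (cases "a \<in> set p")
      case True
      then obtain ys zs where d: "p = ys @ a # zs" by (meson split_list)
      have "\<forall>x\<in>set (a # zs). R\<^sup>*\<^sup>* a x"
        using p(6) d step(1) by (auto intro: converse_rtranclp_into_rtranclp)
      then show ?thesis
        using p d by (intro exI[of _ "a # zs"]) (auto simp: successively_append_iff)
    next
      case False
      have "successively R (a # p)" using p step(1) by (cases p) auto
      moreover have "\<forall>x\<in>set (a # p). R\<^sup>*\<^sup>* a x"
        using p(6) step(1) by (auto intro: converse_rtranclp_into_rtranclp)
      ultimately show ?thesis
        using p False by (intro exI[of _ "a # p"]) auto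
    qed
  qed
  then show ?thesis using that by blast
qed

lemma range_affine:
  fixes l :: "int \<Rightarrow> 'v"
  assumes s: "\<sigma> \<in> {1, -1}"
  shows "range (\<lambda>k. l (\<sigma> * k + c)) = range l"
    and "range (\<lambda>k. {l (\<sigma> * k + c), l (\<sigma> * (k + 1) + c)}) = range (\<lambda>k. {l k, l (k + 1)})"
proof -
  have "l k = l (\<sigma> * (\<sigma> * (k - c)) + c)" for k using s by auto
  then show "range (\<lambda>k. l (\<sigma> * k + c)) = range l" by blast
  show "range (\<lambda>k. {l (\<sigma> * k + c), l (\<sigma> * (k + 1) + c)}) = range (\<lambda>k. {l k, l (k + 1)})"
  proof (cases "\<sigma> = 1")
    case True
    have "{l k, l (k + 1)} = {l (1 * (k - c) + c), l (1 * ((k - c) + 1) + c)}" for k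
      by (simp add: algebra_simps)
    moreover have "{l (1 * k + c), l (1 * (k + 1) + c)} = {l (k + c), l ((k + c) + 1)}" for k
      by (simp add: algebra_simps)
    ultimately show ?thesis unfolding True by blast
  next
    case False
    then have m: "\<sigma> = -1" using s by simp
    \<comment> \<open>The reflection k -> c - k sends the edge at index k to the edge at index c - k
      - 1, which explains the witness.\<close>
    have "{l k, l (k + 1)} = {l (-1 * (c - k - 1) + c), l (-1 * ((c - k - 1) + 1) + c)}" for k
      by (simp add: algebra_simps insert_commute)
    moreover have "{l (-1 * k + c), l (-1 * (k + 1) + c)} = {l (c - k - 1), l ((c - k - 1) + 1)}" for k
      by (simp add: algebra_simps insert_commute)
    ultimately show ?thesis unfolding m by blast
  qed
qed

locale tree_graph =
  fixes X :: "'v graph"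
  assumes tree: "tree X"
begin

abbreviation "d \<equiv> graph_dist X"

lemma adjacent_vertices: "adjacent X u v \<Longrightarrow> u \<in> fst X \<and> v \<in> fst X"
  using tree by (auto simp: tree_def simple_graph_def adjacent_def)

lemma adjacent_distinct: "adjacent X u v \<Longrightarrow> u \<noteq> v"
  using tree by (auto simp: tree_def simple_graph_def adjacent_def)

lemma walk_exists:
  assumes "u \<in> fst X" "v \<in> fst X"
  shows "\<exists>n. (adjacent X ^^ n) u v"
proof -
  obtain p where p: "p \<noteq> []" "hd p = u" "last p = v" "successively (adjacent X) p"
    using assms tree unfolding tree_def connected_graph_def by blast
  have "(adjacent X)\<^sup>*\<^sup>* (hd p) (last p)" if "p \<noteq> []" "successively (adjacent X) p" for p
    using that
  proof (induction p)
    case (Cons a p)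
    show ?case
    proof (cases p)
      case (Cons b q)
      then have "adjacent X a b" "(adjacent X)\<^sup>*\<^sup>* b (last p)"
        using Cons.IH Cons.prems by auto
      then show ?thesis using Cons by (auto intro: converse_rtranclp_into_rtranclp)
    qed auto
  qed auto
  then show ?thesis using p rtranclp_imp_relpowp by metis
qed

lemma graph_dist_walk: "u \<in> fst X \<Longrightarrow> v \<in> fst X \<Longrightarrow> (adjacent X ^^ d u v) u v"
  unfolding graph_dist_def using walk_exists by (meson LeastI_ex)

lemma graph_dist_eq_0: "u \<in> fst X \<Longrightarrow> v \<in> fst X \<Longrightarrow> d u v = 0 \<longleftrightarrow> u = v"
  using graph_dist_walk[of u v] by auto

lemma graph_dist_step: "x \<in> fst X \<Longrightarrow> adjacent X u v \<Longrightarrow> d x v \<le> d x u + 1"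
  using graph_dist_walk[of x u] adjacent_vertices graph_dist_le[of "Suc (d x u)" X x v] by auto

lemma closer_neighbour:
  assumes "x \<in> fst X" "v \<in> fst X" "x \<noteq> v"
  obtains w where "adjacent X w v" "d x v = d x w + 1"
proof -
  obtain n where n: "d x v = Suc n"
    using assms graph_dist_eq_0 not0_implies_Suc by metis
  then have "(adjacent X ^^ Suc n) x v" using graph_dist_walk[of x v] assms by simp
  then obtain w where w: "(adjacent X ^^ n) x w" "adjacent X w v" by auto
  then have "d x w \<le> n" "d x v \<le> d x w + 1"
    using graph_dist_le graph_dist_step assms by metis+
  then show ?thesis using that[of w] w n by linarith
qed

text \<open>Shortest walks from \<open>a\<close> and from \<open>b\<close> to \<open>x\<close> avoid
  \<open>c\<close>, because distances to \<open>x\<close> drop along them. So \<open>a\<close> and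
  \<open>b\<close> are joined away from \<open>c\<close>, and closing up through \<open>c\<close>
  would give a cycle. With the weak inequalities the lemma also excludes adjacent vertices at equal
  distance from \<open>x\<close>.\<close>

lemma closer_neighbour_unique:
  assumes a: "adjacent X a c" and b: "adjacent X b c" and x: "x \<in> fst X"
    and da: "d x a \<le> d x c" and db: "d x b \<le> d x c"
  shows "a = b"
proof (rule ccontr)
  assume ne: "a \<noteq> b"
  let ?R = "\<lambda>u v. adjacent X u v \<and> u \<noteq> c \<and> v \<noteq> c"
  have xc: "x \<noteq> c"
    using da a x graph_dist_eq_0[of x a] adjacent_vertices adjacent_distinct by auto
  have reach: "?R\<^sup>*\<^sup>* x y" if "y \<in> fst X" "y \<noteq> c" "d x y \<le> d x c" for y
    using that
  proof (induction "d x y" arbitrary: y)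
    case 0
    then show ?case using x graph_dist_eq_0[of x y] by auto
  next
    case (Suc n)
    then have "x \<noteq> y" by auto
    then obtain w where w: "adjacent X w y" "d x y = d x w + 1"
      using closer_neighbour Suc.prems x by blast
    then have "w \<noteq> c" using Suc.prems by auto
    then have "?R\<^sup>*\<^sup>* x w"
      using w Suc.hyps adjacent_vertices Suc.prems by auto
    then show ?case
      using w \<open>w \<noteq> c\<close> Suc.prems by (simp add: rtranclp.rtrancl_into_rtrancl)
  qed
  have "symp ?R" by (auto simp: symp_def adjacent_commute)
  then have "?R\<^sup>*\<^sup>* a x"
    using reach[of a] da a adjacent_vertices adjacent_distinct by (meson symp_rtranclp sympD)
  moreover have "?R\<^sup>*\<^sup>* x b"
    using reach[of b] db b adjacent_vertices adjacent_distinct by blast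
  ultimately have "?R\<^sup>*\<^sup>* a b" by auto
  then obtain p where p: "p \<noteq> []" "hd p = a" "last p = b" "distinct p" "successively ?R p"
      "\<And>x. x \<in> set p \<Longrightarrow> ?R\<^sup>*\<^sup>* a x"
    using rtranclp_distinct_path by (smt (verit))
  have "y \<noteq> c" if "?R\<^sup>*\<^sup>* a y" for y
    using that a adjacent_distinct by (cases rule: rtranclp.cases) auto
  then have "c \<notin> set p" using p(6) by blast
  moreover have "2 \<le> length p"
    using p(1-3) ne by (cases p; cases "tl p") auto
  moreover have "successively (adjacent X) p"
    using p(5) by (rule successively_mono) auto
  ultimately have "graph_cycle X (c # p)"
    using p a b by (auto simp: graph_cycle_def adjacent_commute successively_Cons)
  then show False using tree by (auto simp: tree_def)
qed

text \<open>At equal distances, \<open>v\<close> and the neighbour of \<open>u\<close> closer to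
  \<open>x\<close> would both be no farther than \<open>u\<close>, hence equal, which is
  absurd.\<close>

lemma graph_dist_adjacent:
  assumes x: "x \<in> fst X" and uv: "adjacent X u v"
  shows "d x u = d x v + 1 \<or> d x v = d x u + 1"
proof -
  have 1: "d x v \<le> d x u + 1" "d x u \<le> d x v + 1"
    using graph_dist_step[OF x] uv adjacent_commute by metis+
  have "d x u \<noteq> d x v"
  proof
    assume e: "d x u = d x v"
    have "x \<noteq> u"
      using e uv x graph_dist_eq_0[of x v] adjacent_vertices adjacent_distinct by force
    then obtain w where w: "adjacent X w u" "d x u = d x w + 1"
      using closer_neighbour[of x u] x adjacent_vertices[OF uv] by blast
    have "w = v"
      using closer_neighbour_unique[OF w(1) adjacent_sym[OF uv] x] w e by simp
    then show False using w e by simp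
  qed
  then show ?thesis using 1 by linarith
qed

lemma graph_dist_1: "adjacent X u v \<Longrightarrow> d u v = 1"
  using graph_dist_adjacent[of u u v] adjacent_vertices by auto

lemma even_walk:
  assumes "x \<in> fst X" "(adjacent X ^^ n) u v"
  shows "even n \<longleftrightarrow> (even (d x u) \<longleftrightarrow> even (d x v))"
  using assms(2)
proof (induction n arbitrary: v)
  case (Suc n)
  then obtain w where w: "(adjacent X ^^ n) u w" "adjacent X w v" by auto
  then show ?case
    using Suc.IH graph_dist_adjacent[OF assms(1) w(2)] by auto
qed auto

lemma even_graph_dist:
  "x \<in> fst X \<Longrightarrow> u \<in> fst X \<Longrightarrow> v \<in> fst X \<Longrightarrow> even (d u v) \<longleftrightarrow> (even (d x u) \<longleftrightarrow> even (d x v))"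
  using even_walk graph_dist_walk by blast

lemma bipartition_parity:
  assumes "x \<in> fst X"
  shows "bipartition X {v \<in> fst X. even (d x v)} {v \<in> fst X. odd (d x v)}"
proof -
  have "e \<inter> {v \<in> fst X. even (d x v)} \<noteq> {} \<and> e \<inter> {v \<in> fst X. odd (d x v)} \<noteq> {}"
    if "e \<in> snd X" for e
  proof -
    have "card e = 2" using that tree by (auto simp: tree_def simple_graph_def)
    then obtain u v where e: "e = {u, v}" by (auto simp: card_2_iff)
    then have uv: "adjacent X u v" using that by (simp add: adjacent_def)
    then show ?thesis
      using graph_dist_adjacent[OF assms uv] adjacent_vertices[OF uv] e by auto
  qed
  then show ?thesis by (auto simp: bipartition_def)
qed

text \<open>Crossing an edge changes the class, so every bipartition is the one by parity of
  distances. Types can therefore be treated as parities.\<close>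

lemma bipartition_even_dist:
  assumes "bipartition X P Q" "u \<in> fst X" "v \<in> fst X"
  shows "(u \<in> P \<longleftrightarrow> v \<in> P) \<longleftrightarrow> even (d u v)"
proof -
  have adj: "u \<in> P \<longleftrightarrow> v \<notin> P" if "adjacent X u v" for u v
  proof -
    have "{u, v} \<inter> P \<noteq> {} \<and> {u, v} \<inter> Q \<noteq> {}" "P \<inter> Q = {}"
      using that assms(1) by (auto simp: bipartition_def adjacent_def)
    then show ?thesis by blast
  qed
  have "(u \<in> P \<longleftrightarrow> v \<in> P) \<longleftrightarrow> even n" if "(adjacent X ^^ n) u v" for n
    using that
  proof (induction n arbitrary: v)
    case (Suc n)
    then obtain w where w: "(adjacent X ^^ n) u w" "adjacent X w v" by auto
    then show ?case using Suc.IH adj by auto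
  qed auto
  then show ?thesis using graph_dist_walk assms by blast
qed

section \<open>Lines without backtracking\<close>

lemma line_adjacent: "line X l \<Longrightarrow> adjacent X (l k) (l (k + 1))"
  by (simp add: line_def)

lemma line_vertex: "line X l \<Longrightarrow> l k \<in> fst X"
  using line_adjacent adjacent_vertices by blast

text \<open>Two consecutive distances are carried through the induction. If the next vertex were not
  farther away, it would coincide by \<open>closer_neighbour_unique\<close> with the vertex two
  steps before it, contrary to the absence of backtracking.\<close>

lemma line_dist_aux:
  assumes l: "line X l"
  shows "d (l i) (l (i + int n)) = n \<and> d (l i) (l (i + int n + 1)) = n + 1"
proof (induction n)
  case 0
  then show ?case using graph_dist_1 line_adjacent[OF l, of i] by simp
next
  case (Suc n)
  let ?j = "i + int n"
  have a: "adjacent X (l ?j) (l (?j + 1))" "adjacent X (l (?j + 2)) (l (?j + 1))"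
    using line_adjacent[OF l, of ?j] adjacent_sym[OF line_adjacent[OF l, of "?j + 1"]]
    by (auto simp: add.assoc)
  have "l ?j \<noteq> l (?j + 2)" using l by (simp add: line_def)
  then have "\<not> d (l i) (l (?j + 2)) \<le> d (l i) (l (?j + 1))"
    using closer_neighbour_unique[OF a line_vertex[OF l, of i]] Suc by auto
  then have "d (l i) (l (?j + 2)) = n + 2"
    using graph_dist_adjacent[OF line_vertex[OF l, of i] a(2)] Suc by auto
  then show ?case using Suc by (simp add: algebra_simps)
qed

lemma line_dist:
  assumes l: "line X l"
  shows "d (l i) (l j) = nat \<bar>i - j\<bar>"
proof (cases "i \<le> j")
  case True
  then show ?thesis using line_dist_aux[OF l, of i "nat (j - i)"] by simp
next
  case False
  then show ?thesis
    using line_dist_aux[OF l, of j "nat (i - j)"] graph_dist_commute[of X "l i"] by simp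
qed

lemma line_inj: "line X l \<Longrightarrow> l i = l j \<longleftrightarrow> i = j"
  using line_dist[of l i j] by auto

lemma line_affine:
  assumes "\<sigma> \<in> {1, -1}" "line X l"
  shows "line X (\<lambda>k. l (\<sigma> * k + c))"
proof -
  have "adjacent X (l (c - k)) (l (c - k - 1))" for k
    using adjacent_sym[OF line_adjacent[OF assms(2), of "c - k - 1"]] by auto
  moreover have "adjacent X (l (k + c)) (l (k + 1 + c))" for k
    using line_adjacent[OF assms(2), of "k + c"] by (simp add: algebra_simps)
  ultimately show ?thesis
    using assms line_inj[OF assms(2)] by (auto simp: line_def algebra_simps)
qed

text \<open>Distances make the index map an isometry of the integers, and such a map is a
  translation or a reflection, determined by the images of 0 and 1.\<close>

lemma line_reparam:
  assumes l: "line X l" and m: "line X m" and sub: "range m \<subseteq> range l"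
  obtains \<sigma> c where "\<sigma> \<in> {1, -1 :: int}" "\<And>k. m k = l (\<sigma> * k + c)"
proof -
  have "\<exists>j. m k = l j" for k using sub by auto
  then obtain f where f: "\<And>k. m k = l (f k)" by metis
  have iso: "\<bar>f i - f j\<bar> = \<bar>i - j\<bar>" for i j
    using line_dist[OF l, of "f i" "f j"] line_dist[OF m, of i j] f by simp
  define \<sigma> where "\<sigma> = f 1 - f 0"
  have s: "\<sigma> \<in> {1, -1}" using iso[of 1 0] by (auto simp: \<sigma>_def)
  have fk: "f k = \<sigma> * k + f 0" for k
  proof -
    have "\<bar>f k - f 0\<bar> = \<bar>k\<bar>" "\<bar>f k - f 1\<bar> = \<bar>k - 1\<bar>" using iso[of k 0] iso[of k 1] by auto
    then show ?thesis using s by (auto simp: \<sigma>_def)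
  qed
  have "m k = l (\<sigma> * k + f 0)" for k using f[of k] fk[of k] by simp
  then show ?thesis by (rule that[OF s])
qed

lemma biinfinite_geodesics_line:
  "A \<in> biinfinite_geodesics X \<longleftrightarrow>
    (\<exists>l. line X l \<and> fst A = range l \<and> snd A = range (\<lambda>k. {l k, l (k + 1)}))"
proof
  assume "A \<in> biinfinite_geodesics X"
  then obtain l :: "int \<Rightarrow> 'v" where l: "inj l" "fst A = range l" "snd A = range (\<lambda>k. {l k, l (k + 1)})"
      "snd A \<subseteq> snd X"
    unfolding biinfinite_geodesics_def by blast
  then have "line X l" by (auto simp: line_def adjacent_def dest: injD)
  then show "\<exists>l. line X l \<and> fst A = range l \<and> snd A = range (\<lambda>k. {l k, l (k + 1)})"
    using l by blast
next
  assume "\<exists>l. line X l \<and> fst A = range l \<and> snd A = range (\<lambda>k. {l k, l (k + 1)})"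
  then obtain l where l: "line X l" "fst A = range l" "snd A = range (\<lambda>k. {l k, l (k + 1)})"
    by blast
  then have "inj l" "fst A \<subseteq> fst X" "snd A \<subseteq> snd X"
    using line_inj[OF l(1)] line_vertex[OF l(1)] line_adjacent[OF l(1)]
    by (auto simp: adjacent_def inj_def)
  then show "A \<in> biinfinite_geodesics X"
    using l by (auto simp: biinfinite_geodesics_def)
qed

text \<open>Away from the seam both conditions are inherited; the last hypothesis forbids
  backtracking at the seam itself.\<close>

lemma line_splice:
  assumes "line X l" "line X m" "l n = m n" "l (n - 1) \<noteq> m (n + 1)"
  shows "line X (\<lambda>k. if k \<le> n then l k else m k)"
  unfolding line_def
proof
  fix k
  consider "k + 2 \<le> n" | "k + 1 = n" | "k = n" | "k > n" by linarith
  then show "adjacent X (if k \<le> n then l k else m k) (if k + 1 \<le> n then l (k + 1) else m (k + 1)) \<and>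
      (if k \<le> n then l k else m k) \<noteq> (if k + 2 \<le> n then l (k + 2) else m (k + 2))"
  proof cases
    case 2
    then have "k = n - 1" by simp
    then show ?thesis using assms line_adjacent[OF assms(1), of k] by (auto simp: add.commute)
  qed (use assms in \<open>auto simp: line_def\<close>)
qed

text \<open>Going back from the positive side of the edge \<open>{x, y}\<close>, one leaves that side only through
  the edge itself.\<close>

lemma closer_neighbour_side:
  assumes xy: "adjacent X x y" and ab: "adjacent X a b"
    and "d x a < d x b" "d y b < d x b"
  shows "(a = x \<and> b = y) \<or> d y a < d x a"
proof -
  have v: "x \<in> fst X" "y \<in> fst X" "a \<in> fst X" "b \<in> fst X"
    using xy ab adjacent_vertices by auto
  have dxb: "d x b = d y b + 1"
    using graph_dist_adjacent[OF v(4) xy] assms(4) by (simp add: graph_dist_commute)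
  have dxa: "d x b = d x a + 1" using graph_dist_adjacent[OF v(1) ab] assms(3) by auto
  show ?thesis
  proof (cases "y = b")
    case True
    then show ?thesis using dxa dxb v graph_dist_eq_0 by auto
  next
    case False
    then obtain w where w: "adjacent X w b" "d y b = d y w + 1"
      using closer_neighbour v by blast
    have "d x w \<le> d y w + 1"
      using graph_dist_step[of w y x] xy adjacent_commute adjacent_vertices w
      by (metis graph_dist_commute)
    then have "a = w"
      using closer_neighbour_unique[OF ab w(1) v(1)] w dxb assms(3) by simp
    then show ?thesis using w dxa dxb by simp
  qed
qed

end

section \<open>Strongly transitive actions\<close>

locale tree_action = group G + tree_graph X + group_action G "fst X" \<phi>
  for G :: "('g, 'm) monoid_scheme" (structure) and X :: "'v graph" and \<phi> +
  assumes edges_image: "g \<in> carrier G \<Longrightarrow> (\<lambda>e. \<phi> g ` e) ` snd X = snd X"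
begin

lemma act_vertex: "g \<in> carrier G \<Longrightarrow> v \<in> fst X \<Longrightarrow> \<phi> g v \<in> fst X"
  using element_image by blast

lemma act_mult: "g \<in> carrier G \<Longrightarrow> h \<in> carrier G \<Longrightarrow> v \<in> fst X \<Longrightarrow> \<phi> (g \<otimes> h) v = \<phi> g (\<phi> h v)"
  using composition_rule by blast

lemma act_one: "v \<in> fst X \<Longrightarrow> \<phi> \<one> v = v"
  using id_eq_one by (metis restrict_apply')

lemma act_inv_act: "g \<in> carrier G \<Longrightarrow> v \<in> fst X \<Longrightarrow> \<phi> (inv g) (\<phi> g v) = v"
  using orbit_sym_aux by blast

lemma act_act_inv: "g \<in> carrier G \<Longrightarrow> v \<in> fst X \<Longrightarrow> \<phi> g (\<phi> (inv g) v) = v"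
  using act_inv_act[of "inv g" v] by simp

lemma act_eq_iff: "g \<in> carrier G \<Longrightarrow> u \<in> fst X \<Longrightarrow> v \<in> fst X \<Longrightarrow> \<phi> g u = \<phi> g v \<longleftrightarrow> u = v"
  using act_inv_act by metis

lemma act_adjacent: "g \<in> carrier G \<Longrightarrow> adjacent X u v \<Longrightarrow> adjacent X (\<phi> g u) (\<phi> g v)"
  using edges_image[of g] unfolding adjacent_def by (metis image_empty image_eqI image_insert)

lemma act_dist:
  assumes g: "g \<in> carrier G" and uv: "u \<in> fst X" "v \<in> fst X"
  shows "d (\<phi> g u) (\<phi> g v) = d u v"
proof -
  have le: "d (\<phi> h x) (\<phi> h y) \<le> d x y" if h: "h \<in> carrier G" and xy: "x \<in> fst X" "y \<in> fst X" for h x y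
  proof -
    have "(adjacent X ^^ n) (\<phi> h x) (\<phi> h y)" if "(adjacent X ^^ n) x y" for n
      using that
    proof (induction n arbitrary: y)
      case (Suc n)
      then show ?case using act_adjacent[OF h] by auto
    qed auto
    then show ?thesis using graph_dist_walk[OF xy] graph_dist_le by metis
  qed
  have "d u v = d (\<phi> (inv g) (\<phi> g u)) (\<phi> (inv g) (\<phi> g v))"
    using g uv act_inv_act by simp
  also have "\<dots> \<le> d (\<phi> g u) (\<phi> g v)"
    using g uv act_vertex by (intro le) auto
  finally show ?thesis using le[OF g uv] by simp
qed

lemma act_line: "g \<in> carrier G \<Longrightarrow> line X m \<Longrightarrow> line X (\<lambda>k. \<phi> g (m k))"
  using act_adjacent act_eq_iff line_vertex[of m] by (auto simp: line_def)

text \<open>The displacement of \<open>g\<close> has the same parity at all vertices, because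
  \<open>g\<close> preserves distances; a single vertex therefore decides.\<close>

lemma type_preserving_iff:
  assumes g: "g \<in> carrier G" and x: "x \<in> fst X"
  shows "type_preserving X (\<phi> g) \<longleftrightarrow> even (d x (\<phi> g x))"
proof
  assume tp: "type_preserving X (\<phi> g)"
  have "\<phi> g ` {v \<in> fst X. even (d x v)} = {v \<in> fst X. even (d x v)}"
    using tp bipartition_parity[OF x] by (auto simp: type_preserving_def)
  then show "even (d x (\<phi> g x))" using x by fastforce
next
  assume ev: "even (d x (\<phi> g x))"
  have all: "even (d v (\<phi> g v))" if v: "v \<in> fst X" for v
  proof -
    have "even (d x v) \<longleftrightarrow> even (d (\<phi> g x) (\<phi> g v))" using act_dist g x v by simp
    then show ?thesis using ev even_graph_dist x v act_vertex[OF g] by metis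
  qed
  show "type_preserving X (\<phi> g)"
    unfolding type_preserving_def
  proof (intro allI impI)
    fix P Q assume PQ: "bipartition X P Q"
    have P: "\<phi> g v \<in> P \<longleftrightarrow> v \<in> P" if "v \<in> fst X" for v
      using bipartition_even_dist[OF PQ that act_vertex[OF g that]] all[OF that] by blast
    have sub: "P \<subseteq> fst X" "Q = fst X - P" using PQ by (auto simp: bipartition_def)
    have ex: "\<exists>w\<in>fst X. v = \<phi> g w" if "v \<in> fst X" for v
      using that g surj_prop by blast
    have im: "\<phi> g ` S = S" if S: "S \<subseteq> fst X" "\<And>v. v \<in> fst X \<Longrightarrow> \<phi> g v \<in> S \<longleftrightarrow> v \<in> S" for S
    proof
      show "\<phi> g ` S \<subseteq> S" using S by blast
      show "S \<subseteq> \<phi> g ` S"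
      proof
        fix v assume "v \<in> S"
        moreover then obtain w where "w \<in> fst X" "v = \<phi> g w" using ex S(1) by blast
        ultimately show "v \<in> \<phi> g ` S" using S(2) by blast
      qed
    qed
    have "\<phi> g ` P = P" using P sub by (intro im) auto
    moreover have "\<phi> g ` Q = Q" using P sub act_vertex[OF g] by (intro im) auto
    ultimately show "\<phi> g ` P = P \<and> \<phi> g ` Q = Q" by blast
  qed
qed

end

text \<open>Here \<open>G\<close> plays the role of the type-preserving subgroup; for an arbitrary
  acting group the locale is interpreted with that subgroup as carrier.\<close>

locale strongly_transitive_action = tree_action G X \<phi>
  for G :: "('g, 'm) monoid_scheme" (structure) and X :: "'v graph" and \<phi> +
  fixes l :: "int \<Rightarrow> 'v"
  assumes act_type_preserving: "g \<in> carrier G \<Longrightarrow> type_preserving X (\<phi> g)"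
    and strong: "strongly_transitive (carrier G) X \<phi>"
    and line_l: "line X l"
begin

lemma act_even: "g \<in> carrier G \<Longrightarrow> v \<in> fst X \<Longrightarrow> even (d v (\<phi> g v))"
  using type_preserving_iff act_type_preserving by blast

abbreviation geodesic :: "(int \<Rightarrow> 'v) \<Rightarrow> 'v graph" where
  "geodesic m \<equiv> (range m, range (\<lambda>k. {m k, m (k + 1)}))"

lemma geodesic_biinfinite: "line X m \<Longrightarrow> geodesic m \<in> biinfinite_geodesics X"
  using biinfinite_geodesics_line by auto

lemma image_mult: "g \<in> carrier G \<Longrightarrow> h \<in> carrier G \<Longrightarrow> S \<subseteq> fst X \<Longrightarrow> \<phi> (g \<otimes> h) ` S = \<phi> g ` \<phi> h ` S"
  using act_mult by (auto simp: image_iff subset_iff)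

text \<open>Every two geodesics are moved to one whose stabilizer is transitive on its edges, so the
  edge chosen on the first can be matched with the edge chosen on the second.\<close>

lemma geodesics_with_edges_transitive:
  assumes m: "line X m" and m': "line X m'"
  obtains h \<sigma> c where "h \<in> carrier G" "\<sigma> \<in> {1, -1 :: int}" "\<And>k. \<phi> h (m k) = m' (\<sigma> * k + c)"
    "{\<sigma> * i + c, \<sigma> * (i + 1) + c} = {j, j + 1}"
proof -
  obtain A0 where A0: "A0 \<in> biinfinite_geodesics X"
    and tr: "\<forall>f\<in>snd A0. \<forall>f'\<in>snd A0. \<exists>g\<in>setwise_stabilizer (carrier G) \<phi> A0. \<phi> g ` f = f'"
    using strong unfolding strongly_transitive_def by (elim conjE bexE)
  have trans: "\<exists>g\<in>carrier G. graph_image (\<phi> g) A = A'"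
    if "A \<in> biinfinite_geodesics X" "A' \<in> biinfinite_geodesics X" for A A'
    using strong that unfolding strongly_transitive_def by (elim conjE) blast
  have A0V: "f \<subseteq> fst X" if "f \<in> snd A0" for f
    using that A0 tree by (auto simp: biinfinite_geodesics_def tree_def simple_graph_def)
  obtain g1 where g1: "g1 \<in> carrier G" "graph_image (\<phi> g1) (geodesic m) = A0"
    using trans geodesic_biinfinite[OF m] A0 by blast
  obtain g2 where g2: "g2 \<in> carrier G" "graph_image (\<phi> g2) A0 = geodesic m'"
    using trans geodesic_biinfinite[OF m'] A0 by blast
  have mV: "range m \<subseteq> fst X" "{m i, m (i + 1)} \<subseteq> fst X" using line_vertex[OF m] by auto
  have e1: "\<phi> g1 ` {m i, m (i + 1)} \<in> snd A0"
    unfolding g1(2)[symmetric] graph_image_def snd_conv by (intro imageI rangeI)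
  have "{m' j, m' (j + 1)} \<in> snd (graph_image (\<phi> g2) A0)" unfolding g2(2) by auto
  then obtain e2 where e2: "e2 \<in> snd A0" "\<phi> g2 ` e2 = {m' j, m' (j + 1)}"
    by (auto simp: graph_image_def)
  obtain s where s: "s \<in> carrier G" "graph_image (\<phi> s) A0 = A0" "\<phi> s ` \<phi> g1 ` {m i, m (i + 1)} = e2"
    using tr e1 e2(1) unfolding setwise_stabilizer_def by blast
  define h where "h = g2 \<otimes> (s \<otimes> g1)"
  have h: "h \<in> carrier G" using g1 g2 s by (simp add: h_def)
  have im: "\<phi> h ` S = \<phi> g2 ` \<phi> s ` \<phi> g1 ` S" if "S \<subseteq> fst X" for S
  proof -
    have "\<phi> g1 ` S \<subseteq> fst X" using that act_vertex g1(1) by blast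
    then show ?thesis using that g1 g2 s by (simp add: h_def image_mult act_vertex)
  qed
  have "\<phi> h ` range m = range m'"
  proof -
    have "\<phi> g1 ` range m = fst A0" "\<phi> s ` fst A0 = fst A0" "\<phi> g2 ` fst A0 = range m'"
      using arg_cong[OF g1(2), of fst] arg_cong[OF s(2), of fst] arg_cong[OF g2(2), of fst]
      by (simp_all add: graph_image_def)
    then show ?thesis using im[OF mV(1)] by simp
  qed
  then have "range (\<lambda>k. \<phi> h (m k)) \<subseteq> range m'" by (simp add: image_image)
  then obtain \<sigma> c where sc: "\<sigma> \<in> {1, -1}" "\<And>k. \<phi> h (m k) = m' (\<sigma> * k + c)"
    using line_reparam[OF m' act_line[OF h m]] by blast
  have "\<phi> h ` {m i, m (i + 1)} = {m' j, m' (j + 1)}"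
    by (simp only: im[OF mV(2)] s(3) e2(2))
  then have "m' ` {\<sigma> * i + c, \<sigma> * (i + 1) + c} = m' ` {j, j + 1}"
    using sc(2) by simp
  moreover have "inj m'" using line_inj[OF m'] by (simp add: inj_def)
  ultimately have "{\<sigma> * i + c, \<sigma> * (i + 1) + c} = {j, j + 1}"
    by (simp only: inj_image_eq_iff)
  then show ?thesis by (rule that[OF h sc])
qed

text \<open>An affine map of the integers that preserves the edge {0, 1} is the identity or k -> 1 -
  k. Type preservation makes \<open>c\<close> even, which excludes the second.\<close>

lemma geodesics_transitive_pointwise:
  assumes m: "line X m" and m': "line X m'" and "m 0 = m' 0" "m 1 = m' 1"
  obtains h where "h \<in> carrier G" "\<And>k. \<phi> h (m k) = m' k"
proof -
  obtain h \<sigma> c where h: "h \<in> carrier G" "\<sigma> \<in> {1, -1 :: int}" "\<And>k. \<phi> h (m k) = m' (\<sigma> * k + c)"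
    "{\<sigma> * 0 + c, \<sigma> * (0 + 1) + c} = {0, 0 + 1}"
    using geodesics_with_edges_transitive[OF m m'] by metis
  have "even (d (m 0) (m' c))" using act_even[OF h(1) line_vertex[OF m, of 0]] h(3)[of 0] by simp
  then have "even c" using line_dist[OF m', of 0 c] assms(3) by (simp add: even_nat_iff)
  then have "c = 0 \<and> \<sigma> = 1" using h(2,4) by (auto simp: doubleton_eq_iff)
  then show ?thesis using that h by simp
qed

lemma line_through_edge:
  assumes "adjacent X a b"
  obtains m where "line X m" "m 0 = a" "m 1 = b"
proof -
  have "{a, b} \<in> snd X" "{l 0, l 1} \<in> snd X"
    using assms line_adjacent[OF line_l, of 0] by (auto simp: adjacent_def)
  moreover have "\<forall>f\<in>snd X. \<forall>f'\<in>snd X. \<exists>g\<in>carrier G. \<phi> g ` f = f'"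
    using strong unfolding strongly_transitive_def by (elim conjE)
  ultimately obtain g where g: "g \<in> carrier G" "\<phi> g ` {l 0, l 1} = {a, b}"
    by blast
  then consider "\<phi> g (l 0) = a" "\<phi> g (l 1) = b" | "\<phi> g (l 0) = b" "\<phi> g (l 1) = a"
    by (auto simp: doubleton_eq_iff)
  then show ?thesis
  proof cases
    case 1
    then show ?thesis using that[OF act_line[OF g(1) line_l]] by simp
  next
    case 2
    then show ?thesis
      using that[OF act_line[OF g(1) line_affine[OF _ line_l, of "-1" 1]]] by simp
  qed
qed

text \<open>Extend \<open>m\<close> through the predecessor \<open>w\<close> of \<open>a\<close>,
  and splice at \<open>a\<close> with a line through the edge {a, b}, which exists by transitivity
  on edges. The half of \<open>m\<close> ending with its base edge is kept.\<close>

lemma line_extends_to: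
  assumes m: "line X m" and ab: "adjacent X a b"
    and "d (m 0) a = n" "d (m 0) b = n + 1" "d (m 1) b = n"
  shows "\<exists>m'. line X m' \<and> (\<forall>k\<le>1. m' k = m k) \<and> m' (int n) = a \<and> m' (int n + 1) = b"
  using assms(2-)
proof (induction n arbitrary: a b)
  case 0
  then have "a = m 0" "b = m 1"
    using graph_dist_eq_0 line_vertex[OF m] adjacent_vertices by auto
  then show ?case using m by auto
next
  case (Suc n)
  have V: "a \<in> fst X" "b \<in> fst X" "m 0 \<in> fst X" "m 1 \<in> fst X"
    using Suc.prems(1) line_vertex[OF m] adjacent_vertices by auto
  have m01: "adjacent X (m 0) (m 1)" using line_adjacent[OF m, of 0] by simp
  have "d (m 1) a < d (m 0) a"
    using closer_neighbour_side[OF m01 Suc.prems(1)] Suc.prems V by auto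
  then have da: "d (m 1) a = n"
    using graph_dist_adjacent[OF V(1) m01] Suc.prems by (simp add: graph_dist_commute)
  have "m 0 \<noteq> a" using Suc.prems by auto
  then obtain w where w: "adjacent X w a" "d (m 0) a = d (m 0) w + 1"
    using closer_neighbour V by blast
  then obtain m' where m': "line X m'" "\<forall>k\<le>1. m' k = m k" "m' (int n) = w" "m' (int n + 1) = a"
    using Suc.IH[OF w(1)] Suc.prems da by auto
  obtain r where r: "line X r" "r 0 = a" "r 1 = b" using line_through_edge Suc.prems by blast
  \<comment> \<open>The shift places \<open>a\<close> at index \<open>Suc n\<close>, where
    \<open>m'\<close> also has it. The seam condition becomes \<open>w \<noteq> b\<close>, which
    holds because \<open>w\<close> is closer to \<open>m 0\<close> than \<open>b\<close>.\<close>
  define r' where "r' = (\<lambda>k. r (1 * k + - int (Suc n)))"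
  have r': "line X r'" unfolding r'_def by (rule line_affine[OF _ r(1)]) simp
  have "w \<noteq> b" using w Suc.prems by auto
  then have "line X (\<lambda>k. if k \<le> int (Suc n) then m' k else r' k)"
    using m' r by (intro line_splice[OF m'(1) r']) (auto simp: r'_def add.commute)
  moreover have "\<forall>k\<le>1. (if k \<le> int (Suc n) then m' k else r' k) = m k"
    using m'(2) by auto
  ultimately show ?case
    using m' r by (intro exI[of _ "\<lambda>k. if k \<le> int (Suc n) then m' k else r' k"])
      (auto simp: r'_def add.commute)
qed

text \<open>The extended line agrees with \<open>m\<close> on the base edge, so the group element
  that matches the two lines pointwise fixes that edge.\<close>

lemma straighten_edge:
  assumes m: "line X m" and ab: "adjacent X a b"
    and n: "d (m 0) a = n" "d (m 0) b = n + 1" "d (m 1) b = n"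
  obtains h where "h \<in> carrier G" "\<phi> h (m 0) = m 0" "\<phi> h (m 1) = m 1"
    "\<phi> h a = m (int n)" "\<phi> h b = m (int n + 1)"
proof -
  obtain m' where m': "line X m'" "\<forall>k\<le>1. m' k = m k" "m' (int n) = a" "m' (int n + 1) = b"
    using line_extends_to[OF assms] by blast
  have "m' 0 = m 0" "m' 1 = m 1" using m'(2) by auto
  then obtain h where "h \<in> carrier G" "\<And>k. \<phi> h (m' k) = m k"
    using geodesics_transitive_pointwise[OF m'(1) m] by blast
  then show ?thesis using that m' by (metis le_numeral_extra(4) zero_le_one)
qed

section \<open>The retraction onto the line and positions of group elements\<close>

definition chamber_stabilizer :: "'g set" where
  "chamber_stabilizer = pointwise_stabilizer (carrier G) \<phi> {l 0, l 1}"

text \<open>The coordinate on the line \<open>l\<close> of the image of a vertex under the retraction of the tree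
  centred at the edge \<open>{l 0, l 1}\<close>.\<close>

definition retract :: "'v \<Rightarrow> int" where
  "retract v = (if d (l 1) v < d (l 0) v then int (d (l 0) v) else - int (d (l 0) v))"

text \<open>The index \<open>j\<close> of the edge \<open>{l j, l (j + 1)}\<close> to which \<open>g {l 0, l 1}\<close> retracts.\<close>

definition edge_pos :: "'g \<Rightarrow> int" where
  "edge_pos g = min (retract (\<phi> g (l 0))) (retract (\<phi> g (l 1)))"

lemma l_vertex [simp]: "l k \<in> fst X"
  by (rule line_vertex[OF line_l])

lemma l01: "adjacent X (l 0) (l 1)"
  using line_adjacent[OF line_l, of 0] by simp

lemma chamber_stabilizer_iff:
  "b \<in> chamber_stabilizer \<longleftrightarrow> b \<in> carrier G \<and> \<phi> b (l 0) = l 0 \<and> \<phi> b (l 1) = l 1"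
  by (auto simp: chamber_stabilizer_def pointwise_stabilizer_def)

lemma retract_line [simp]: "retract (l k) = k"
  using line_dist[OF line_l] by (auto simp: retract_def)

lemma retract_chamber_stabilizer:
  assumes "b \<in> chamber_stabilizer" "v \<in> fst X"
  shows "retract (\<phi> b v) = retract v"
proof -
  have "d (l 0) (\<phi> b v) = d (l 0) v" "d (l 1) (\<phi> b v) = d (l 1) v"
    using act_dist[of b "l 0" v] act_dist[of b "l 1" v] assms by (auto simp: chamber_stabilizer_iff)
  then show ?thesis by (simp add: retract_def)
qed

lemma dist_l01: "v \<in> fst X \<Longrightarrow> d (l 0) v = d (l 1) v + 1 \<or> d (l 1) v = d (l 0) v + 1"
  using graph_dist_adjacent[OF _ l01, of v] by (simp add: graph_dist_commute)

text \<open>It suffices to treat an edge that points away from \<open>l 0\<close>. On the positive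
  side it is straightened along \<open>l\<close>; on the negative side the same argument applies to
  the reversed line, whose base vertex is \<open>l 1\<close>.\<close>

lemma retract_edge:
  assumes "adjacent X a b"
  obtains h where "h \<in> chamber_stabilizer" "\<phi> h a = l (retract a)" "\<phi> h b = l (retract b)"
proof -
  have oriented: "\<exists>h\<in>chamber_stabilizer. \<phi> h a = l (retract a) \<and> \<phi> h b = l (retract b)"
    if ab: "adjacent X a b" and less: "d (l 0) a < d (l 0) b" for a b
  proof -
    have V: "a \<in> fst X" "b \<in> fst X" using ab adjacent_vertices by auto
    have ab0: "d (l 0) b = d (l 0) a + 1"
      using graph_dist_adjacent[OF _ ab, of "l 0"] less by auto
    show ?thesis
    proof (cases "d (l 1) b < d (l 0) b")
      case True
      then have n: "d (l 1) b = d (l 0) a" using dist_l01[OF V(2)] ab0 by auto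
      have "(a = l 0 \<and> b = l 1) \<or> d (l 1) a < d (l 0) a"
        by (rule closer_neighbour_side[OF l01 ab less True])
      then have "retract a = int (d (l 0) a)" by (auto simp: retract_def)
      moreover have "retract b = int (d (l 0) a) + 1" using True ab0 by (auto simp: retract_def)
      ultimately show ?thesis
        using straighten_edge[OF line_l ab refl ab0 n] by (metis chamber_stabilizer_iff)
    next
      case False
      define m where "m = (\<lambda>k. l (1 - k))"
      have m: "line X m" using line_affine[OF _ line_l, of "-1" 1] by (simp add: m_def algebra_simps)
      have b1: "d (l 1) b = d (l 0) b + 1" using False dist_l01[OF V(2)] by auto
      have a1: "d (l 1) b = d (l 1) a + 1"
        using graph_dist_adjacent[OF l_vertex ab, of 1] b1 ab0 dist_l01[OF V(1)] by linarith
      have aa: "d (l 1) a = d (l 0) a + 1" using a1 b1 ab0 by linarith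
      obtain h where h: "h \<in> carrier G" "\<phi> h (m 0) = m 0" "\<phi> h (m 1) = m 1"
          "\<phi> h a = m (int (d (m 0) a))" "\<phi> h b = m (int (d (m 0) a) + 1)"
      proof (rule straighten_edge[OF m ab refl])
        show "d (m 0) b = d (m 0) a + 1" using a1 by (simp add: m_def)
        show "d (m 1) b = d (m 0) a" using aa ab0 by (simp add: m_def)
      qed
      have "retract a = - int (d (l 0) a)" "retract b = - int (d (l 0) b)"
        using aa b1 by (auto simp: retract_def)
      then have "\<phi> h a = l (retract a)" "\<phi> h b = l (retract b)"
        using h aa ab0 by (auto simp: m_def)
      then show ?thesis using h by (auto simp: m_def chamber_stabilizer_iff)
    qed
  qed
  have "d (l 0) a < d (l 0) b \<or> d (l 0) b < d (l 0) a"
    using graph_dist_adjacent[OF _ assms, of "l 0"] by auto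
  then show ?thesis
    using that oriented[of a b] oriented[of b a] assms adjacent_sym[of X a b] by blast
qed

lemma retract_adjacent:
  assumes "adjacent X a b"
  shows "\<bar>retract a - retract b\<bar> = 1"
proof -
  obtain h where h: "h \<in> chamber_stabilizer" "\<phi> h a = l (retract a)" "\<phi> h b = l (retract b)"
    using retract_edge[OF assms] .
  have "d (\<phi> h a) (\<phi> h b) = 1"
    using h(1) act_adjacent[OF _ assms] graph_dist_1 by (auto simp: chamber_stabilizer_iff)
  then show ?thesis using h line_dist[OF line_l] by simp
qed

text \<open>The displacement of \<open>l 0\<close> is even, so its image has an even coordinate, and
  the two ends have consecutive coordinates. The parity of the position thus tells which end is the
  image of \<open>l 0\<close>.\<close>

lemma edge_pos_cases:
  assumes x: "x \<in> carrier G"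
  shows "if even (edge_pos x) then retract (\<phi> x (l 0)) = edge_pos x \<and> retract (\<phi> x (l 1)) = edge_pos x + 1
    else retract (\<phi> x (l 1)) = edge_pos x \<and> retract (\<phi> x (l 0)) = edge_pos x + 1"
proof -
  have "even (retract (\<phi> x (l 0)))"
    using act_even[OF x, of "l 0"] by (auto simp: retract_def)
  moreover have "\<bar>retract (\<phi> x (l 0)) - retract (\<phi> x (l 1))\<bar> = 1"
    by (rule retract_adjacent[OF act_adjacent[OF x l01]])
  moreover have "retract (\<phi> x (l 0)) = retract (\<phi> x (l 1)) + 1 \<or>
      retract (\<phi> x (l 1)) = retract (\<phi> x (l 0)) + 1"
    using calculation(2) by linarith
  ultimately show ?thesis
    by (auto simp: edge_pos_def min_def)
qed

lemma edge_pos_one: "edge_pos \<one> = 0"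
  by (simp add: edge_pos_def act_one)

lemma edge_pos_chamber_left:
  "b \<in> chamber_stabilizer \<Longrightarrow> x \<in> carrier G \<Longrightarrow> edge_pos (b \<otimes> x) = edge_pos x"
  by (simp add: edge_pos_def act_mult chamber_stabilizer_iff retract_chamber_stabilizer act_vertex)

lemma edge_pos_chamber_right:
  "b \<in> chamber_stabilizer \<Longrightarrow> x \<in> carrier G \<Longrightarrow> edge_pos (x \<otimes> b) = edge_pos x"
  by (simp add: edge_pos_def act_mult chamber_stabilizer_iff)

text \<open>Elements \<open>h\<close> and \<open>k\<close> of the stabilizer move the two image
  edges onto the same edge of the line, with the same orientation. Hence h x and k y differ by a
  right factor \<open>b'\<close> fixing the base edge, and x = h^-1 k y b'.\<close>

lemma edge_pos_eqD:
  assumes x: "x \<in> carrier G" and y: "y \<in> carrier G" and "edge_pos x = edge_pos y"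
  obtains b b' where "b \<in> chamber_stabilizer" "b' \<in> chamber_stabilizer" "x = b \<otimes> (y \<otimes> b')"
proof -
  have r: "retract (\<phi> x (l 0)) = retract (\<phi> y (l 0))" "retract (\<phi> x (l 1)) = retract (\<phi> y (l 1))"
    using edge_pos_cases[OF x] edge_pos_cases[OF y] assms(3) by (auto split: if_splits)
  obtain h where h: "h \<in> chamber_stabilizer" "\<phi> h (\<phi> x (l 0)) = l (retract (\<phi> x (l 0)))"
      "\<phi> h (\<phi> x (l 1)) = l (retract (\<phi> x (l 1)))"
    using retract_edge[OF act_adjacent[OF x l01]] .
  obtain k where k: "k \<in> chamber_stabilizer" "\<phi> k (\<phi> y (l 0)) = l (retract (\<phi> y (l 0)))"
      "\<phi> k (\<phi> y (l 1)) = l (retract (\<phi> y (l 1)))"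
    using retract_edge[OF act_adjacent[OF y l01]] .
  have c: "h \<in> carrier G" "k \<in> carrier G" using h k by (auto simp: chamber_stabilizer_iff)
  define b where "b = inv h \<otimes> k"
  define b' where "b' = inv y \<otimes> (inv k \<otimes> (h \<otimes> x))"
  have fix_inv: "\<phi> (inv h) (l 0) = l 0" "\<phi> (inv h) (l 1) = l 1"
    using h(1) act_inv_act[of h "l 0"] act_inv_act[of h "l 1"] by (auto simp: chamber_stabilizer_iff)
  have "b \<in> chamber_stabilizer"
    using c k(1) fix_inv by (simp add: b_def chamber_stabilizer_iff act_mult)
  moreover have "\<phi> b' (l i) = l i" if i: "i \<in> {0, 1}" for i
  proof -
    have "\<phi> (h \<otimes> x) (l i) = \<phi> (k \<otimes> y) (l i)"
      using i h(2,3) k(2,3) r c x y by (auto simp: act_mult)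
    then have "\<phi> b' (l i) = \<phi> (inv y) (\<phi> (inv k) (\<phi> k (\<phi> y (l i))))"
      using c x y by (simp add: b'_def act_mult act_vertex)
    then show ?thesis using c x y by (simp add: act_inv_act act_vertex)
  qed
  then have "b' \<in> chamber_stabilizer" using c x y by (simp add: chamber_stabilizer_iff b'_def)
  moreover have "x = b \<otimes> (y \<otimes> b')"
  proof -
    have "y \<otimes> b' = inv k \<otimes> (h \<otimes> x)"
      using c x y by (simp add: b'_def flip: m_assoc)
    then have "k \<otimes> (y \<otimes> b') = h \<otimes> x"
      using c x y by (simp flip: m_assoc)
    moreover have "b \<otimes> (y \<otimes> b') = inv h \<otimes> (k \<otimes> (y \<otimes> b'))"
      using c x y by (simp add: b_def b'_def m_assoc)
    ultimately show ?thesis using c x by (simp flip: m_assoc)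
  qed
  ultimately show ?thesis using that by blast
qed

lemma retract_eq_0: "v \<in> fst X \<Longrightarrow> retract v = 0 \<longleftrightarrow> v = l 0"
  using graph_dist_eq_0[of "l 0" v] by (auto simp: retract_def)

lemma retract_eq_1: "v \<in> fst X \<Longrightarrow> retract v = 1 \<longleftrightarrow> v = l 1"
  using graph_dist_eq_0[of "l 1" v] dist_l01[of v] retract_line[of 1] by (auto simp: retract_def split: if_splits)

text \<open>The edges of the line at \<open>l 0\<close> have positions -1 and 0, and no vertex other
  than \<open>l 0\<close> retracts to 0.\<close>

lemma edge_pos_stabilizer_0:
  assumes x: "x \<in> carrier G"
  shows "edge_pos x \<in> {0, -1} \<longleftrightarrow> \<phi> x (l 0) = l 0"
proof -
  have "edge_pos x \<in> {0, -1} \<longleftrightarrow> retract (\<phi> x (l 0)) = 0"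
    using edge_pos_cases[OF x] by (auto split: if_splits)
  then show ?thesis using retract_eq_0[OF act_vertex[OF x]] by simp
qed

lemma edge_pos_stabilizer_1:
  assumes x: "x \<in> carrier G"
  shows "edge_pos x \<in> {0, 1} \<longleftrightarrow> \<phi> x (l 1) = l 1"
proof -
  have "edge_pos x \<in> {0, 1} \<longleftrightarrow> retract (\<phi> x (l 1)) = 1"
    using edge_pos_cases[OF x] by (auto split: if_splits)
  then show ?thesis using retract_eq_1[OF act_vertex[OF x]] by simp
qed

text \<open>For \<open>v\<close> on the positive side, the neighbour of \<open>l 0\<close> towards
  \<open>\<phi> x v\<close> is \<open>\<phi> x (l 1)\<close>. This is not \<open>l 1\<close>, so the
  image lies on the negative side, at an unchanged distance from \<open>l 0\<close>.\<close>

lemma retract_rotate_0: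
  assumes x: "x \<in> carrier G" "\<phi> x (l 0) = l 0" "\<phi> x (l 1) \<noteq> l 1" and v: "v \<in> fst X" "0 \<le> retract v"
  shows "retract (\<phi> x v) = - retract v"
proof (cases "v = l 0")
  case True
  then show ?thesis using x retract_line[of 0] by simp
next
  case False
  then have less: "d (l 1) v < d (l 0) v"
    using v retract_eq_0[OF v(1)] by (auto simp: retract_def split: if_splits)
  have e: "d (l 0) (\<phi> x v) = d (l 0) v" "d (\<phi> x (l 1)) (\<phi> x v) = d (l 1) v"
    using act_dist[OF x(1), of "l 0" v] act_dist[OF x(1), of "l 1" v] x v by auto
  have "\<not> d (l 1) (\<phi> x v) < d (l 0) (\<phi> x v)"
  proof
    assume "d (l 1) (\<phi> x v) < d (l 0) (\<phi> x v)"
    then have "l 1 = \<phi> x (l 1)"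
      using closer_neighbour_unique[OF adjacent_sym[OF l01], of "\<phi> x (l 1)" "\<phi> x v"]
        act_adjacent[OF x(1) adjacent_sym[OF l01]] x v act_vertex e less
      by (simp add: graph_dist_commute[of X "\<phi> x v"])
    then show False using x by simp
  qed
  then show ?thesis using less e by (simp add: retract_def)
qed

text \<open>This mirrors the rotation about \<open>l 0\<close>: the coordinate is reflected in the
  fixed vertex 1, whence k -> 2 - k.\<close>

lemma retract_rotate_1:
  assumes x: "x \<in> carrier G" "\<phi> x (l 1) = l 1" "\<phi> x (l 0) \<noteq> l 0" and v: "v \<in> fst X" "retract v \<le> 1"
  shows "retract (\<phi> x v) = 2 - retract v"
proof (cases "v = l 1")
  case True
  then show ?thesis using x retract_line[of 1] by simp
next
  case False
  then have "retract v \<noteq> 1" using retract_eq_1[OF v(1)] by simp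
  then have less: "d (l 0) v < d (l 1) v" "retract v = - int (d (l 0) v)"
    using v dist_l01[OF v(1)] by (auto simp: retract_def split: if_splits)
  have e: "d (l 1) (\<phi> x v) = d (l 1) v" "d (\<phi> x (l 0)) (\<phi> x v) = d (l 0) v"
    using act_dist[OF x(1), of "l 0" v] act_dist[OF x(1), of "l 1" v] x v by auto
  have "\<not> d (l 0) (\<phi> x v) < d (l 1) (\<phi> x v)"
  proof
    assume "d (l 0) (\<phi> x v) < d (l 1) (\<phi> x v)"
    then have "l 0 = \<phi> x (l 0)"
      using closer_neighbour_unique[OF l01, of "\<phi> x (l 0)" "\<phi> x v"]
        act_adjacent[OF x(1) l01] x v act_vertex e less
      by (simp add: graph_dist_commute[of X "\<phi> x v"])
    then show False using x by simp
  qed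
  then show ?thesis
    using less e dist_l01[OF v(1)] dist_l01[OF act_vertex[OF x(1) v(1)]] by (auto simp: retract_def)
qed

lemma edge_pos_mult_neg:
  assumes x: "x \<in> carrier G" "edge_pos x = -1" and y: "y \<in> carrier G" "0 \<le> edge_pos y"
  shows "edge_pos (x \<otimes> y) = - edge_pos y - 1"
proof -
  have "\<phi> x (l 0) = l 0" "\<phi> x (l 1) \<noteq> l 1"
    using edge_pos_stabilizer_0[OF x(1)] edge_pos_stabilizer_1[OF x(1)] x(2) by auto
  moreover have "0 \<le> retract (\<phi> y (l 0))" "0 \<le> retract (\<phi> y (l 1))"
    using y by (auto simp: edge_pos_def)
  ultimately have "retract (\<phi> (x \<otimes> y) (l 0)) = - retract (\<phi> y (l 0))"
      "retract (\<phi> (x \<otimes> y) (l 1)) = - retract (\<phi> y (l 1))"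
    using x y by (auto simp: act_mult act_vertex retract_rotate_0)
  then show ?thesis
    using edge_pos_cases[OF y(1)] by (auto simp: edge_pos_def[of "x \<otimes> y"] split: if_splits)
qed

lemma edge_pos_mult_pos:
  assumes x: "x \<in> carrier G" "edge_pos x = 1" and y: "y \<in> carrier G" "edge_pos y \<le> 0"
  shows "edge_pos (x \<otimes> y) = 1 - edge_pos y"
proof -
  have "\<phi> x (l 1) = l 1" "\<phi> x (l 0) \<noteq> l 0"
    using edge_pos_stabilizer_0[OF x(1)] edge_pos_stabilizer_1[OF x(1)] x(2) by auto
  moreover have "retract (\<phi> y (l 0)) \<le> 1" "retract (\<phi> y (l 1)) \<le> 1"
    using y edge_pos_cases[OF y(1)] by (auto split: if_splits)
  ultimately have "retract (\<phi> (x \<otimes> y) (l 0)) = 2 - retract (\<phi> y (l 0))"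
      "retract (\<phi> (x \<otimes> y) (l 1)) = 2 - retract (\<phi> y (l 1))"
    using x y by (auto simp: act_mult act_vertex retract_rotate_1)
  then show ?thesis
    using edge_pos_cases[OF y(1)] by (auto simp: edge_pos_def[of "x \<otimes> y"] split: if_splits)
qed

lemma edge_pos_line:
  assumes "\<And>k. \<phi> n (l k) = l (\<sigma> * k + c)"
  shows "edge_pos n = min c (\<sigma> + c)"
  using assms[of 0] assms[of 1] by (simp add: edge_pos_def)

end

context tree_action
begin

lemma graph_image_geodesic_iff:
  assumes l: "line X l" and g: "g \<in> carrier G"
    and A: "A = (range l, range (\<lambda>k. {l k, l (k + 1)}))"
  shows "graph_image (\<phi> g) A = A \<longleftrightarrow> (\<exists>\<sigma>\<in>{1, -1}. \<exists>c. \<forall>k. \<phi> g (l k) = l (\<sigma> * k + c))"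
proof
  assume "graph_image (\<phi> g) A = A"
  then have "range (\<lambda>k. \<phi> g (l k)) \<subseteq> range l"
    by (auto simp: graph_image_def A)
  then show "\<exists>\<sigma>\<in>{1, -1}. \<exists>c. \<forall>k. \<phi> g (l k) = l (\<sigma> * k + c)"
    using line_reparam[OF l act_line[OF g l]] by metis
next
  assume "\<exists>\<sigma>\<in>{1, -1}. \<exists>c. \<forall>k. \<phi> g (l k) = l (\<sigma> * k + c)"
  then obtain \<sigma> c where s: "\<sigma> \<in> {1, -1}" and c: "\<forall>k. \<phi> g (l k) = l (\<sigma> * k + c)"
    by blast
  have "(\<lambda>e. \<phi> g ` e) ` range (\<lambda>k. {l k, l (k + 1)}) = range (\<lambda>k. {l (\<sigma> * k + c), l (\<sigma> * (k + 1) + c)})"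
      "\<phi> g ` range l = range (\<lambda>k. l (\<sigma> * k + c))"
    by (simp_all add: image_image c)
  then show "graph_image (\<phi> g) A = A" by (simp only: graph_image_def A fst_conv snd_conv range_affine[OF s])
qed

end

section \<open>Double cosets of the stabilizer of the base edge and their products\<close>

context strongly_transitive_action
begin

lemma double_coset_chamber:
  assumes x: "x \<in> carrier G"
  shows "double_coset G chamber_stabilizer x = {y \<in> carrier G. edge_pos y = edge_pos x}"
proof (intro Set.set_eqI iffI)
  fix y assume "y \<in> double_coset G chamber_stabilizer x"
  then obtain b b' where "b \<in> chamber_stabilizer" "b' \<in> chamber_stabilizer" "y = b \<otimes> (x \<otimes> b')"
    by (auto simp: double_coset_def set_mult_def l_coset_def)
  then show "y \<in> {y \<in> carrier G. edge_pos y = edge_pos x}"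
    using x by (simp add: edge_pos_chamber_left edge_pos_chamber_right chamber_stabilizer_iff)
next
  fix y assume "y \<in> {y \<in> carrier G. edge_pos y = edge_pos x}"
  then obtain b b' where "b \<in> chamber_stabilizer" "b' \<in> chamber_stabilizer" "y = b \<otimes> (x \<otimes> b')"
    using edge_pos_eqD x by blast
  then show "y \<in> double_coset G chamber_stabilizer x"
    by (auto simp: double_coset_def set_mult_def l_coset_def)
qed

lemma edge_pos_eq_0_iff: "x \<in> carrier G \<Longrightarrow> edge_pos x = 0 \<longleftrightarrow> x \<in> chamber_stabilizer"
  using edge_pos_stabilizer_0[of x] edge_pos_stabilizer_1[of x] by (auto simp: chamber_stabilizer_iff)

lemma fix_quotient:
  assumes "g \<in> carrier G" "k \<in> carrier G" "g' \<in> carrier G" "k' \<in> carrier G" "g \<otimes> g' = k \<otimes> k'"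
  shows "g' \<otimes> inv k' = inv g \<otimes> k"
proof -
  have "g' = inv g \<otimes> (g \<otimes> g')" using assms(1-4) by (simp flip: m_assoc)
  then have "g' = (inv g \<otimes> k) \<otimes> k'" unfolding assms(5) using assms(1-4) by (simp add: m_assoc)
  then show ?thesis using assms(1-4) by (simp add: m_assoc)
qed

text \<open>\<open>g' k'\<^sup>-\<^sup>1 = g\<^sup>-\<^sup>1 k\<close> fixes the vertex fixed by \<open>g\<close> and \<open>k\<close>; if it moved the other vertex of
  the base edge, it would change the position of \<open>k'\<close>.\<close>

lemma double_coset_mult_ascending:
  assumes hp: "hecke_pair G chamber_stabilizer"
    and x: "x \<in> carrier G" and y: "y \<in> carrier G"
    and stab: "\<And>z. z \<in> carrier G \<Longrightarrow> edge_pos z \<in> {0, edge_pos x} \<longleftrightarrow> \<phi> z (l v) = l v"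
    and step: "\<And>z z'. z \<in> carrier G \<Longrightarrow> z' \<in> carrier G \<Longrightarrow> edge_pos z = edge_pos x \<Longrightarrow>
      edge_pos z' = edge_pos y \<Longrightarrow> edge_pos (z \<otimes> z') = edge_pos (x \<otimes> y)"
    and ne: "edge_pos (x \<otimes> y) \<noteq> edge_pos y"
  shows "double_coset_mult G chamber_stabilizer (double_coset G chamber_stabilizer x)
      (double_coset G chamber_stabilizer y) =
    Poly_Mapping.single (double_coset G chamber_stabilizer (x \<otimes> y)) 1"
proof -
  interpret H: hecke_pair G chamber_stabilizer by (rule hp)
  show ?thesis
  proof (rule H.double_coset_mult_single)
    show "g \<otimes> g' \<in> double_coset G chamber_stabilizer (x \<otimes> y)"
      if "g \<in> double_coset G chamber_stabilizer x" "g' \<in> double_coset G chamber_stabilizer y" for g g'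
      using that x y step[of g g'] by (simp add: double_coset_chamber)
    fix g k g' k'
    assume "g \<in> double_coset G chamber_stabilizer x" "k \<in> double_coset G chamber_stabilizer x"
      "g' \<in> double_coset G chamber_stabilizer y" "k' \<in> double_coset G chamber_stabilizer y"
      and eq: "g \<otimes> g' = k \<otimes> k'"
    then have c: "g \<in> carrier G" "k \<in> carrier G" "g' \<in> carrier G" "k' \<in> carrier G"
      and p: "edge_pos g = edge_pos x" "edge_pos k = edge_pos x"
        "edge_pos g' = edge_pos y" "edge_pos k' = edge_pos y"
      using x y by (auto simp: double_coset_chamber)
    define z where "z = g' \<otimes> inv k'"
    have z: "z \<in> carrier G" using c by (simp add: z_def)
    have "\<phi> g (l v) = l v" "\<phi> k (l v) = l v"
      using stab[OF c(1)] stab[OF c(2)] p by auto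
    then have "\<phi> z (l v) = l v"
      using c act_inv_act[OF c(1), of "l v"] by (simp add: z_def fix_quotient[OF c eq] act_mult)
    then have "edge_pos z \<in> {0, edge_pos x}" using stab[OF z] by simp
    moreover have "edge_pos z \<noteq> edge_pos x"
    proof
      assume "edge_pos z = edge_pos x"
      then have "edge_pos (z \<otimes> k') = edge_pos (x \<otimes> y)" using step[OF z c(4)] p by simp
      moreover have "z \<otimes> k' = g'" using c by (simp add: z_def m_assoc)
      ultimately show False using p ne by simp
    qed
    ultimately show "g' \<otimes> inv k' \<in> chamber_stabilizer"
      using edge_pos_eq_0_iff[OF z] by (simp add: z_def)
  qed (use x y H.double_coset_in in auto)
qed

lemma double_coset_mult_neg:
  assumes hp: "hecke_pair G chamber_stabilizer"
    and x: "x \<in> carrier G" "edge_pos x = -1" and y: "y \<in> carrier G" "0 \<le> edge_pos y"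
  shows "double_coset_mult G chamber_stabilizer (double_coset G chamber_stabilizer x)
      (double_coset G chamber_stabilizer y) =
    Poly_Mapping.single (double_coset G chamber_stabilizer (x \<otimes> y)) 1"
  using x y edge_pos_stabilizer_0
  by (intro double_coset_mult_ascending[OF hp x(1) y(1), of 0]) (simp_all add: edge_pos_mult_neg)

lemma double_coset_mult_pos:
  assumes hp: "hecke_pair G chamber_stabilizer"
    and x: "x \<in> carrier G" "edge_pos x = 1" and y: "y \<in> carrier G" "edge_pos y \<le> 0"
  shows "double_coset_mult G chamber_stabilizer (double_coset G chamber_stabilizer x)
      (double_coset G chamber_stabilizer y) =
    Poly_Mapping.single (double_coset G chamber_stabilizer (x \<otimes> y)) 1"
  using x y edge_pos_stabilizer_1
  by (intro double_coset_mult_ascending[OF hp x(1) y(1), of 1]) (simp_all add: edge_pos_mult_pos)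

lemma vertex_stabilizer_subgroup:
  assumes "v \<in> fst X"
  shows "subgroup {g \<in> carrier G. \<phi> g v = v} G"
proof (rule subgroupI)
  show "inv g \<in> {g \<in> carrier G. \<phi> g v = v}" if "g \<in> {g \<in> carrier G. \<phi> g v = v}" for g
    using that act_inv_act[of g v] assms by auto
qed (use assms act_one in \<open>auto simp: act_mult\<close>)

lemma double_coset_mult_panel:
  assumes hp: "hecke_pair G chamber_stabilizer"
    and x: "x \<in> carrier G" "edge_pos x \<in> {-1, 1}"
  defines "D \<equiv> double_coset G chamber_stabilizer x"
  shows "double_coset_mult G chamber_stabilizer D D =
      of_nat (rcoset_number G chamber_stabilizer D) *\<^sub>H Poly_Mapping.single chamber_stabilizer 1
    + (of_nat (rcoset_number G chamber_stabilizer D) - 1) *\<^sub>H Poly_Mapping.single D 1"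
proof -
  interpret H: hecke_pair G chamber_stabilizer by (rule hp)
  have B: "chamber_stabilizer = {y \<in> carrier G. edge_pos y = 0}"
    using edge_pos_eq_0_iff by (auto simp: chamber_stabilizer_iff)
  show ?thesis
  proof (rule H.double_coset_mult_square)
    show "D \<in> double_cosets G chamber_stabilizer" using x H.double_coset_in by (simp add: D_def)
    have "x \<in> D" using x H.self_in_double_coset by (simp add: D_def)
    moreover have "x \<notin> chamber_stabilizer" using edge_pos_eq_0_iff[OF x(1)] x(2) by auto
    ultimately show "D \<noteq> chamber_stabilizer" by blast
    have D: "D = {y \<in> carrier G. edge_pos y = edge_pos x}"
      unfolding D_def by (rule double_coset_chamber[OF x(1)])
    have "chamber_stabilizer \<union> D = {y \<in> carrier G. edge_pos y \<in> {0, edge_pos x}}"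
      unfolding D B by auto
    \<comment> \<open>The edges at positions 0 and 1 share the vertex \<open>l 1\<close>, those at
      positions 0 and -1 the vertex \<open>l 0\<close>.\<close>
    also have "\<dots> = {y \<in> carrier G. \<phi> y (l (if edge_pos x = 1 then 1 else 0)) =
        l (if edge_pos x = 1 then 1 else 0)}"
    proof (cases "edge_pos x = 1")
      case True
      then show ?thesis using edge_pos_stabilizer_1 by (auto simp: insert_commute)
    next
      case False
      then show ?thesis using edge_pos_stabilizer_0 x by auto
    qed
    finally show "subgroup (chamber_stabilizer \<union> D) G"
      using vertex_stabilizer_subgroup by simp
  qed
qed

end

section \<open>The Weyl group and the multiplication tables\<close>

locale weyl_setting = tree_action G X \<phi>
  for G :: "('g, 'm) monoid_scheme" (structure) and X :: "'v graph" and \<phi> +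
  fixes l :: "int \<Rightarrow> 'v"
  assumes line_l: "line X l"
    and strong: "strongly_transitive (type_preserving_part G X \<phi>) X \<phi>"
    and hecke_G: "hecke_pair G (pointwise_stabilizer (carrier G) \<phi> {l 0, l 1})"
    and hecke_Gp: "hecke_pair (G\<lparr>carrier := type_preserving_part G X \<phi>\<rparr>)
      (pointwise_stabilizer (carrier G) \<phi> {l 0, l 1})"
begin

abbreviation "Kp \<equiv> type_preserving_part G X \<phi>"
abbreviation "Gp \<equiv> G\<lparr>carrier := Kp\<rparr>"
abbreviation "B \<equiv> pointwise_stabilizer (carrier G) \<phi> {l 0, l 1}"
abbreviation "A \<equiv> (range l, range (\<lambda>k. {l k, l (k + 1)}))"
abbreviation "N \<equiv> setwise_stabilizer (carrier G) \<phi> A"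
abbreviation "Np \<equiv> setwise_stabilizer Kp \<phi> A"
abbreviation "T \<equiv> pointwise_stabilizer (carrier G) \<phi> (range l)"
abbreviation "W \<equiv> G\<lparr>carrier := Np\<rparr> Mod T"
abbreviation "Wt \<equiv> G\<lparr>carrier := N\<rparr> Mod T"

lemma l_vertex [simp]: "l k \<in> fst X"
  by (rule line_vertex[OF line_l])

lemma Kp_iff: "g \<in> carrier G \<Longrightarrow> v \<in> fst X \<Longrightarrow> g \<in> Kp \<longleftrightarrow> even (d v (\<phi> g v))"
  using type_preserving_iff by (simp add: type_preserving_part_def)

lemma Kp_carrier: "g \<in> Kp \<Longrightarrow> g \<in> carrier G"
  by (simp add: type_preserving_part_def)

text \<open>The displacement of a product passes from v to g v and on to g h v; since
  \<open>g\<close> is an isometry the second leg has the length of the displacement of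
  \<open>h\<close>, and parities add. Being type-preserving is thus the kernel condition of a
  homomorphism to a group of order two.\<close>

lemma parity_mult:
  assumes "g \<in> carrier G" "h \<in> carrier G"
  shows "g \<otimes> h \<in> Kp \<longleftrightarrow> (g \<in> Kp \<longleftrightarrow> h \<in> Kp)"
proof -
  let ?v = "l 0"
  have "even (d ?v (\<phi> (g \<otimes> h) ?v)) \<longleftrightarrow> (even (d ?v (\<phi> g ?v)) \<longleftrightarrow> even (d (\<phi> g ?v) (\<phi> g (\<phi> h ?v))))"
    using even_graph_dist[of ?v "\<phi> g ?v" "\<phi> g (\<phi> h ?v)"] assms act_vertex by (auto simp: act_mult)
  then show ?thesis
    using Kp_iff[of _ ?v] assms act_dist act_vertex by simp
qed

lemma Kp_subgroup: "subgroup Kp G"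
proof (rule subgroupI)
  have one: "\<one> \<in> Kp" using Kp_iff[of \<one> "l 0"] by (simp add: act_one)
  then show "Kp \<noteq> {}" by blast
  show "inv g \<in> Kp" if "g \<in> Kp" for g
    using that parity_mult[of "inv g" g] one Kp_carrier by auto
  show "g \<otimes> h \<in> Kp" if "g \<in> Kp" "h \<in> Kp" for g h
    using that parity_mult Kp_carrier by auto
qed (use Kp_carrier in blast)

sublocale P: strongly_transitive_action Gp X \<phi> l
proof -
  have gr: "group Gp" by (rule subgroup.subgroup_is_group[OF Kp_subgroup is_group])
  have "\<phi> \<in> hom G (BijGroup (fst X))" "group (BijGroup (fst X))"
    using group_hom by (auto simp: group_hom_def group_hom_axioms_def)
  then have "\<phi> \<in> hom Gp (BijGroup (fst X))"
    using Kp_carrier by (auto simp: hom_def)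
  then have ga: "group_action Gp (fst X) \<phi>"
    using gr \<open>group (BijGroup (fst X))\<close>
    by (simp add: group_action_def group_hom_def group_hom_axioms_def)
  show "strongly_transitive_action Gp X \<phi> l"
  proof (intro strongly_transitive_action.intro tree_action.intro
      strongly_transitive_action_axioms.intro tree_action_axioms.intro)
    show "(\<lambda>e. \<phi> g ` e) ` snd X = snd X" if "g \<in> carrier Gp" for g
      using that edges_image Kp_carrier by simp
    show "type_preserving X (\<phi> g)" if "g \<in> carrier Gp" for g
      using that by (simp add: type_preserving_part_def)
    show "strongly_transitive (carrier Gp) X \<phi>" using strong by simp
  qed (rule gr ga tree_graph_axioms line_l)+
qed

lemma B_iff: "b \<in> B \<longleftrightarrow> b \<in> carrier G \<and> \<phi> b (l 0) = l 0 \<and> \<phi> b (l 1) = l 1"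
  by (auto simp: pointwise_stabilizer_def)

lemma B_subset: "B \<subseteq> Kp"
  using Kp_iff[of _ "l 0"] by (auto simp: B_iff)

lemma chamber_stabilizer_eq: "P.chamber_stabilizer = B"
  using B_subset Kp_carrier by (auto simp: P.chamber_stabilizer_iff B_iff)

sublocale H: hecke_pair G B
  by (rule hecke_G)

sublocale Hp: hecke_pair Gp B
  by (rule hecke_Gp)

lemma double_coset_Gp [simp]: "double_coset Gp B x = double_coset G B x"
  by (simp add: double_coset_def)

lemma weyl_double_coset_Gp [simp]: "weyl_double_coset Gp B w = weyl_double_coset G B w"
  by (simp add: weyl_double_coset_def)

lemma N_iff: "g \<in> setwise_stabilizer M \<phi> A \<longleftrightarrow>
    g \<in> M \<and> (\<exists>\<sigma>\<in>{1, -1}. \<exists>c. \<forall>k. \<phi> g (l k) = l (\<sigma> * k + c))" if "M \<subseteq> carrier G"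
  using that graph_image_geodesic_iff[OF line_l _ refl] by (auto simp: setwise_stabilizer_def)

lemma T_iff: "g \<in> T \<longleftrightarrow> g \<in> carrier G \<and> (\<forall>k. \<phi> g (l k) = l k)"
  unfolding pointwise_stabilizer_def mem_Collect_eq ball_simps(9) by (simp only: ball_UNIV)

lemma T_subset: "T \<subseteq> Kp" "T \<subseteq> B"
  using B_subset by (auto simp: T_iff B_iff)

text \<open>Stated for an arbitrary subgroup \<open>M\<close> so that it covers \<open>N\<close> and
  \<open>Np\<close> together.\<close>

lemma stabilizer_subgroup:
  assumes M: "subgroup M G"
  shows "subgroup (setwise_stabilizer M \<phi> A) G"
proof (rule subgroupI)
  have MG: "M \<subseteq> carrier G" using M by (rule subgroup.subset)
  note iff = N_iff[OF MG]
  show "setwise_stabilizer M \<phi> A \<subseteq> carrier G" using MG by (auto simp: setwise_stabilizer_def)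
  have "\<one> \<in> setwise_stabilizer M \<phi> A"
    using subgroup.one_closed[OF M] act_one by (subst iff) (auto intro!: bexI[of _ 1] exI[of _ 0])
  then show "setwise_stabilizer M \<phi> A \<noteq> {}" by blast
  show "inv g \<in> setwise_stabilizer M \<phi> A" if g: "g \<in> setwise_stabilizer M \<phi> A" for g
  proof -
    obtain \<sigma> c where s: "\<sigma> \<in> {1, -1}" and c: "\<forall>k. \<phi> g (l k) = l (\<sigma> * k + c)" and gM: "g \<in> M"
      using g unfolding iff by blast
    \<comment> \<open>This is the inverse of the affine map of \<open>g\<close>, as \<sigma> is its
      own inverse.\<close>
    have "\<phi> (inv g) (l k) = l (\<sigma> * k + - \<sigma> * c)" for k
    proof -
      have "\<phi> g (l (\<sigma> * k + - \<sigma> * c)) = l k" using s c by auto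
      then show ?thesis using act_inv_act[of g "l (\<sigma> * k + - \<sigma> * c)"] gM MG by auto
    qed
    then show ?thesis unfolding iff using s subgroup.m_inv_closed[OF M gM] by blast
  qed
  show "g \<otimes> h \<in> setwise_stabilizer M \<phi> A"
    if gh: "g \<in> setwise_stabilizer M \<phi> A" "h \<in> setwise_stabilizer M \<phi> A" for g h
  proof -
    obtain \<sigma> c where s: "\<sigma> \<in> {1, -1}" and c: "\<forall>k. \<phi> g (l k) = l (\<sigma> * k + c)" and gM: "g \<in> M"
      using gh(1) unfolding iff by blast
    obtain \<tau> b where t: "\<tau> \<in> {1, -1}" and b: "\<forall>k. \<phi> h (l k) = l (\<tau> * k + b)" and hM: "h \<in> M"
      using gh(2) unfolding iff by blast
    have "\<phi> (g \<otimes> h) (l k) = l ((\<sigma> * \<tau>) * k + (\<sigma> * b + c))" for k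
      using c b gM hM MG by (subst act_mult) (auto simp: algebra_simps)
    moreover have "\<sigma> * \<tau> \<in> {1, -1}" using s t by auto
    ultimately show ?thesis unfolding iff using subgroup.m_closed[OF M gM hM] by blast
  qed
qed

text \<open>The inverse of \<open>x\<close> maps the line to itself, \<open>h\<close> acts trivially
  there, and \<open>x\<close> undoes the inverse; so the conjugate acts trivially on the
  line.\<close>

lemma T_normal:
  assumes M: "subgroup M G" and TM: "T \<subseteq> M"
  shows "T \<lhd> G\<lparr>carrier := setwise_stabilizer M \<phi> A\<rparr>"
proof -
  let ?S = "setwise_stabilizer M \<phi> A"
  have S: "subgroup ?S G" by (rule stabilizer_subgroup[OF M])
  have MG: "M \<subseteq> carrier G" using M by (rule subgroup.subset)
  interpret S: group "G\<lparr>carrier := ?S\<rparr>" by (rule subgroup.subgroup_is_group[OF S is_group])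
  have TS: "T \<subseteq> ?S"
  proof
    fix g assume g: "g \<in> T"
    then show "g \<in> ?S"
      using TM unfolding N_iff[OF MG] by (auto simp: T_iff intro!: bexI[of _ 1] exI[of _ 0])
  qed
  have T: "subgroup T G"
  proof (rule subgroupI)
    have "\<one> \<in> T" by (simp add: T_iff act_one)
    then show "T \<noteq> {}" by blast
    show "inv g \<in> T" if "g \<in> T" for g
      using that act_inv_act[of g] by (auto simp: T_iff) (metis l_vertex)
  qed (auto simp: T_iff act_mult)
  have "subgroup T (G\<lparr>carrier := ?S\<rparr>)"
    using subgroup_incl[OF T S TS] .
  moreover have "x \<otimes> h \<otimes> inv x \<in> T" if x: "x \<in> ?S" and h: "h \<in> T" for x h
  proof -
    have c: "x \<in> carrier G" "h \<in> carrier G" using x h S subgroup.subset by (auto simp: T_iff)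
    have "inv x \<in> ?S" using S x by (rule subgroup.m_inv_closed)
    then obtain \<sigma> b where b: "\<forall>k. \<phi> (inv x) (l k) = l (\<sigma> * k + b)"
      unfolding N_iff[OF MG] by blast
    have "\<phi> (x \<otimes> h \<otimes> inv x) (l k) = l k" for k
    proof -
      have "\<phi> (x \<otimes> h \<otimes> inv x) (l k) = \<phi> x (\<phi> h (\<phi> (inv x) (l k)))"
        using c by (simp add: act_mult act_vertex m_assoc)
      also have "\<dots> = \<phi> x (\<phi> (inv x) (l k))" using h b by (simp add: T_iff)
      finally show ?thesis using c by (simp add: act_act_inv)
    qed
    then show ?thesis using c by (simp add: T_iff)
  qed
  then have "\<forall>x\<in>carrier (G\<lparr>carrier := ?S\<rparr>). \<forall>h\<in>T.
      x \<otimes>\<^bsub>G\<lparr>carrier := ?S\<rparr>\<^esub> h \<otimes>\<^bsub>G\<lparr>carrier := ?S\<rparr>\<^esub> inv\<^bsub>G\<lparr>carrier := ?S\<rparr>\<^esub> x \<in> T"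
    using m_inv_consistent[OF S] by simp
  ultimately show ?thesis by (simp add: S.normal_inv_iff)
qed

lemma quotient_carrier: "carrier (G\<lparr>carrier := S\<rparr> Mod T) = (\<lambda>n. T #> n) ` S"
  by (auto simp: FactGroup_def RCOSETS_def)

lemma quotient_mult:
  assumes "T \<lhd> G\<lparr>carrier := S\<rparr>" "n \<in> S" "m \<in> S"
  shows "(T #> n) \<otimes>\<^bsub>G\<lparr>carrier := S\<rparr> Mod T\<^esub> (T #> m) = T #> (n \<otimes> m)"
  using normal.rcos_sum[OF assms(1), of n m] assms by (simp add: FactGroup_def)

lemma N_normal: "T \<lhd> G\<lparr>carrier := N\<rparr>"
  by (rule T_normal[OF subgroup_self]) (auto simp: T_iff)

lemma Np_normal: "T \<lhd> G\<lparr>carrier := Np\<rparr>"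
  by (rule T_normal[OF Kp_subgroup T_subset(1)])

lemma Np_subset: "Np \<subseteq> N" "Np \<subseteq> Kp" "N \<subseteq> carrier G"
  using Kp_carrier by (auto simp: setwise_stabilizer_def)

text \<open>With \<open>c\<close> even there remain the translations by even amounts and the
  reflections in vertices of the line, that is, the infinite dihedral group of its type-preserving
  automorphisms.\<close>

lemma Np_affine:
  assumes "n \<in> Np"
  obtains \<sigma> c where "\<sigma> \<in> {1, -1 :: int}" "even c" "\<forall>k. \<phi> n (l k) = l (\<sigma> * k + c)"
proof -
  have KG: "Kp \<subseteq> carrier G" using Kp_carrier by blast
  obtain \<sigma> c where s: "\<sigma> \<in> {1, -1 :: int}" "\<forall>k. \<phi> n (l k) = l (\<sigma> * k + c)"
    using assms unfolding N_iff[OF KG] by blast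
  have "even (d (l 0) (\<phi> n (l 0)))"
    using P.act_even[of n "l 0"] assms Np_subset by auto
  then have "even c" using s(2) line_dist[OF line_l, of 0 c] by (simp add: even_nat_iff)
  then show ?thesis using that s by blast
qed

lemma weyl_double_coset_rcos:
  assumes n: "n \<in> carrier G"
  shows "weyl_double_coset G B (T #> n) = double_coset G B n"
proof (intro Set.set_eqI iffI)
  fix x assume "x \<in> weyl_double_coset G B (T #> n)"
  then obtain b \<tau> b' where a: "b \<in> B" "\<tau> \<in> T" "b' \<in> B" "x = b \<otimes> (\<tau> \<otimes> n) \<otimes> b'"
    by (auto simp: weyl_double_coset_def set_mult_def r_coset_def)
  then have "\<tau> \<in> B" using T_subset by blast
  moreover have "b \<in> carrier G" "\<tau> \<in> carrier G" "b' \<in> carrier G"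
    using a H.subset \<open>\<tau> \<in> B\<close> by auto
  ultimately have "x = (b \<otimes> \<tau>) \<otimes> (n \<otimes> b')" "b \<otimes> \<tau> \<in> B" using a n by (simp_all add: m_assoc)
  then show "x \<in> double_coset G B n" using a H.double_coset_memI by simp
next
  fix x assume "x \<in> double_coset G B n"
  then obtain b b' where a: "b \<in> B" "b' \<in> B" "x = b \<otimes> (n \<otimes> b')"
    by (auto simp: H.in_double_coset_iff)
  moreover have "b \<in> carrier G" "b' \<in> carrier G" using a H.subset by auto
  ultimately have "x = b \<otimes> (\<one> \<otimes> n) \<otimes> b'" using n by (simp add: m_assoc)
  moreover have "\<one> \<in> T" by (simp add: T_iff act_one)
  ultimately show "x \<in> weyl_double_coset G B (T #> n)"
    using a by (auto simp: weyl_double_coset_def set_mult_def r_coset_def)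
qed

definition weyl_pos :: "'g set \<Rightarrow> int" where
  "weyl_pos w = P.edge_pos (coset_rep w)"

text \<open>A left factor in \<open>T\<close> fixes the base edge and does not change the position,
  so the representative chosen in \<open>weyl_pos\<close> is immaterial.\<close>

lemma weyl_pos_rcos:
  assumes n: "n \<in> Np"
  shows "weyl_pos (T #> n) = P.edge_pos n"
proof -
  have nK: "n \<in> Kp" "n \<in> carrier G" using n Np_subset by auto
  have "\<one> \<in> T" by (simp add: T_iff act_one)
  then have "\<one> \<otimes> n \<in> T #> n" unfolding r_coset_def by blast
  then have "coset_rep (T #> n) \<in> T #> n" unfolding coset_rep_def by (rule someI)
  then obtain \<tau> where t: "\<tau> \<in> T" "coset_rep (T #> n) = \<tau> \<otimes> n" by (auto simp: r_coset_def)
  have "\<tau> \<in> P.chamber_stabilizer" using t T_subset chamber_stabilizer_eq by blast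
  then have "P.edge_pos (\<tau> \<otimes> n) = P.edge_pos n"
    using P.edge_pos_chamber_left[of \<tau> n] nK by simp
  then show ?thesis using t by (simp add: weyl_pos_def)
qed

lemma weyl_pos_affine:
  assumes "n \<in> Np" "\<forall>k. \<phi> n (l k) = l (\<sigma> * k + c)"
  shows "weyl_pos (T #> n) = min c (\<sigma> + c)"
  using weyl_pos_rcos[OF assms(1)] P.edge_pos_line[OF assms(2)[rule_format]] by simp

text \<open>\<open>T\<close> is the kernel of the action of \<open>Np\<close> on the line.\<close>

lemma rcos_T_eqI:
  assumes n: "n \<in> Np" and m: "m \<in> Np" and e: "\<And>k. \<phi> n (l k) = \<phi> m (l k)"
  shows "T #> n = T #> m"
proof -
  have c: "n \<in> carrier G" "m \<in> carrier G" using n m Np_subset by auto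
  have S: "subgroup Np G" by (rule stabilizer_subgroup[OF Kp_subgroup])
  have "inv m \<in> Np" using S m by (rule subgroup.m_inv_closed)
  then obtain \<sigma> b where "\<sigma> \<in> {1, -1 :: int}" "even b" and b: "\<forall>k. \<phi> (inv m) (l k) = l (\<sigma> * k + b)"
    by (rule Np_affine)
  have "\<phi> (n \<otimes> inv m) (l k) = l k" for k
  proof -
    have "\<phi> (n \<otimes> inv m) (l k) = \<phi> m (\<phi> (inv m) (l k))" using c b e by (simp add: act_mult)
    then show ?thesis using c by (simp add: act_act_inv)
  qed
  then have q: "n \<otimes> inv m \<in> T" using c by (simp add: T_iff)
  have "n = (n \<otimes> inv m) \<otimes> m" using c by (simp add: m_assoc)
  then have "n \<in> T #> m" using q unfolding r_coset_def by blast
  moreover have "subgroup T (G\<lparr>carrier := Np\<rparr>)" using Np_normal by (rule normal_imp_subgroup)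
  moreover have "group (G\<lparr>carrier := Np\<rparr>)" by (rule subgroup.subgroup_is_group[OF S is_group])
  ultimately show ?thesis
    using group.repr_independence[of "G\<lparr>carrier := Np\<rparr>" n T m] m by simp
qed

text \<open>The position is the even number \<open>c\<close> for a translation and the odd number
  \<open>c - 1\<close> for a reflection, so \<sigma> and \<open>c\<close> can both be recovered from
  it.\<close>

lemma weyl_pos_inj: "inj_on weyl_pos (carrier W)"
proof (rule inj_onI)
  fix w w' assume "w \<in> carrier W" "w' \<in> carrier W" and e: "weyl_pos w = weyl_pos w'"
  then obtain n m where n: "n \<in> Np" "w = T #> n" and m: "m \<in> Np" "w' = T #> m"
    by (auto simp: quotient_carrier)
  obtain \<sigma> c where s: "\<sigma> \<in> {1, -1 :: int}" "even c" "\<forall>k. \<phi> n (l k) = l (\<sigma> * k + c)"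
    using Np_affine[OF n(1)] .
  obtain \<tau> b where t: "\<tau> \<in> {1, -1 :: int}" "even b" "\<forall>k. \<phi> m (l k) = l (\<tau> * k + b)"
    using Np_affine[OF m(1)] .
  have mm: "min c (\<sigma> + c) = min b (\<tau> + b)"
    using e weyl_pos_affine[OF n(1) s(3)] weyl_pos_affine[OF m(1) t(3)] n m by simp
  have "\<sigma> = \<tau> \<and> c = b"
  proof -
    have "min c (\<sigma> + c) = (if \<sigma> = 1 then c else c - 1)" "min b (\<tau> + b) = (if \<tau> = 1 then b else b - 1)"
      using s(1) t(1) by auto
    then show ?thesis using mm s(1,2) t(1,2) by (auto split: if_splits)
  qed
  then show "w = w'" using rcos_T_eqI[OF n(1) m(1)] s(3) t(3) n m by simp
qed

text \<open>The image of the base edge determines the affine map: with \<open>c\<close> even, {c,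
  \<sigma> + c} = {-1, 0} forces k -> -k, and {c, \<sigma> + c} = {1, 2} forces k -> 2 - k. The
  rules for positions are the effects of these reflections on edges.\<close>

lemma reflections_dihedral:
  assumes s: "s \<in> carrier W" "\<forall>n\<in>s. \<phi> n ` {l 0, l 1} = {l (-1), l 0}"
    and t: "t \<in> carrier W" "\<forall>n\<in>t. \<phi> n ` {l 0, l 1} = {l 1, l 2}"
  shows "infinite_dihedral W s t weyl_pos"
proof -
  have self: "n \<in> T #> n" if "n \<in> carrier G" for n
  proof -
    have "\<one> \<in> T" by (simp add: T_iff act_one)
    then have "\<one> \<otimes> n \<in> T #> n" unfolding r_coset_def by blast
    then show ?thesis using that by simp
  qed
  have NpG: "Np \<subseteq> carrier G" using Np_subset by blast
  have S: "subgroup Np G" by (rule stabilizer_subgroup[OF Kp_subgroup])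
  obtain a where a: "a \<in> Np" "s = T #> a" using s by (auto simp: quotient_carrier)
  obtain b where b: "b \<in> Np" "t = T #> b" using t by (auto simp: quotient_carrier)
  have act_a: "\<forall>k. \<phi> a (l k) = l (- k)"
  proof -
    obtain \<sigma> c where sc: "\<sigma> \<in> {1, -1 :: int}" "even c" "\<forall>k. \<phi> a (l k) = l (\<sigma> * k + c)"
      using Np_affine[OF a(1)] .
    have "\<phi> a ` {l 0, l 1} = {l (-1), l 0}" using s(2) a self NpG by blast
    then have "{c, \<sigma> + c} = {-1, 0}"
      using sc(3) line_inj[OF line_l] by (auto simp: doubleton_eq_iff)
    then have "c = 0 \<and> \<sigma> = -1" using sc(1,2) by (auto simp: doubleton_eq_iff)
    then show ?thesis using sc(3) by simp
  qed
  have act_b: "\<forall>k. \<phi> b (l k) = l (2 - k)"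
  proof -
    obtain \<sigma> c where sc: "\<sigma> \<in> {1, -1 :: int}" "even c" "\<forall>k. \<phi> b (l k) = l (\<sigma> * k + c)"
      using Np_affine[OF b(1)] .
    have "\<phi> b ` {l 0, l 1} = {l 1, l 2}" using t(2) b self NpG by blast
    then have "{c, \<sigma> + c} = {1, 2}"
      using sc(3) line_inj[OF line_l] by (auto simp: doubleton_eq_iff)
    then have "c = 2 \<and> \<sigma> = -1" using sc(1,2) by (auto simp: doubleton_eq_iff)
    then show ?thesis using sc(3) by simp
  qed
  show ?thesis
  proof (intro infinite_dihedral.intro infinite_dihedral_axioms.intro)
    show "s \<in> carrier W" "t \<in> carrier W" by (rule s, rule t)
    have one: "\<one> \<in> Np" using S by (rule subgroup.one_closed)
    have "T \<subseteq> carrier G" using T_subset(1) Kp_carrier by blast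
    then have W1: "\<one>\<^bsub>W\<^esub> = T #> \<one>" by (simp add: FactGroup_def)
    have "\<forall>k. \<phi> \<one> (l k) = l (1 * k + 0)" using act_one by simp
    then have "weyl_pos (T #> \<one>) = min 0 (1 + 0)" by (rule weyl_pos_affine[OF one])
    then show "weyl_pos \<one>\<^bsub>W\<^esub> = 0" unfolding W1 by simp
    show "inj_on weyl_pos (carrier W)" by (rule weyl_pos_inj)
    fix w assume "w \<in> carrier W"
    then obtain n where n: "n \<in> Np" "w = T #> n" by (auto simp: quotient_carrier)
    obtain \<sigma> c where sc: "\<sigma> \<in> {1, -1 :: int}" "even c" "\<forall>k. \<phi> n (l k) = l (\<sigma> * k + c)"
      using Np_affine[OF n(1)] .
    have pw: "weyl_pos w = min c (\<sigma> + c)" using weyl_pos_affine[OF n(1) sc(3)] n by simp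
    have "\<forall>k. \<phi> (a \<otimes> n) (l k) = l (- \<sigma> * k + - c)"
      using sc(3) act_a a n NpG by (auto simp: act_mult subset_iff algebra_simps)
    then have "weyl_pos (T #> (a \<otimes> n)) = min (- c) (- \<sigma> + - c)"
      by (rule weyl_pos_affine[OF subgroup.m_closed[OF S a(1) n(1)]])
    then have "weyl_pos (T #> (a \<otimes> n)) = - weyl_pos w - 1"
      unfolding pw using sc(1) by auto
    then show "weyl_pos (s \<otimes>\<^bsub>W\<^esub> w) = - weyl_pos w - 1"
      unfolding a(2) n(2) quotient_mult[OF Np_normal a(1) n(1)] .
    have "\<forall>k. \<phi> (b \<otimes> n) (l k) = l (- \<sigma> * k + (2 - c))"
      using sc(3) act_b b n NpG by (auto simp: act_mult subset_iff algebra_simps)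
    then have "weyl_pos (T #> (b \<otimes> n)) = min (2 - c) (- \<sigma> + (2 - c))"
      by (rule weyl_pos_affine[OF subgroup.m_closed[OF S b(1) n(1)]])
    then have "weyl_pos (T #> (b \<otimes> n)) = 1 - weyl_pos w"
      unfolding pw using sc(1) by auto
    then show "weyl_pos (t \<otimes>\<^bsub>W\<^esub> w) = 1 - weyl_pos w"
      unfolding b(2) n(2) quotient_mult[OF Np_normal b(1) n(1)] .
  qed (rule normal.factorgroup_is_group[OF Np_normal])
qed

lemma double_coset_eq_iff:
  assumes "x \<in> Kp" "y \<in> Kp"
  shows "double_coset G B x = double_coset G B y \<longleftrightarrow> P.edge_pos x = P.edge_pos y"
proof -
  have "double_coset G B z = {y \<in> Kp. P.edge_pos y = P.edge_pos z}" if "z \<in> Kp" for z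
    using P.double_coset_chamber[of z] that by (simp add: chamber_stabilizer_eq)
  then show ?thesis using assms by auto
qed

text \<open>Transitivity on pairs of a geodesic and an edge of it, applied to the line and itself,
  gives an element of \<open>Np\<close> at any prescribed position. Hence \<open>W\<close> indexes
  all double cosets of \<open>Gp\<close>.\<close>

lemma Kp_Np_double_coset:
  assumes x: "x \<in> Kp"
  obtains n where "n \<in> Np" "double_coset G B n = double_coset G B x"
proof -
  obtain h \<sigma> c where h: "h \<in> carrier Gp" "\<sigma> \<in> {1, -1 :: int}" "\<And>k. \<phi> h (l k) = l (\<sigma> * k + c)"
    "{\<sigma> * 0 + c, \<sigma> * (0 + 1) + c} = {P.edge_pos x, P.edge_pos x + 1}"
    using P.geodesics_with_edges_transitive[OF line_l line_l, where i = 0 and j = "P.edge_pos x"] by metis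
  have KG: "Kp \<subseteq> carrier G" using Kp_carrier by blast
  have hN: "h \<in> Np" unfolding N_iff[OF KG] using h by auto
  have "P.edge_pos h = min c (\<sigma> + c)" by (rule P.edge_pos_line[OF h(3)])
  also have "\<dots> = P.edge_pos x" using h(2,4) by (auto simp: doubleton_eq_iff)
  finally have "double_coset G B h = double_coset G B x"
    using double_coset_eq_iff h(1) x by simp
  then show ?thesis using that hN by blast
qed

lemma Delta_rcos: "n \<in> carrier G \<Longrightarrow> Delta G B (T #> n) = Poly_Mapping.single (double_coset G B n) 1"
  by (simp add: Delta_def weyl_double_coset_rcos)

lemma hecke_basis_Gp: "hecke_basis Gp B = Delta G B ` carrier W"
proof
  show "hecke_basis Gp B \<subseteq> Delta G B ` carrier W"
  proof
    fix f assume "f \<in> hecke_basis Gp B"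
    then obtain x where x: "x \<in> Kp" "f = Poly_Mapping.single (double_coset G B x) 1"
      by (auto simp: hecke_basis_def double_cosets_def)
    obtain n where n: "n \<in> Np" "double_coset G B n = double_coset G B x"
      using Kp_Np_double_coset[OF x(1)] .
    have "f = Delta G B (T #> n)" using n x Np_subset Delta_rcos[of n] by auto
    then show "f \<in> Delta G B ` carrier W" using n by (auto simp: quotient_carrier)
  qed
  show "Delta G B ` carrier W \<subseteq> hecke_basis Gp B"
  proof
    fix f assume "f \<in> Delta G B ` carrier W"
    then obtain n where n: "n \<in> Np" "f = Delta G B (T #> n)" by (auto simp: quotient_carrier)
    then have "f = Poly_Mapping.single (double_coset G B n) 1" "n \<in> Kp"
      using Delta_rcos[of n] Np_subset by auto
    then show "f \<in> hecke_basis Gp B"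
      by (auto simp: hecke_basis_def double_cosets_def)
  qed
qed

text \<open>Choosing representatives in \<open>Np\<close> turns the abstract position into
  \<open>P.edge_pos\<close> and the assumptions of the dihedral setting into the product rules
  already known for double cosets.\<close>

lemma dihedral_hecke_W:
  assumes "infinite_dihedral W s t weyl_pos"
  shows "dihedral_hecke W s t weyl_pos Gp B (weyl_double_coset Gp B)
    (\<lambda>r. of_nat (rcoset_number Gp B (weyl_double_coset Gp B r)))"
proof -
  interpret I: infinite_dihedral W s t weyl_pos by (rule assms)
  have rep: "\<exists>n. n \<in> Np \<and> n \<in> Kp \<and> n \<in> carrier G \<and> w = T #> n \<and>
      weyl_double_coset Gp B w = double_coset Gp B n \<and> weyl_pos w = P.edge_pos n"
    if w: "w \<in> carrier W" for w
  proof -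
    obtain n where n: "n \<in> Np" "w = T #> n" using w by (auto simp: quotient_carrier)
    moreover have "n \<in> Kp" "n \<in> carrier G" using n Np_subset by auto
    ultimately show ?thesis using weyl_double_coset_rcos weyl_pos_rcos by auto
  qed
  have mult: "weyl_double_coset Gp B (w \<otimes>\<^bsub>W\<^esub> w') = double_coset Gp B (n \<otimes> n')"
    if "n \<in> Np" "n' \<in> Np" "w = T #> n" "w' = T #> n'" for w w' n n'
    using that quotient_mult[OF Np_normal] Np_subset weyl_double_coset_rcos by (auto simp: subset_iff)
  note pos_st = I.pos_generators
  have hp: "hecke_pair Gp P.chamber_stabilizer" by (simp only: chamber_stabilizer_eq hecke_Gp)
  show ?thesis
  proof (intro dihedral_hecke.intro dihedral_hecke_axioms.intro)
    show "infinite_dihedral W s t weyl_pos" by (rule assms)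
    show "hecke_pair Gp B" by (rule hecke_Gp)
    show "weyl_double_coset Gp B w \<in> double_cosets Gp B" if "w \<in> carrier W" for w
      using rep[OF that] Hp.double_coset_in by auto
    show "weyl_double_coset Gp B \<one>\<^bsub>W\<^esub> = B"
    proof -
      obtain n where n: "n \<in> Kp" "weyl_double_coset Gp B \<one>\<^bsub>W\<^esub> = double_coset G B n" "P.edge_pos n = 0"
        using rep[OF I.one_closed] I.pos_one by auto
      moreover have "\<one> \<in> Kp" "P.edge_pos \<one> = 0"
        using subgroup.one_closed[OF Kp_subgroup] P.edge_pos_one by auto
      ultimately show ?thesis using double_coset_eq_iff[of n \<one>] H.double_coset_one by simp
    qed
    show "double_coset_mult Gp B (weyl_double_coset Gp B r) (weyl_double_coset Gp B r) =
        of_nat (rcoset_number Gp B (weyl_double_coset Gp B r)) *\<^sub>H Poly_Mapping.single B 1 +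
        (of_nat (rcoset_number Gp B (weyl_double_coset Gp B r)) - 1) *\<^sub>H
          Poly_Mapping.single (weyl_double_coset Gp B r) 1"
      if r: "r \<in> {s, t}" for r
    proof -
      have rc: "r \<in> carrier W" using r I.s_closed I.t_closed by auto
      obtain n where n: "n \<in> Kp" "weyl_double_coset Gp B r = double_coset Gp B n" "weyl_pos r = P.edge_pos n"
        using rep[OF rc] by auto
      have "P.edge_pos n \<in> {-1, 1}" using n(3) r pos_st by auto
      then show ?thesis
        using P.double_coset_mult_panel[OF hp, of n] n(1) unfolding n(2) chamber_stabilizer_eq by simp
    qed
    show "double_coset_mult Gp B (weyl_double_coset Gp B s) (weyl_double_coset Gp B w) =
        Poly_Mapping.single (weyl_double_coset Gp B (s \<otimes>\<^bsub>W\<^esub> w)) 1"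
      if w: "w \<in> carrier W" "0 \<le> weyl_pos w" for w
    proof -
      obtain n where n: "n \<in> Np" "n \<in> Kp" "s = T #> n" "weyl_double_coset Gp B s = double_coset Gp B n"
          "weyl_pos s = P.edge_pos n"
        using rep[OF I.s_closed] by auto
      obtain m where m: "m \<in> Np" "m \<in> Kp" "w = T #> m" "weyl_double_coset Gp B w = double_coset Gp B m"
          "weyl_pos w = P.edge_pos m"
        using rep[OF w(1)] by auto
      show ?thesis
        using P.double_coset_mult_neg[OF hp, of n m] n m w pos_st mult[OF n(1) m(1) n(3) m(3)]
        unfolding n(4) m(4) chamber_stabilizer_eq by simp
    qed
    show "double_coset_mult Gp B (weyl_double_coset Gp B t) (weyl_double_coset Gp B w) =
        Poly_Mapping.single (weyl_double_coset Gp B (t \<otimes>\<^bsub>W\<^esub> w)) 1"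
      if w: "w \<in> carrier W" "weyl_pos w \<le> 0" for w
    proof -
      obtain n where n: "n \<in> Np" "n \<in> Kp" "t = T #> n" "weyl_double_coset Gp B t = double_coset Gp B n"
          "weyl_pos t = P.edge_pos n"
        using rep[OF I.t_closed] by auto
      obtain m where m: "m \<in> Np" "m \<in> Kp" "w = T #> m" "weyl_double_coset Gp B w = double_coset Gp B m"
          "weyl_pos w = P.edge_pos m"
        using rep[OF w(1)] by auto
      show ?thesis
        using P.double_coset_mult_pos[OF hp, of n m] n m w pos_st mult[OF n(1) m(1) n(3) m(3)]
        unfolding n(4) m(4) chamber_stabilizer_eq by simp
    qed
  qed
qed

section \<open>Comparison of the Hecke algebras of the two groups\<close>

lemma double_cosets_Gp_subset: "double_cosets Gp B \<subseteq> double_cosets G B"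
  using Kp_carrier by (auto simp: double_cosets_def)

lemma rcosets_in_Gp: "D \<in> double_cosets Gp B \<Longrightarrow> rcosets_in Gp B D = rcosets_in G B D"
  using double_cosets_Gp_subset by (auto simp: Hp.rcosets_in_eq H.rcosets_in_eq)

text \<open>The right cosets in \<open>D\<close> and \<open>D'\<close> are the same in both groups,
  so the counts agree; the index sets of the two sums differ. A double coset outside
  \<open>Kp\<close> gets coefficient 0, since a product of type-preserving elements is
  type-preserving.\<close>

lemma double_coset_mult_Gp:
  assumes D: "D \<in> double_cosets Gp B" and D': "D' \<in> double_cosets Gp B"
  shows "double_coset_mult G B D D' = double_coset_mult Gp B D D'"
proof (rule poly_mapping_eqI)
  fix Y
  have DG: "D \<in> double_cosets G B" "D' \<in> double_cosets G B" using D D' double_cosets_Gp_subset by auto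
  have coeff: "hecke_coeff Gp B D D' x = hecke_coeff G B D D' x" for x
    by (simp add: hecke_coeff_def rcosets_in_Gp D D')
  have "hecke_coeff G B D D' (coset_rep Y) = 0"
    if Y: "Y \<in> double_cosets G B" "Y \<notin> double_cosets Gp B"
  proof -
    have y: "coset_rep Y \<in> carrier G" "double_coset G B (coset_rep Y) = Y"
      using Y(1) H.coset_rep_double_coset H.double_cosets_subset H.double_coset_coset_rep by auto
    then have "coset_rep Y \<notin> Kp" using Y(2) Hp.double_coset_in by fastforce
    moreover have "coset_rep Y \<in> Kp"
      if C: "C \<in> rcosets_in G B D" "C' \<in> rcosets_in G B D'"
        "coset_rep C \<otimes> coset_rep C' \<in> B #> coset_rep Y" for C C'
    proof -
      have "coset_rep C \<in> Kp" "coset_rep C' \<in> Kp"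
        using C(1,2) H.coset_rep_rcosets_in Hp.double_cosets_subset D D' by auto
      moreover obtain b where "b \<in> B" "coset_rep C \<otimes> coset_rep C' = b \<otimes> coset_rep Y"
        using C(3) by (auto simp: r_coset_def)
      ultimately have "b \<otimes> coset_rep Y \<in> Kp"
        using subgroup.m_closed[OF Kp_subgroup] by metis
      then show ?thesis
        using \<open>b \<in> B\<close> B_subset Kp_carrier y(1) parity_mult[of b "coset_rep Y"] by blast
    qed
    ultimately have "{(C, C'). C \<in> rcosets_in G B D \<and> C' \<in> rcosets_in G B D' \<and>
        coset_rep C \<otimes> coset_rep C' \<in> B #> coset_rep Y} = {}" by blast
    then show ?thesis unfolding hecke_coeff_def by (simp only: card.empty)
  qed
  then show "Poly_Mapping.lookup (double_coset_mult G B D D') Y =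
      Poly_Mapping.lookup (double_coset_mult Gp B D D') Y"
    using double_cosets_Gp_subset
    by (auto simp: H.lookup_double_coset_mult[OF DG] Hp.lookup_double_coset_mult[OF D D'] coeff)
qed

lemma hecke_mult_Gp:
  assumes "w \<in> carrier W" "w' \<in> carrier W"
  shows "hecke_mult G B (Delta G B w) (Delta G B w') = hecke_mult Gp B (Delta G B w) (Delta G B w')"
proof -
  have "weyl_double_coset G B w \<in> double_cosets Gp B" if "w \<in> carrier W" for w
  proof -
    obtain n where "n \<in> Np" "w = T #> n" using \<open>w \<in> carrier W\<close> by (auto simp: quotient_carrier)
    moreover then have "n \<in> Kp" "n \<in> carrier G" using Np_subset by auto
    ultimately show ?thesis
      using weyl_double_coset_rcos[of n] Hp.double_coset_in[of n] by simp
  qed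
  then show ?thesis
    using assms by (simp add: Delta_def hecke_mult_single double_coset_mult_Gp)
qed

end

section \<open>An element that inverts the base edge\<close>

locale weyl_flip = weyl_setting +
  fixes i
  assumes i_N: "i \<in> N" and flip: "\<phi> i (l 0) = l 1" "\<phi> i (l 1) = l 0"
begin

lemma i_carrier: "i \<in> carrier G"
  using i_N Np_subset by blast

lemma flip_line: "\<phi> i (l k) = l (1 - k)"
proof -
  obtain \<sigma> c where s: "\<sigma> \<in> {1, -1 :: int}" "\<forall>k. \<phi> i (l k) = l (\<sigma> * k + c)"
    using i_N unfolding N_iff[OF subset_refl] by blast
  then have "l c = l 1" "l (\<sigma> + c) = l 0" using flip s(2)[rule_format, of 0] s(2)[rule_format, of 1] by auto
  then have "c = 1" "\<sigma> = -1" using line_inj[OF line_l] by auto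
  then show ?thesis using s by simp
qed

lemma i_not_Kp: "i \<notin> Kp"
  using Kp_iff[OF i_carrier, of "l 0"] flip graph_dist_1[OF P.l01] by simp

lemma flip_line_inv: "\<phi> (inv i) (l k) = l (1 - k)"
  using act_inv_act[OF i_carrier, of "l (1 - k)"] flip_line[of "1 - k"] by simp

lemma i_normalizes: "i <# B = B #> i"
proof
  have 1: "i \<otimes> b \<otimes> inv i \<in> B" "inv i \<otimes> b \<otimes> i \<in> B" if "b \<in> B" for b
    using that i_carrier flip flip_line_inv[of 0] flip_line_inv[of 1]
    by (auto simp: B_iff act_mult)
  show "i <# B \<subseteq> B #> i"
  proof
    fix x assume "x \<in> i <# B"
    then obtain b where b: "b \<in> B" "x = i \<otimes> b" by (auto simp: l_coset_def)
    then have "x = (i \<otimes> b \<otimes> inv i) \<otimes> i" using i_carrier by (simp add: B_iff m_assoc)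
    then show "x \<in> B #> i" using 1 b by (auto simp: r_coset_def)
  qed
  show "B #> i \<subseteq> i <# B"
  proof
    fix x assume "x \<in> B #> i"
    then obtain b where b: "b \<in> B" "x = b \<otimes> i" by (auto simp: r_coset_def)
    then have "x = i \<otimes> (inv i \<otimes> b \<otimes> i)" using i_carrier by (simp add: B_iff flip: m_assoc)
    then show "x \<in> i <# B" using 1 b by (auto simp: l_coset_def)
  qed
qed

abbreviation "\<Delta> \<equiv> Delta G B"
abbreviation "I \<equiv> T #> i"
abbreviation hmult (infixl \<open>\<star>\<close> 70) where "f \<star> g \<equiv> hecke_mult G B f g"

lemma flip_mult_left:
  assumes x: "x \<in> carrier G"
  shows "\<Delta> I \<star> Poly_Mapping.single (double_coset G B x) 1 = Poly_Mapping.single (double_coset G B (i \<otimes> x)) 1"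
  using H.double_coset_mult_normalizing_left[OF i_carrier i_normalizes x] Delta_rcos[OF i_carrier]
  by (simp add: hecke_mult_single)

lemma flip_mult_right:
  assumes x: "x \<in> carrier G"
  shows "Poly_Mapping.single (double_coset G B x) 1 \<star> \<Delta> I = Poly_Mapping.single (double_coset G B (x \<otimes> i)) 1"
  using H.double_coset_mult_normalizing_right[OF i_carrier i_normalizes x] Delta_rcos[OF i_carrier]
  by (simp add: hecke_mult_single)

lemma Delta_flip:
  assumes "w \<in> carrier W"
  shows "\<Delta> (I \<otimes>\<^bsub>Wt\<^esub> w) = \<Delta> I \<star> \<Delta> w"
proof -
  obtain n where n: "n \<in> Np" "w = T #> n" using assms by (auto simp: quotient_carrier)
  have c: "n \<in> N" "n \<in> carrier G" using n Np_subset by auto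
  have "I \<otimes>\<^bsub>Wt\<^esub> w = T #> (i \<otimes> n)" unfolding n(2) by (rule quotient_mult[OF N_normal i_N c(1)])
  then show ?thesis
    using c i_carrier n(2) flip_mult_left[OF c(2)] by (simp add: Delta_rcos)
qed

lemma Delta_double_coset:
  assumes "w \<in> carrier Wt"
  shows "\<exists>D\<in>double_cosets G B. \<Delta> w = Poly_Mapping.single D 1"
proof -
  obtain n where "n \<in> N" "w = T #> n" using assms by (auto simp: quotient_carrier)
  then show ?thesis using Delta_rcos[of n] H.double_coset_in[of n] Np_subset by blast
qed

lemma W_subset_Wt: "carrier W \<subseteq> carrier Wt"
  using Np_subset by (auto simp: quotient_carrier)

lemma I_Wt: "I \<in> carrier Wt"
  using i_N by (auto simp: quotient_carrier)

lemma Delta_assoc: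
  assumes "u \<in> carrier Wt" "v \<in> carrier Wt" "w \<in> carrier Wt"
  shows "\<Delta> u \<star> \<Delta> v \<star> \<Delta> w = \<Delta> u \<star> (\<Delta> v \<star> \<Delta> w)"
  using assms[THEN Delta_double_coset] H.hecke_mult_assoc_basis by auto

text \<open>\<open>i\<close> need not be an involution of \<open>G\<close>, but its square fixes
  both ends of the base edge and so lies in \<open>B\<close>.\<close>

lemma Delta_flip_flip:
  assumes "w \<in> carrier W"
  shows "\<Delta> I \<star> (\<Delta> I \<star> \<Delta> w) = \<Delta> w"
proof -
  obtain n where n: "n \<in> Np" "w = T #> n" using assms by (auto simp: quotient_carrier)
  have c: "n \<in> carrier G" using n Np_subset by auto
  have ii: "i \<otimes> i \<in> B"
    using i_carrier flip by (simp add: B_iff act_mult)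
  have "i \<otimes> (i \<otimes> n) \<in> double_coset G B n"
    using H.double_coset_memI[OF ii, of \<one> n] c i_carrier by (simp add: m_assoc)
  then have "double_coset G B (i \<otimes> (i \<otimes> n)) = double_coset G B n" by (rule H.double_coset_eqI[OF c])
  moreover have "\<Delta> w = Poly_Mapping.single (double_coset G B n) 1"
    unfolding n(2) by (rule Delta_rcos[OF c])
  ultimately show ?thesis
    using flip_mult_left[OF c] flip_mult_left[of "i \<otimes> n"] c i_carrier by simp
qed

text \<open>If \<open>x\<close> is not type-preserving then \<open>inv i \<otimes> x\<close> is; the
  basis for \<open>Gp\<close> applies to it, and multiplication by the element of \<open>I\<close>
  restores the factor \<open>i\<close>.\<close>

lemma hecke_basis_G: "hecke_basis G B = \<Delta> ` carrier W \<union> (\<lambda>w. \<Delta> (I \<otimes>\<^bsub>Wt\<^esub> w)) ` carrier W"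
proof
  show "hecke_basis G B \<subseteq> \<Delta> ` carrier W \<union> (\<lambda>w. \<Delta> (I \<otimes>\<^bsub>Wt\<^esub> w)) ` carrier W"
  proof
    fix f assume "f \<in> hecke_basis G B"
    then obtain x where x: "x \<in> carrier G" "f = Poly_Mapping.single (double_coset G B x) 1"
      by (auto simp: hecke_basis_def double_cosets_def)
    show "f \<in> \<Delta> ` carrier W \<union> (\<lambda>w. \<Delta> (I \<otimes>\<^bsub>Wt\<^esub> w)) ` carrier W"
    proof (cases "x \<in> Kp")
      case True
      then have "f \<in> hecke_basis Gp B" using x by (auto simp: hecke_basis_def double_cosets_def)
      then show ?thesis using hecke_basis_Gp by blast
    next
      case False
      have "inv i \<notin> Kp" using i_not_Kp subgroup.m_inv_closed[OF Kp_subgroup, of "inv i"] i_carrier by auto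
      then have "inv i \<otimes> x \<in> Kp" using parity_mult[of "inv i" x] False i_carrier x by simp
      then have "Poly_Mapping.single (double_coset G B (inv i \<otimes> x)) 1 \<in> hecke_basis Gp B"
        by (auto simp: hecke_basis_def double_cosets_def)
      then obtain w where w: "w \<in> carrier W" "Poly_Mapping.single (double_coset G B (inv i \<otimes> x)) 1 = \<Delta> w"
        using hecke_basis_Gp by blast
      have "\<Delta> (I \<otimes>\<^bsub>Wt\<^esub> w) = Poly_Mapping.single (double_coset G B (i \<otimes> (inv i \<otimes> x))) 1"
        using Delta_flip[OF w(1)] w(2) flip_mult_left[of "inv i \<otimes> x"] i_carrier x(1) by simp
      also have "i \<otimes> (inv i \<otimes> x) = x" using i_carrier x(1) by (simp flip: m_assoc)
      finally have "f = \<Delta> (I \<otimes>\<^bsub>Wt\<^esub> w)" using x(2) by simp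
      then show ?thesis using w(1) by (intro UnI2) (rule image_eqI)
    qed
  qed
  show "\<Delta> ` carrier W \<union> (\<lambda>w. \<Delta> (I \<otimes>\<^bsub>Wt\<^esub> w)) ` carrier W \<subseteq> hecke_basis G B"
  proof -
    have "\<Delta> w \<in> hecke_basis G B" if "w \<in> carrier Wt" for w
      using Delta_double_coset[OF that] by (auto simp: hecke_basis_def)
    moreover have "I \<otimes>\<^bsub>Wt\<^esub> w \<in> carrier Wt" if "w \<in> carrier W" for w
      using group.is_monoid[OF normal.factorgroup_is_group[OF N_normal]] I_Wt that W_subset_Wt
      by (meson monoid.m_closed subsetD)
    ultimately show ?thesis using W_subset_Wt by blast
  qed
qed

text \<open>Write n i = i x with x = i^-1 n i. As \<open>i\<close> acts by k -> 1 - k, this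
  conjugation negates positions, so \<open>x\<close> and the representative \<open>m\<close> lie in
  the same double coset. The automorphism \<open>bar\<close> can therefore enter through its effect
  on positions alone.\<close>

lemma Delta_commute_flip:
  assumes w: "w \<in> carrier W" and w': "w' \<in> carrier W" and pos: "weyl_pos w' = - weyl_pos w"
  shows "\<Delta> w \<star> \<Delta> I = \<Delta> I \<star> \<Delta> w'"
proof -
  obtain n where n: "n \<in> Np" "w = T #> n" using w by (auto simp: quotient_carrier)
  obtain m where m: "m \<in> Np" "w' = T #> m" using w' by (auto simp: quotient_carrier)
  have c: "n \<in> carrier G" "m \<in> carrier G" "n \<in> Kp" "m \<in> Kp" using n m Np_subset by auto
  define x where "x = inv i \<otimes> n \<otimes> i"
  have xc: "x \<in> carrier G" using c i_carrier by (simp add: x_def)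
  have "\<one> \<in> Kp" using Kp_subgroup by (rule subgroup.one_closed)
  then have "inv i \<notin> Kp" using parity_mult[of "inv i" i] i_not_Kp i_carrier by simp
  then have xK: "x \<in> Kp"
    using parity_mult[of "inv i \<otimes> n" i] parity_mult[of "inv i" n] c i_carrier i_not_Kp by (simp add: x_def)
  obtain \<sigma> b where sb: "\<sigma> \<in> {1, -1 :: int}" "even b" "\<forall>k. \<phi> n (l k) = l (\<sigma> * k + b)"
    using Np_affine[OF n(1)] .
  have "\<phi> x (l k) = l (\<sigma> * k + (1 - \<sigma> - b))" for k
    using c i_carrier sb(3) by (simp add: x_def act_mult flip_line flip_line_inv algebra_simps)
  then have "P.edge_pos x = min (1 - \<sigma> - b) (\<sigma> + (1 - \<sigma> - b))" by (rule P.edge_pos_line)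
  also have "\<dots> = - min b (\<sigma> + b)" using sb(1) by auto
  also have "\<dots> = - weyl_pos w" using weyl_pos_affine[OF n(1) sb(3)] n(2) by simp
  also have "\<dots> = P.edge_pos m" using pos weyl_pos_rcos[OF m(1)] m(2) by simp
  finally have dc: "double_coset G B x = double_coset G B m"
    using double_coset_eq_iff[OF xK c(4)] by simp
  have "n \<otimes> i = i \<otimes> x" using c i_carrier by (simp add: x_def flip: m_assoc)
  then have "\<Delta> w \<star> \<Delta> I = Poly_Mapping.single (double_coset G B (i \<otimes> x)) 1"
    using flip_mult_right[OF c(1)] n(2) Delta_rcos[OF c(1)] by simp
  also have "\<dots> = \<Delta> I \<star> \<Delta> w'"
    using flip_mult_left[OF xc] dc m(2) Delta_rcos[OF c(2)] by simp
  finally show ?thesis .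
qed

end

text \<open>Of the two orientations of the geodesic, the one that puts \<open>e\<^sub>1\<close> on
  the negative side of the base edge is chosen.\<close>

lemma (in tree_graph) oriented_parametrization:
  assumes A: "A \<in> biinfinite_geodesics X" "e \<in> snd A"
    and nbrs: "neighbour_edges A e = {e\<^sub>1, e\<^sub>2}" "e\<^sub>1 \<noteq> e\<^sub>2"
  obtains l where "line X l" "A = (range l, range (\<lambda>k. {l k, l (k + 1)}))"
    "e = {l 0, l 1}" "e\<^sub>1 = {l (-1), l 0}" "e\<^sub>2 = {l 1, l 2}"
proof -
  obtain l0 where l0: "line X l0" "fst A = range l0" "snd A = range (\<lambda>k. {l0 k, l0 (k + 1)})"
    using A(1) biinfinite_geodesics_line by blast
  obtain k0 where k0: "e = {l0 k0, l0 (k0 + 1)}" using A(2) l0(3) by blast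
  have shift: "A = (range (\<lambda>k. l0 (\<sigma> * k + c)), range (\<lambda>k. {l0 (\<sigma> * k + c), l0 (\<sigma> * (k + 1) + c)}))"
    if "\<sigma> \<in> {1, -1}" for \<sigma> c
    unfolding range_affine[OF that] using l0 by (simp add: prod_eq_iff)
  have "neighbour_edges A e = {{l0 (k0 - 1), l0 k0}, {l0 (k0 + 1), l0 (k0 + 2)}}"
  proof (intro Set.set_eqI iffI)
    fix f assume "f \<in> neighbour_edges A e"
    then obtain k where k: "f = {l0 k, l0 (k + 1)}" "f \<noteq> e" "f \<inter> e \<noteq> {}"
      by (auto simp: neighbour_edges_def l0(3))
    then have "k = k0 - 1 \<or> k = k0 + 1"
      using line_inj[OF l0(1)] k0 by auto
    then show "f \<in> {{l0 (k0 - 1), l0 k0}, {l0 (k0 + 1), l0 (k0 + 2)}}"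
      using k(1) by (auto simp: algebra_simps)
  next
    fix f assume f: "f \<in> {{l0 (k0 - 1), l0 k0}, {l0 (k0 + 1), l0 (k0 + 2)}}"
    have "{l0 (k0 - 1), l0 k0} = {l0 (k0 - 1), l0 ((k0 - 1) + 1)}"
        "{l0 (k0 + 1), l0 (k0 + 2)} = {l0 (k0 + 1), l0 ((k0 + 1) + 1)}" by (simp_all add: algebra_simps)
    then have "f \<in> snd A" using f l0(3) by blast
    then show "f \<in> neighbour_edges A e"
      using f line_inj[OF l0(1)] k0 by (auto simp: neighbour_edges_def doubleton_eq_iff)
  qed
  then consider "e\<^sub>1 = {l0 (k0 - 1), l0 k0}" "e\<^sub>2 = {l0 (k0 + 1), l0 (k0 + 2)}"
    | "e\<^sub>2 = {l0 (k0 - 1), l0 k0}" "e\<^sub>1 = {l0 (k0 + 1), l0 (k0 + 2)}"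
    using nbrs by (metis doubleton_eq_iff)
  then show ?thesis
  proof cases
    case 1
    show ?thesis
    proof (rule that[OF line_affine[OF _ l0(1), of 1 k0] shift[of 1 k0]])
    qed (use 1 k0 in \<open>simp_all add: algebra_simps\<close>)
  next
    case 2
    show ?thesis
    \<comment> \<open>The map k -> k0 + 1 - k interchanges the indices of the two ends of
      \<open>e\<close>, and with them the two neighbouring edges.\<close>
    proof (rule that[OF line_affine[OF _ l0(1), of "-1" "k0 + 1"] shift[of "-1" "k0 + 1"]])
    qed (use 2 k0 in \<open>simp_all add: algebra_simps insert_commute\<close>)
  qed
qed

context weyl_setting
begin

lemma multiplication_W:
  assumes dih: "infinite_dihedral W s t weyl_pos"
  defines "q \<equiv> \<lambda>r. of_nat (rcoset_number Gp B (weyl_double_coset Gp B r)) :: complex"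
    and "word \<equiv> reduced_word W {s, t}"
  defines "qw \<equiv> \<lambda>v. \<Prod>r\<leftarrow>v. q r"
  assumes w: "w \<in> carrier W" and w': "w' \<in> carrier W"
  shows "word w = [] \<or> word w' = [] \<or> last (word w) \<noteq> hd (word w') \<Longrightarrow>
      hecke_mult Gp B (Delta G B w) (Delta G B w') = Delta G B (w \<otimes>\<^bsub>W\<^esub> w')"
    and "word w \<noteq> [] \<Longrightarrow> word w' \<noteq> [] \<Longrightarrow> last (word w) = r \<Longrightarrow> hd (word w') = r \<Longrightarrow>
      {r, u} = {s, t} \<Longrightarrow> m = min (length (word w)) (length (word w')) \<Longrightarrow>
      hecke_mult Gp B (Delta G B w) (Delta G B w') =
        qw (last_letters m (word w))
          *\<^sub>H Delta G B (word_prod W (drop_last_letters m (word w) @ drop m (word w')))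
        + (\<Sum>j<m. (qw (last_letters j (word w)) * (q (if even j then r else u) - 1))
            *\<^sub>H Delta G B (word_prod W (drop_last_letters (j + 1) (word w)
                   @ [word w' ! j] @ drop (j + 1) (word w'))))"
proof -
  interpret D: dihedral_hecke W s t weyl_pos Gp B "weyl_double_coset Gp B" q
    unfolding q_def by (rule dihedral_hecke_W[OF dih])
  have Delta: "Delta G B (word_prod W xs) = D.\<Delta> xs" for xs
    by (simp add: Delta_def)
  have alt: "D.alternating (word w)" "D.alternating (word w')"
    using D.reduced_word(1)[OF w] D.reduced_word(1)[OF w'] by (simp_all add: word_def)
  have prod: "word_prod W (word w) = w" "word_prod W (word w') = w'"
    using D.reduced_word(2)[OF w] D.reduced_word(2)[OF w'] by (simp_all add: word_def)
  have Dw: "Delta G B w = D.\<Delta> (word w)" "Delta G B w' = D.\<Delta> (word w')"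
    using Delta[of "word w"] Delta[of "word w'"] unfolding prod by simp_all
  {
    assume "word w = [] \<or> word w' = [] \<or> last (word w) \<noteq> hd (word w')"
    then have "D.alternating (word w @ word w')" using alt by (auto simp: D.alternating_append)
    then have "hecke_mult Gp B (Delta G B w) (Delta G B w') = D.\<Delta> (word w @ word w')"
      unfolding Dw by (rule D.\<Delta>_append)
    also have "\<dots> = Delta G B (w \<otimes>\<^bsub>W\<^esub> w')"
      using D.word_prod_append[OF alt[THEN D.alternating_set]] unfolding prod Delta[symmetric] by (simp only:)
    finally show "hecke_mult Gp B (Delta G B w) (Delta G B w') = Delta G B (w \<otimes>\<^bsub>W\<^esub> w')" .
  }
  assume "word w \<noteq> []" "word w' \<noteq> []" "last (word w) = r" "hd (word w') = r"
      "{r, u} = {s, t}" "m = min (length (word w)) (length (word w'))"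
  from D.\<Delta>_mult_cancelling[OF alt this]
  show "hecke_mult Gp B (Delta G B w) (Delta G B w') =
        qw (last_letters m (word w))
          *\<^sub>H Delta G B (word_prod W (drop_last_letters m (word w) @ drop m (word w')))
        + (\<Sum>j<m. (qw (last_letters j (word w)) * (q (if even j then r else u) - 1))
            *\<^sub>H Delta G B (word_prod W (drop_last_letters (j + 1) (word w)
                   @ [word w' ! j] @ drop (j + 1) (word w'))))"
    unfolding Dw Delta qw_def .
qed

end

context weyl_flip
begin

text \<open>All three relations come from associativity and the rules for \<open>I\<close>: its
  basis element splits off on the left, passes from right to left at the price of
  \<open>bar\<close>, and cancels when it occurs twice.\<close>

lemma multiplication_Wt:
  assumes dih: "infinite_dihedral W s t weyl_pos"
    and bar: "bar \<in> iso W W" "bar s = t" "bar t = s"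
    and w: "w \<in> carrier W" and w': "w' \<in> carrier W"
  shows "\<Delta> (I \<otimes>\<^bsub>Wt\<^esub> w) \<star> \<Delta> w' = \<Delta> I \<star> (\<Delta> w \<star> \<Delta> w')"
    and "\<Delta> w \<star> \<Delta> (I \<otimes>\<^bsub>Wt\<^esub> w') = \<Delta> I \<star> (\<Delta> (bar w) \<star> \<Delta> w')"
    and "\<Delta> (I \<otimes>\<^bsub>Wt\<^esub> w) \<star> \<Delta> (I \<otimes>\<^bsub>Wt\<^esub> w') = \<Delta> (bar w) \<star> \<Delta> w'"
proof -
  interpret D: infinite_dihedral W s t weyl_pos by (rule dih)
  have hom: "bar \<in> hom W W" using bar(1) by (simp add: iso_def)
  then have bw: "bar w \<in> carrier W" using w by (auto simp: hom_def)
  have Wt: "I \<in> carrier Wt" "w \<in> carrier Wt" "w' \<in> carrier Wt" "bar w \<in> carrier Wt"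
    using I_Wt W_subset_Wt w w' bw by blast+
  have comm: "\<Delta> w \<star> \<Delta> I = \<Delta> I \<star> \<Delta> (bar w)"
    by (rule Delta_commute_flip[OF w bw D.pos_swap[OF hom bar(2,3) w]])
  show "\<Delta> (I \<otimes>\<^bsub>Wt\<^esub> w) \<star> \<Delta> w' = \<Delta> I \<star> (\<Delta> w \<star> \<Delta> w')"
    unfolding Delta_flip[OF w] by (rule Delta_assoc[OF Wt(1-3)])
  show "\<Delta> w \<star> \<Delta> (I \<otimes>\<^bsub>Wt\<^esub> w') = \<Delta> I \<star> (\<Delta> (bar w) \<star> \<Delta> w')"
    unfolding Delta_flip[OF w'] Delta_assoc[OF Wt(2,1,3), symmetric] comm
    by (rule Delta_assoc[OF Wt(1,4,3)])
  have "\<Delta> (I \<otimes>\<^bsub>Wt\<^esub> w) \<star> \<Delta> I = \<Delta> I \<star> (\<Delta> I \<star> \<Delta> (bar w))"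
    unfolding Delta_flip[OF w] Delta_assoc[OF Wt(1,2,1)] comm ..
  then have *: "\<Delta> (I \<otimes>\<^bsub>Wt\<^esub> w) \<star> \<Delta> I = \<Delta> (bar w)"
    unfolding Delta_flip_flip[OF bw] .
  have IwWt: "I \<otimes>\<^bsub>Wt\<^esub> w \<in> carrier Wt"
    using group.is_monoid[OF normal.factorgroup_is_group[OF N_normal]] Wt(1,2)
    by (rule monoid.m_closed)
  show "\<Delta> (I \<otimes>\<^bsub>Wt\<^esub> w) \<star> \<Delta> (I \<otimes>\<^bsub>Wt\<^esub> w') = \<Delta> (bar w) \<star> \<Delta> w'"
    unfolding Delta_flip[OF w'] Delta_assoc[OF IwWt Wt(1,3), symmetric] * ..
qed

end

theorem corollary4p6:
  fixes G Gp :: "('g, 'm) monoid_scheme"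
    and X A :: "'v graph"
    and \<phi> :: "'g \<Rightarrow> 'v \<Rightarrow> 'v"
    and e e\<^sub>s e\<^sub>t :: "'v set"
    and B N Np T s t :: "'g set"
    and W Wt :: "'g set monoid"
    and bar :: "'g set \<Rightarrow> 'g set"
    and \<Delta> :: "'g set \<Rightarrow> 'g hecke"
    and q :: "'g set \<Rightarrow> complex"
    and qw :: "'g set list \<Rightarrow> complex"
    and word :: "'g set \<Rightarrow> 'g set list"
  assumes tree: "tree X" "locally_finite X"
    and action: "group G" "acts_by_automorphisms G X \<phi>"
    and Gp: "Gp = G\<lparr>carrier := type_preserving_part G X \<phi>\<rparr>"
    and strong: "strongly_transitive (carrier Gp) X \<phi>"
    and e: "e \<in> snd X"
    and B: "B = pointwise_stabilizer (carrier G) \<phi> e"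
    and hecke: "hecke_pair G B" "hecke_pair Gp B"
    and A: "A \<in> biinfinite_geodesics X" "e \<in> snd A"
    and Np: "Np = setwise_stabilizer (carrier Gp) \<phi> A"
    and N: "N = setwise_stabilizer (carrier G) \<phi> A"
    and T: "T = pointwise_stabilizer (carrier G) \<phi> (fst A)"
    and W: "W = G\<lparr>carrier := Np\<rparr> Mod T"
    and Wt: "Wt = G\<lparr>carrier := N\<rparr> Mod T"
    and nbrs: "neighbour_edges A e = {e\<^sub>s, e\<^sub>t}" "e\<^sub>s \<noteq> e\<^sub>t"
    and s: "s \<in> carrier W" "s \<noteq> \<one>\<^bsub>W\<^esub>" "s \<otimes>\<^bsub>W\<^esub> s = \<one>\<^bsub>W\<^esub>" "\<forall>n\<in>s. \<phi> n ` e = e\<^sub>s"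
    and t: "t \<in> carrier W" "t \<noteq> \<one>\<^bsub>W\<^esub>" "t \<otimes>\<^bsub>W\<^esub> t = \<one>\<^bsub>W\<^esub>" "\<forall>n\<in>t. \<phi> n ` e = e\<^sub>t"
    and bar: "bar \<in> iso W W" "bar s = t" "bar t = s"
    and \<Delta>: "\<Delta> = Delta G B"
    and q: "q = (\<lambda>r. of_nat (rcoset_number Gp B (weyl_double_coset Gp B r)))"
    and qw: "qw = (\<lambda>v. \<Prod>r\<leftarrow>v. q r)"
    and word: "word = reduced_word W {s, t}"
  shows
    \<comment> \<open>(1)\<close>
    "(hecke_basis Gp B = \<Delta> ` carrier W \<and>
     (\<forall>w\<in>carrier W. \<forall>w'\<in>carrier W.
        \<comment> \<open>(a)\<close>
        (word w = [] \<or> word w' = [] \<or> last (word w) \<noteq> hd (word w') \<longrightarrow>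
           hecke_mult Gp B (\<Delta> w) (\<Delta> w') = \<Delta> (w \<otimes>\<^bsub>W\<^esub> w')) \<and>
        \<comment> \<open>(b)\<close>
        (\<forall>r u m. word w \<noteq> [] \<and> word w' \<noteq> [] \<and> last (word w) = r \<and> hd (word w') = r \<and>
           {r, u} = {s, t} \<and> m = min (length (word w)) (length (word w')) \<longrightarrow>
           hecke_mult Gp B (\<Delta> w) (\<Delta> w') =
             qw (last_letters m (word w))
               *\<^sub>H \<Delta> (word_prod W (drop_last_letters m (word w) @ drop m (word w')))
             + (\<Sum>j<m. (qw (last_letters j (word w)) * (q (if even j then r else u) - 1))
                 *\<^sub>H \<Delta> (word_prod W (drop_last_letters (j + 1) (word w)
                        @ [word w' ! j] @ drop (j + 1) (word w'))))))) \<and>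
    \<comment> \<open>(2)\<close>
    (carrier G \<noteq> carrier Gp \<longrightarrow>
     (\<forall>i\<in>N. (\<forall>v\<in>e. \<phi> i v \<in> e \<and> \<phi> i v \<noteq> v) \<longrightarrow>
        (let I = T #>\<^bsub>G\<^esub> i in
         hecke_basis G B = \<Delta> ` carrier W \<union> (\<lambda>w. \<Delta> (I \<otimes>\<^bsub>Wt\<^esub> w)) ` carrier W \<and>
         (\<forall>w\<in>carrier W. \<forall>w'\<in>carrier W.
            hecke_mult G B (\<Delta> w) (\<Delta> w') = hecke_mult Gp B (\<Delta> w) (\<Delta> w') \<and>
            hecke_mult G B (\<Delta> (I \<otimes>\<^bsub>Wt\<^esub> w)) (\<Delta> w') =
              hecke_mult G B (\<Delta> I) (hecke_mult G B (\<Delta> w) (\<Delta> w')) \<and>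
            hecke_mult G B (\<Delta> w) (\<Delta> (I \<otimes>\<^bsub>Wt\<^esub> w')) =
              hecke_mult G B (\<Delta> I) (hecke_mult G B (\<Delta> (bar w)) (\<Delta> w')) \<and>
            hecke_mult G B (\<Delta> (I \<otimes>\<^bsub>Wt\<^esub> w)) (\<Delta> (I \<otimes>\<^bsub>Wt\<^esub> w')) =
              hecke_mult G B (\<Delta> (bar w)) (\<Delta> w')))))"
proof -
  interpret act: tree_action G X \<phi>
    using tree action
    by (intro tree_action.intro tree_action_axioms.intro tree_graph.intro)
      (auto simp: acts_by_automorphisms_def)
  \<comment> \<open>With \<open>e\<^sub>s\<close> on the negative side, \<open>s\<close> has
    position -1 and \<open>t\<close> position 1, as the abstract dihedral setting requires.\<close>
  obtain l where l: "line X l" and A': "A = (range l, range (\<lambda>k. {l k, l (k + 1)}))"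
    and e': "e = {l 0, l 1}" and es: "e\<^sub>s = {l (-1), l 0}" and et: "e\<^sub>t = {l 1, l 2}"
    by (rule act.oriented_parametrization[OF A nbrs])
  have B': "B = pointwise_stabilizer (carrier G) \<phi> {l 0, l 1}" using B e' by simp
  have T': "T = pointwise_stabilizer (carrier G) \<phi> (range l)" using T A' by simp
  have Np': "Np = setwise_stabilizer (type_preserving_part G X \<phi>) \<phi> A" using Np Gp by simp
  interpret S: weyl_setting G X \<phi> l
  proof (intro weyl_setting.intro weyl_setting_axioms.intro)
    show "tree_action G X \<phi>" by (rule act.tree_action_axioms)
    show "strongly_transitive (type_preserving_part G X \<phi>) X \<phi>" using strong Gp by simp
  qed (use l hecke in \<open>simp_all add: B' Gp\<close>)
  have W': "W = S.W" unfolding W Np' T' A' ..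
  have Wt': "Wt = S.Wt" unfolding Wt N T' A' ..
  have dih: "infinite_dihedral S.W s t S.weyl_pos"
    using s(1,4) t(1,4) unfolding W' e' es et by (intro S.reflections_dihedral)
  note mult = S.multiplication_W[OF dih]
  have flip: "weyl_flip G X \<phi> l i"
    if i: "i \<in> N" "\<forall>v\<in>e. \<phi> i v \<in> e \<and> \<phi> i v \<noteq> v" for i
  proof (intro weyl_flip.intro weyl_flip_axioms.intro)
    show "weyl_setting G X \<phi> l" by (rule S.weyl_setting_axioms)
    show "i \<in> S.N" using i(1) unfolding N A' .
    show "\<phi> i (l 0) = l 1" "\<phi> i (l 1) = l 0" using i(2) unfolding e' by auto
  qed
  have bar': "bar \<in> iso S.W S.W" using bar(1) unfolding W' .
  show ?thesis
    unfolding \<Delta> q qw word Let_def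
  proof (intro conjI ballI allI impI; (elim conjE)?)
    show "hecke_basis Gp B = Delta G B ` carrier W"
      unfolding Gp B' W' by (rule S.hecke_basis_Gp)
  next
    fix w w' assume w: "w \<in> carrier W" "w' \<in> carrier W"
      and "reduced_word W {s, t} w = [] \<or> reduced_word W {s, t} w' = [] \<or>
        last (reduced_word W {s, t} w) \<noteq> hd (reduced_word W {s, t} w')"
    then show "hecke_mult Gp B (Delta G B w) (Delta G B w') = Delta G B (w \<otimes>\<^bsub>W\<^esub> w')"
      unfolding Gp B' W' by (rule mult(1))
  next
    fix w w' r u m assume w: "w \<in> carrier W" "w' \<in> carrier W"
      and "reduced_word W {s, t} w \<noteq> []" "reduced_word W {s, t} w' \<noteq> []"
        "last (reduced_word W {s, t} w) = r" "hd (reduced_word W {s, t} w') = r" "{r, u} = {s, t}"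
        "m = min (length (reduced_word W {s, t} w)) (length (reduced_word W {s, t} w'))"
    then show "hecke_mult Gp B (Delta G B w) (Delta G B w') =
        (\<Prod>r\<leftarrow>last_letters m (reduced_word W {s, t} w). of_nat (rcoset_number Gp B (weyl_double_coset Gp B r)))
          *\<^sub>H Delta G B (word_prod W (drop_last_letters m (reduced_word W {s, t} w) @ drop m (reduced_word W {s, t} w')))
        + (\<Sum>j<m. ((\<Prod>r\<leftarrow>last_letters j (reduced_word W {s, t} w). of_nat (rcoset_number Gp B (weyl_double_coset Gp B r)))
              * (of_nat (rcoset_number Gp B (weyl_double_coset Gp B (if even j then r else u))) - 1))
            *\<^sub>H Delta G B (word_prod W (drop_last_letters (j + 1) (reduced_word W {s, t} w)
                   @ [reduced_word W {s, t} w' ! j] @ drop (j + 1) (reduced_word W {s, t} w'))))"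
      unfolding Gp B' W' by (rule mult(2))
  next
    fix i assume i: "i \<in> N" "\<forall>v\<in>e. \<phi> i v \<in> e \<and> \<phi> i v \<noteq> v"
    interpret F: weyl_flip G X \<phi> l i by (rule flip[OF i])
    show "hecke_basis G B = Delta G B ` carrier W \<union> (\<lambda>w. Delta G B ((T #>\<^bsub>G\<^esub> i) \<otimes>\<^bsub>Wt\<^esub> w)) ` carrier W"
      unfolding B' W' Wt' T' by (rule F.hecke_basis_G)
    fix w w' assume w: "w \<in> carrier W" "w' \<in> carrier W"
    note w' = w[unfolded W']
    note rel = F.multiplication_Wt[OF dih bar' bar(2,3) w']
    show "hecke_mult G B (Delta G B w) (Delta G B w') = hecke_mult Gp B (Delta G B w) (Delta G B w')"
      unfolding Gp B' by (rule S.hecke_mult_Gp[OF w'])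
    show "hecke_mult G B (Delta G B ((T #>\<^bsub>G\<^esub> i) \<otimes>\<^bsub>Wt\<^esub> w)) (Delta G B w') =
        hecke_mult G B (Delta G B (T #>\<^bsub>G\<^esub> i)) (hecke_mult G B (Delta G B w) (Delta G B w'))"
      unfolding B' Wt' T' by (rule rel(1))
    show "hecke_mult G B (Delta G B w) (Delta G B ((T #>\<^bsub>G\<^esub> i) \<otimes>\<^bsub>Wt\<^esub> w')) =
        hecke_mult G B (Delta G B (T #>\<^bsub>G\<^esub> i)) (hecke_mult G B (Delta G B (bar w)) (Delta G B w'))"
      unfolding B' Wt' T' by (rule rel(2))
    show "hecke_mult G B (Delta G B ((T #>\<^bsub>G\<^esub> i) \<otimes>\<^bsub>Wt\<^esub> w)) (Delta G B ((T #>\<^bsub>G\<^esub> i) \<otimes>\<^bsub>Wt\<^esub> w')) =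
        hecke_mult G B (Delta G B (bar w)) (Delta G B w')"
      unfolding B' Wt' T' by (rule rel(3))
  qed
qed

end
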